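(* Let $\nu$ be a non-atomic, $\sigma$-finite measure on $[0,1]$ with $\nu([0,1])=\infty$ and $\int_0^1 w\,\nu(\mathrm{d}w)<\infty$, with density denoted $\nu(w)$, and let $N_t$ and $N_t^{(e)}$ be the numbers of vertices and of edges (counted with multiplicity) at step $t$ of the edge-exchangeable multigraph sequence constructed from a Poisson process of weights with rate measure $\nu$. Assume that, as $w\downarrow 0$, $$\nu(w)\sim c\,w^{-2}\ell(w^{-1}),$$ where $c>0$, $\ell$ is slowly varying at infinity, and $$\ell_1(x):=\int_x^\infty u^{-1}\ell(u)\,\mathrm{d}u<\infty$$ for all sufficiently large $x$. If $\ell_1(x\ell_1(x))\sim \ell_1(x)$ as $x\to\infty$, then almost surely, as $t\to\infty$, $$N_t^{(e)}=\Theta\!\left(\frac{N_t}{\ell_1(N_t)}\right).$$ In particular, if $\ell(x)=(\log x)^a$ with $a<-1$, then almost surely, as $t\to\infty$, $$N_t^{(e)}=\Theta\!\left(N_t(\log N_t)^{-a-1}\right).$$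
   Context: Graph model. Let $\mathcal W=\{w_i\}_{i\ge 1}$ be an enumeration of the points of a Poisson point process on $[0,1]$ with rate (intensity) measure $\nu$, where $\nu$ is non-atomic and $\sigma$-finite with $\nu([0,1])=\infty$ and $\int_0^1 w\,\nu(\mathrm{d}w)<\infty$ (so a.s. there are countably infinitely many weights and $\sum_i w_i<\infty$). Vertices are indexed by $i\in\mathbb N$. Conditionally on $\mathcal W$, for every step $p=1,2,\dots$ and every unordered pair $\{i,j\}$ with $i\ne j$, let $m^p_{\{i,j\}}\sim\mathrm{Bernoulli}(w_iw_j)$, independently over all $p$ and all pairs (there are no self-loops). At step $p$, $m^p_{\{i,j\}}$ copies of the edge $\{i,j\}$ are added to the multigraph. Put $M^t_{\{i,j\}}=\sum_{p=1}^t m^p_{\{i,j\}}$. The number of vertices (only vertices with at least one incident edge are counted) and the number of edges at step $t$ are $$N_t=\sum_i \mathbf 1\Big\{\sum_{j\ne i}M^t_{\{i,j\}}>0\Big\},\qquad N_t^{(e)}=\frac12\sum_{i\ne j}M^t_{\{i,j\}}.$$ Notation. $\nu(w)$ denotes the density of $\nu$ with respect to Lebesgue measure. $f\sim g$ means $f/g\to1$. $f=\Theta(g)$ means that there are constants $0<C_1\le C_2$ with $C_1|g|\le|f|\le C_2|g|$ in a neighbourhood of the limit point; for random quantities this is required to hold almost surely (constants and neighbourhood may depend on the realization). A function $\ell:(0,\infty)\to(0,\infty)$ is slowly varying (at infinity) if $\ell(cx)/\ell(x)\to1$ as $x\to\infty$ for all $c>0$; only the values of $\ell$ at large arguments matter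 here. *)

theory Defs
  imports "HOL-Probability.Probability" "HOL-Library.Landau_Symbols"
begin

definition nonatomic :: "'a measure \<Rightarrow> bool" where
  "nonatomic N \<longleftrightarrow>
     (\<forall>A\<in>sets N. emeasure N A > 0 \<longrightarrow>
        (\<exists>B\<in>sets N. B \<subseteq> A \<and> 0 < emeasure N B \<and> emeasure N B < emeasure N A))"

locale rate_measure = sigma_finite_measure \<nu> for \<nu> :: "real measure" +
  assumes sets_rate: "sets \<nu> = sets (restrict_space borel {0..1})"
    and nonatomic_rate: "nonatomic \<nu>"
    and infinite_rate: "emeasure \<nu> {0..1} = \<infinity>"
    and finite_mean_rate: "(\<integral>\<^sup>+ w. ennreal w \<partial>\<nu>) < \<infinity>"

definition num_points :: "(nat \<Rightarrow> 'a \<Rightarrow> real) \<Rightarrow> real set \<Rightarrow> 'a \<Rightarrow> ennreal" where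
  "num_points w A \<omega> = emeasure (count_space UNIV) {i. w i \<omega> \<in> A}"

(* The random variables w i enumerate (with multiplicity) the points of a Poisson process
   with mean measure \<nu>. The Poisson probabilities are spelled out because poisson_pmf
   is only available for a strictly positive rate, and sets of measure 0 are needed too. *)
locale poisson_process = prob_space M + rate_measure \<nu>
  for M :: "'a measure" and \<nu> :: "real measure" +
  fixes w :: "nat \<Rightarrow> 'a \<Rightarrow> real"
  assumes weight_measurable: "\<And>i. random_variable \<nu> (w i)"
    and poisson_counts:
      "\<And>A k. A \<in> sets \<nu> \<Longrightarrow> emeasure \<nu> A < \<infinity> \<Longrightarrow>
         prob {\<omega> \<in> space M. num_points w A \<omega> = of_nat k} =
           measure \<nu> A ^ k / fact k * exp (- measure \<nu> A)"
    and infinite_counts: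
      "\<And>A. A \<in> sets \<nu> \<Longrightarrow> emeasure \<nu> A = \<infinity> \<Longrightarrow>
         AE \<omega> in M. num_points w A \<omega> = \<infinity>"
    and indep_counts:
      "\<And>A (n :: nat). A ` {..<n} \<subseteq> sets \<nu> \<Longrightarrow> disjoint_family_on A {..<n} \<Longrightarrow>
         indep_vars (\<lambda>_. borel) (\<lambda>k. num_points w (A k)) {..<n}"

definition vertex_pairs :: "nat set set" where
  "vertex_pairs = {e. card e = 2}"

definition weight_algebra :: "'a measure \<Rightarrow> real measure \<Rightarrow> (nat \<Rightarrow> 'a \<Rightarrow> real) \<Rightarrow> 'a measure" where
  "weight_algebra M \<nu> w =
     vimage_algebra (space M) (\<lambda>\<omega> i. w i \<omega>) (Pi\<^sub>M UNIV (\<lambda>_. \<nu>))"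

(* m p e says that at step p a copy of the edge e is added. Assumption
   conditional_bernoulli gives the joint conditional law of finitely many m p e given the
   weights: they are independent, and m p {i, j} is Bernoulli with parameter w i * w j. *)
locale poisson_multigraph = poisson_process M \<nu> w
  for M :: "'a measure" and \<nu> :: "real measure" and w :: "nat \<Rightarrow> 'a \<Rightarrow> real" +
  fixes m :: "nat \<Rightarrow> nat set \<Rightarrow> 'a \<Rightarrow> bool"
  assumes edge_measurable:
      "\<And>p e. p \<ge> 1 \<Longrightarrow> e \<in> vertex_pairs \<Longrightarrow> random_variable (count_space UNIV) (m p e)"
    and conditional_bernoulli:
      "\<And>I b. finite I \<Longrightarrow> I \<subseteq> {1..} \<times> vertex_pairs \<Longrightarrow>
         AE \<omega> in M.
           real_cond_exp M (weight_algebra M \<nu> w)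
             (indicator {\<omega> \<in> space M. \<forall>(p, e)\<in>I. m p e \<omega> = b p e}) \<omega> =
           (\<Prod>(p, e)\<in>I. pmf (bernoulli_pmf (\<Prod>i\<in>e. w i \<omega>)) (b p e))"

definition multiplicity_at ::
  "(nat \<Rightarrow> nat set \<Rightarrow> 'a \<Rightarrow> bool) \<Rightarrow> nat \<Rightarrow> nat set \<Rightarrow> 'a \<Rightarrow> nat" where
  "multiplicity_at m t e \<omega> = (\<Sum>p = 1..t. of_bool (m p e \<omega>))"

(* Both counts are almost surely finite; the value \<infinity> is possible on a null set. *)
definition num_vertices :: "(nat \<Rightarrow> nat set \<Rightarrow> 'a \<Rightarrow> bool) \<Rightarrow> nat \<Rightarrow> 'a \<Rightarrow> ennreal" where
  "num_vertices m t \<omega> =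
     (\<Sum>\<^sub>\<infinity>i. of_bool ((\<Sum>\<^sub>\<infinity>j\<in>UNIV - {i}. (of_nat (multiplicity_at m t {i, j} \<omega>) :: ennreal)) > 0))"

definition num_edges :: "(nat \<Rightarrow> nat set \<Rightarrow> 'a \<Rightarrow> bool) \<Rightarrow> nat \<Rightarrow> 'a \<Rightarrow> ennreal" where
  "num_edges m t \<omega> =
     (\<Sum>\<^sub>\<infinity>(i, j)\<in>{(i, j). i \<noteq> j}. of_nat (multiplicity_at m t {i, j} \<omega>)) / 2"

definition slowly_varying :: "(real \<Rightarrow> real) \<Rightarrow> bool" where
  "slowly_varying L \<longleftrightarrow>
     (\<forall>x>0. L x > 0) \<and> (\<forall>c>0. ((\<lambda>x. L (c * x) / L x) \<longlongrightarrow> 1) at_top)"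

definition tail_integral :: "(real \<Rightarrow> real) \<Rightarrow> real \<Rightarrow> real" where
  "tail_integral L x = (LBINT u:{x..}. L u / u)"

end

theory Submission
  imports Defs
begin

text \<open>
  Fix a realization of the weights, with finite total mass. A step then adds
  each edge $\{i,j\}$ with probability $w_i w_j$, independently, so the number of edges grows
  linearly: $N^{(e)}_t$ is of the order of $t$. The point is that $N_t$ is of the
  order of $t\,\ell_1(t)$. Granted this, $N_t/\ell_1(N_t)$ is of the order of
  $t\,\ell_1(t)/\ell_1(t\,\ell_1(t))$, and the hypothesis
  $\ell_1(x\,\ell_1(x))\sim\ell_1(x)$ reduces this to $t$ (lemma \<open>bigtheta_inversion\<close>).

  A vertex of weight $w$ is active at time $t$ with probability comparable to $\min(1,tw)$, so
  $N_t$ should be comparable to $\int\min(1,tw)\,\nu(dw)$. The weights below $1/t$ contribute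
  $t\int_0^{1/t}w\,\nu(dw)$, which the substitution $u=1/w$ turns into about $c\,t\,\ell_1(t)$; the
  number of weights above $1/t$ is at most of this order. Almost sure statements come
  from second moments, by cutting weights and time at the powers of two:

  \<^item> The expected number of weights in the shell $(2^{-k-1},2^{-k}]$ grows geometrically in $k$, so
    Chebyshev's inequality and the Borel-Cantelli lemma show that the actual number is of the
    same order for all large $k$. Everything the graph needs to know about the weights
    follows by summation over shells (\<open>AE_typical_weights\<close>).

  \<^item> Given the weights, the number of occurring events in a pairwise independent family has a variance
    bounded by its mean, which yields a law of large numbers along the powers of two
    (\<open>cond_law_of_large_numbers\<close>).

  \<^item> The events that different vertices are active are dependent. They are
    therefore bracketed by independent families (\<open>AE_num_vertices_growth\<close>): from above, by the vertices
    of weight more than $1/t$ together with the ends of the edges that touch a vertex of smaller weight;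
    from below, by the neighbours of one fixed vertex of positive weight.

  Monotonicity in $t$ fills the gaps between the powers of two (\<open>dyadic_interpolation\<close>). The
  logarithmic case needs only the explicit tail $\ell_1(x)=(\log x)^{a+1}/(-a-1)$.
\<close>

section \<open>Conditional probabilities given a sub-sigma-algebra\<close>

text \<open>Testing on the sets of the sub-sigma-algebra alone makes complements and unions of events a
  matter of linearity of the integral; the bounds hold at every point so that versions of
  conditional probabilities can be multiplied and summed without exceptional sets.\<close>
definition has_cond_prob :: "'a measure \<Rightarrow> 'a measure \<Rightarrow> 'a set \<Rightarrow> ('a \<Rightarrow> real) \<Rightarrow> bool" where
  "has_cond_prob M F E q \<longleftrightarrow> E \<in> sets M \<and> q \<in> borel_measurable F \<and> (\<forall>\<omega>\<in>space M. 0 \<le> q \<omega> \<and> q \<omega> \<le> 1) \<and>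
     (\<forall>A\<in>sets F. measure M (A \<inter> E) = (\<integral>\<omega>. indicator A \<omega> * q \<omega> \<partial>M))"

lemma cond_probD:
  assumes "has_cond_prob M F E q"
  shows "E \<in> sets M" "q \<in> borel_measurable F" "\<And>\<omega>. \<omega> \<in> space M \<Longrightarrow> 0 \<le> q \<omega>"
    "\<And>\<omega>. \<omega> \<in> space M \<Longrightarrow> q \<omega> \<le> 1"
    "\<And>A. A \<in> sets F \<Longrightarrow> measure M (A \<inter> E) = (\<integral>\<omega>. indicator A \<omega> * q \<omega> \<partial>M)"
  using assms unfolding has_cond_prob_def by auto

context finite_measure_subalgebra
begin

lemma cond_prob_integrable:
  assumes "has_cond_prob M F E q" "A \<in> sets F"
  shows "integrable M (\<lambda>\<omega>. indicator A \<omega> * q \<omega> :: real)"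
proof -
  note [measurable] = measurable_from_subalg[OF subalg cond_probD(2)[OF assms(1)]]
  have [measurable]: "A \<in> sets M"
    using assms(2) subalg unfolding subalgebra_def by auto
  show ?thesis
    by (rule integrable_const_bound[where B=1])
      (use cond_probD(3,4)[OF assms(1)] in \<open>auto simp: indicator_def\<close>)
qed

lemma cond_probI_real_cond_exp:
  assumes E: "E \<in> sets M" and q: "q \<in> borel_measurable F"
    and q01: "\<And>\<omega>. \<omega> \<in> space M \<Longrightarrow> 0 \<le> q \<omega>" "\<And>\<omega>. \<omega> \<in> space M \<Longrightarrow> q \<omega> \<le> 1"
    and ae: "AE \<omega> in M. real_cond_exp M F (indicator E) \<omega> = q \<omega>"
  shows "has_cond_prob M F E q"
  unfolding has_cond_prob_def
proof (intro conjI ballI)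
  fix A assume A: "A \<in> sets F"
  have AM[measurable]: "A \<in> sets M" "E \<in> sets M"
    using A E subalg unfolding subalgebra_def by auto
  have q'[measurable]: "q \<in> borel_measurable M" by (rule measurable_from_subalg[OF subalg q])
  have "measure M (A \<inter> E) = (\<integral>\<omega>. indicator A \<omega> * indicator E \<omega> \<partial>M)"
    using AM by (simp flip: indicator_inter_arith)
  also have "\<dots> = (\<integral>\<omega>. indicator A \<omega> * real_cond_exp M F (indicator E) \<omega> \<partial>M)"
    using A E by (intro real_cond_exp_intg(2)[symmetric])
      (auto simp flip: indicator_inter_arith simp: less_top[symmetric] intro!: integrable_real_indicator)
  also have "\<dots> = (\<integral>\<omega>. indicator A \<omega> * q \<omega> \<partial>M)"
    by (rule integral_cong_AE) (use ae in auto)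
  finally show "measure M (A \<inter> E) = (\<integral>\<omega>. indicator A \<omega> * q \<omega> \<partial>M)" .
qed (use assms in auto)

text \<open>Second moments are computed by weighting an event with the conditional mean of a whole family,
  so the defining identity is needed for all nonnegative weights, not just for indicators.\<close>
lemma nn_integral_cond_prob:
  fixes G :: "'a \<Rightarrow> ennreal"
  assumes cp: "has_cond_prob M F E q" and G: "G \<in> borel_measurable F"
  shows "(\<integral>\<^sup>+\<omega>. G \<omega> * indicator E \<omega> \<partial>M) = (\<integral>\<^sup>+\<omega>. G \<omega> * ennreal (q \<omega>) \<partial>M)"
  using G
proof (induction rule: borel_measurable_induct)
  case (cong f g)
  then have "\<And>\<omega>. \<omega> \<in> space M \<Longrightarrow> f \<omega> = g \<omega>" using subalg by (auto simp: subalgebra_def)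
  then show ?case using cong(4) by (simp cong: nn_integral_cong)
next
  case (set A)
  have [measurable]: "A \<in> sets M" "E \<in> sets M"
    using set cond_probD(1)[OF cp] subalg unfolding subalgebra_def by auto
  have "(\<integral>\<^sup>+\<omega>. indicator A \<omega> * indicator E \<omega> \<partial>M) = ennreal (measure M (A \<inter> E))"
    by (simp flip: indicator_inter_arith add: emeasure_eq_measure)
  also have "\<dots> = ennreal (\<integral>\<omega>. indicator A \<omega> * q \<omega> \<partial>M)"
    using cond_probD(5)[OF cp set] by simp
  also have "\<dots> = (\<integral>\<^sup>+\<omega>. ennreal (indicator A \<omega> * q \<omega>) \<partial>M)"
    using cond_prob_integrable[OF cp set] cond_probD(3)[OF cp]
    by (intro nn_integral_eq_integral[symmetric]) auto
  also have "\<dots> = (\<integral>\<^sup>+\<omega>. indicator A \<omega> * ennreal (q \<omega>) \<partial>M)"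
    by (intro nn_integral_cong) (auto simp: indicator_def)
  finally show ?case .
next
  case (mult u c)
  note [measurable] = measurable_from_subalg[OF subalg mult(2)] cond_probD(1)[OF cp]
     measurable_from_subalg[OF subalg cond_probD(2)[OF cp]]
  show ?case using mult.IH by (simp add: mult.assoc nn_integral_cmult)
next
  case (add u v)
  note [measurable] = measurable_from_subalg[OF subalg add(1)] measurable_from_subalg[OF subalg add(3)] 
     cond_probD(1)[OF cp] measurable_from_subalg[OF subalg cond_probD(2)[OF cp]]
  show ?case using add by (simp add: distrib_right nn_integral_add)
next
  case (seq U)
  note [measurable] = measurable_from_subalg[OF subalg seq(1)] cond_probD(1)[OF cp]
     measurable_from_subalg[OF subalg cond_probD(2)[OF cp]]
  have *: "(\<integral>\<^sup>+\<omega>. (SUP i. U i \<omega>) * h \<omega> \<partial>M) = (SUP i. \<integral>\<^sup>+\<omega>. U i \<omega> * h \<omega> \<partial>M)"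
    if [measurable]: "h \<in> borel_measurable M" for h :: "'a \<Rightarrow> ennreal"
    by (subst nn_integral_monotone_convergence_SUP[symmetric])
      (use seq(3) in \<open>auto simp: SUP_mult_right_ennreal incseq_def le_fun_def intro!: mult_right_mono\<close>)
  show ?case
    using seq.IH by (simp add: * SUP_apply image_comp)
qed

text \<open>Given the sub-sigma-algebra, one of its sets is a constant. This is how edges are selected
  according to the weights of their ends.\<close>
lemma cond_prob_Int:
  assumes cp: "has_cond_prob M F E q" and B: "B \<in> sets F"
  shows "has_cond_prob M F (E \<inter> B) (\<lambda>\<omega>. q \<omega> * indicator B \<omega>)"
  unfolding has_cond_prob_def
proof (intro conjI ballI)
  note [measurable] = cond_probD(2)[OF cp] B
  show "E \<inter> B \<in> sets M"
    using B cond_probD(1)[OF cp] subalg unfolding subalgebra_def by (meson sets.Int subsetD)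
  show "(\<lambda>\<omega>. q \<omega> * indicator B \<omega>) \<in> borel_measurable F" by measurable
  fix A assume A: "A \<in> sets F"
  show "measure M (A \<inter> (E \<inter> B)) = (\<integral>\<omega>. indicator A \<omega> * (q \<omega> * indicator B \<omega>) \<partial>M)"
    using cond_probD(5)[OF cp, of "A \<inter> B"] A B
    by (simp add: indicator_inter_arith mult_ac Int_ac)
qed (use cond_probD(3,4)[OF cp] in \<open>auto simp: indicator_def\<close>)

lemma cond_prob_compl:
  assumes cp: "has_cond_prob M F E q"
  shows "has_cond_prob M F (space M - E) (\<lambda>\<omega>. 1 - q \<omega>)"
  unfolding has_cond_prob_def
proof (intro conjI ballI)
  note [measurable] = cond_probD(2)[OF cp] cond_probD(1)[OF cp]
  show "space M - E \<in> sets M" by measurable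
  show "(\<lambda>\<omega>. 1 - q \<omega>) \<in> borel_measurable F" by measurable
  fix A assume A: "A \<in> sets F"
  have [measurable]: "A \<in> sets M" using A subalg unfolding subalgebra_def by auto
  have "A \<inter> (space M - E) = A - A \<inter> E" using sets.sets_into_space[of A M] by auto
  then have "measure M (A \<inter> (space M - E)) = measure M A - measure M (A \<inter> E)"
    by (simp add: finite_measure_Diff)
  also have "\<dots> = (\<integral>\<omega>. indicator A \<omega> \<partial>M) - (\<integral>\<omega>. indicator A \<omega> * q \<omega> \<partial>M)"
    using cond_probD(5)[OF cp A] by simp
  also have "\<dots> = (\<integral>\<omega>. indicator A \<omega> - indicator A \<omega> * q \<omega> \<partial>M)"
    using cond_prob_integrable[OF cp A] by (intro Bochner_Integration.integral_diff[symmetric]) (auto simp: less_top[symmetric] intro!: integrable_real_indicator)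
  finally show "measure M (A \<inter> (space M - E)) = (\<integral>\<omega>. indicator A \<omega> * (1 - q \<omega>) \<partial>M)"
    by (simp add: algebra_simps)
qed (use cond_probD(3,4)[OF cp] in \<open>auto\<close>)

text \<open>By inclusion and exclusion, independence passes to the complements.\<close>
lemma cond_prob_compl_Int_compl:
  assumes cp: "has_cond_prob M F E q" "has_cond_prob M F E' q'"
    "has_cond_prob M F (E \<inter> E') (\<lambda>\<omega>. q \<omega> * q' \<omega>)"
  shows "has_cond_prob M F ((space M - E) \<inter> (space M - E')) (\<lambda>\<omega>. (1 - q \<omega>) * (1 - q' \<omega>))"
  unfolding has_cond_prob_def
proof (intro conjI ballI)
  note [measurable] = cond_probD(2)[OF cp(1)] cond_probD(1)[OF cp(1)]
    cond_probD(2)[OF cp(2)] cond_probD(1)[OF cp(2)]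
  show "(space M - E) \<inter> (space M - E') \<in> sets M" by measurable
  show "(\<lambda>\<omega>. (1 - q \<omega>) * (1 - q' \<omega>)) \<in> borel_measurable F" by measurable
  fix A assume A: "A \<in> sets F"
  have [measurable]: "A \<in> sets M" using A subalg unfolding subalgebra_def by auto
  note int = cond_prob_integrable[OF cp(1) A] cond_prob_integrable[OF cp(2) A] cond_prob_integrable[OF cp(3) A]
  have intA: "integrable M (indicator A :: 'a \<Rightarrow> real)"
    by (auto simp: less_top[symmetric] intro!: integrable_real_indicator)
  have "A \<inter> ((space M - E) \<inter> (space M - E')) = A - (A \<inter> E \<union> A \<inter> E')"
    using sets.sets_into_space[of A M] by auto
  then have "measure M (A \<inter> ((space M - E) \<inter> (space M - E'))) = measure M A - measure M (A \<inter> E \<union> A \<inter> E')"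
    by (simp only:) (rule finite_measure_Diff, auto)
  also have "measure M (A \<inter> E \<union> A \<inter> E') = measure M (A \<inter> E) + measure M (A \<inter> E') - measure M (A \<inter> (E \<inter> E'))"
  proof -
    have "measure M (A \<inter> E \<union> A \<inter> E') = measure M (A \<inter> E) + measure M (A \<inter> E') - measure M ((A \<inter> E) \<inter> (A \<inter> E'))"
      by (rule measure_Un3) (auto simp: fmeasurable_eq_sets)
    also have "(A \<inter> E) \<inter> (A \<inter> E') = A \<inter> (E \<inter> E')" by auto
    finally show ?thesis .
  qed
  also have "measure M A - (measure M (A \<inter> E) + measure M (A \<inter> E') - measure M (A \<inter> (E \<inter> E'))) =
     (\<integral>\<omega>. indicator A \<omega> \<partial>M) - (\<integral>\<omega>. indicator A \<omega> * q \<omega> \<partial>M) - (\<integral>\<omega>. indicator A \<omega> * q' \<omega> \<partial>M)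
      + (\<integral>\<omega>. indicator A \<omega> * (q \<omega> * q' \<omega>) \<partial>M)"
    using cond_probD(5)[OF cp(1) A] cond_probD(5)[OF cp(2) A] cond_probD(5)[OF cp(3) A] by simp
  also have "\<dots> = (\<integral>\<omega>. indicator A \<omega> - indicator A \<omega> * q \<omega> - indicator A \<omega> * q' \<omega> + indicator A \<omega> * (q \<omega> * q' \<omega>) \<partial>M)"
    using int intA by simp
  also have "\<dots> = (\<integral>\<omega>. indicator A \<omega> * ((1 - q \<omega>) * (1 - q' \<omega>)) \<partial>M)"
    by (simp add: algebra_simps)
  finally show "measure M (A \<inter> ((space M - E) \<inter> (space M - E'))) = (\<integral>\<omega>. indicator A \<omega> * ((1 - q \<omega>) * (1 - q' \<omega>)) \<partial>M)" .
qed (use cond_probD(3,4)[OF cp(1)] cond_probD(3,4)[OF cp(2)] in \<open>auto simp: mult_le_one\<close>)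

end

section \<open>Sums of conditionally pairwise independent events\<close>

definition cond_pairwise_indep ::
  "'a measure \<Rightarrow> 'a measure \<Rightarrow> 'i set \<Rightarrow> ('i \<Rightarrow> 'a set) \<Rightarrow> ('i \<Rightarrow> 'a \<Rightarrow> real) \<Rightarrow> bool" where
  "cond_pairwise_indep M F I E q \<longleftrightarrow>
     (\<forall>i\<in>I. has_cond_prob M F (E i) (q i)) \<and>
     (\<forall>i\<in>I. \<forall>j\<in>I. i \<noteq> j \<longrightarrow> has_cond_prob M F (E i \<inter> E j) (\<lambda>\<omega>. q i \<omega> * q j \<omega>))"

definition occurrences :: "'i set \<Rightarrow> ('i \<Rightarrow> 'a set) \<Rightarrow> 'a \<Rightarrow> ennreal" where
  "occurrences I E \<omega> = (\<integral>\<^sup>+i. indicator (E i) \<omega> \<partial>count_space I)"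

definition cond_mean :: "'i set \<Rightarrow> ('i \<Rightarrow> 'a \<Rightarrow> real) \<Rightarrow> 'a \<Rightarrow> ennreal" where
  "cond_mean I q \<omega> = (\<integral>\<^sup>+i. ennreal (q i \<omega>) \<partial>count_space I)"

lemma measurable_nn_integral_count_space:
  fixes f :: "'i \<Rightarrow> 'a \<Rightarrow> ennreal"
  assumes I: "countable I" and f: "\<And>i. i \<in> I \<Longrightarrow> f i \<in> borel_measurable N"
  shows "(\<lambda>\<omega>. \<integral>\<^sup>+i. f i \<omega> \<partial>count_space I) \<in> borel_measurable N"
proof -
  interpret sigma_finite_measure "count_space I" by (rule sigma_finite_measure_count_space_countable[OF I])
  have "(\<lambda>(i, \<omega>). f i \<omega>) \<in> borel_measurable (count_space I \<Otimes>\<^sub>M N)"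
    by (rule measurable_pair_measure_countable1[OF I]) (use f in auto)
  then have "(\<lambda>(\<omega>, i). f i \<omega>) \<in> borel_measurable (N \<Otimes>\<^sub>M count_space I)"
    by (subst measurable_pair_swap_iff) (simp add: case_prod_beta)
  then show ?thesis by (rule borel_measurable_nn_integral)
qed

context finite_measure_subalgebra
begin

lemma nn_integral_occurrences:
  fixes G :: "'a \<Rightarrow> ennreal"
  assumes I: "countable I" and cp: "\<And>i. i \<in> I \<Longrightarrow> has_cond_prob M F (E i) (q i)"
    and G: "G \<in> borel_measurable F"
  shows "(\<integral>\<^sup>+\<omega>. G \<omega> * occurrences I E \<omega> \<partial>M) = (\<integral>\<^sup>+\<omega>. G \<omega> * cond_mean I q \<omega> \<partial>M)"
proof -
  note GM[measurable] = measurable_from_subalg[OF subalg G]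
  have [measurable]: "E i \<in> sets M" "q i \<in> borel_measurable M" if "i \<in> I" for i
    using cond_probD(1)[OF cp[OF that]] measurable_from_subalg[OF subalg cond_probD(2)[OF cp[OF that]]] by auto
  have "(\<integral>\<^sup>+\<omega>. G \<omega> * occurrences I E \<omega> \<partial>M) = (\<integral>\<^sup>+\<omega>. \<integral>\<^sup>+i. G \<omega> * indicator (E i) \<omega> \<partial>count_space I \<partial>M)"
    unfolding occurrences_def by (simp add: nn_integral_cmult)
  also have "\<dots> = (\<integral>\<^sup>+i. \<integral>\<^sup>+\<omega>. G \<omega> * indicator (E i) \<omega> \<partial>M \<partial>count_space I)"
    by (rule nn_integral_count_space_nn_integral[OF I]) auto
  also have "\<dots> = (\<integral>\<^sup>+i. \<integral>\<^sup>+\<omega>. G \<omega> * ennreal (q i \<omega>) \<partial>M \<partial>count_space I)"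
    by (rule nn_integral_cong) (simp add: nn_integral_cond_prob[OF cp G])
  also have "\<dots> = (\<integral>\<^sup>+\<omega>. \<integral>\<^sup>+i. G \<omega> * ennreal (q i \<omega>) \<partial>count_space I \<partial>M)"
    by (rule nn_integral_count_space_nn_integral[OF I, symmetric]) auto
  also have "\<dots> = (\<integral>\<^sup>+\<omega>. G \<omega> * cond_mean I q \<omega> \<partial>M)"
    unfolding cond_mean_def by (simp add: nn_integral_cmult)
  finally show ?thesis .
qed

text \<open>Off the diagonal pairwise independence gives the product of the conditional probabilities;
  the diagonal contributes at most the conditional mean.\<close>
lemma nn_integral_occurrences_square_le:
  fixes G :: "'a \<Rightarrow> ennreal"
  assumes I: "countable I" and cp: "cond_pairwise_indep M F I E q"
    and G: "G \<in> borel_measurable F"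
  shows "(\<integral>\<^sup>+\<omega>. G \<omega> * (occurrences I E \<omega> * occurrences I E \<omega>) \<partial>M)
    \<le> (\<integral>\<^sup>+\<omega>. G \<omega> * (cond_mean I q \<omega> + cond_mean I q \<omega> * cond_mean I q \<omega>) \<partial>M)"
proof -
  have cp1: "has_cond_prob M F (E i) (q i)" if "i \<in> I" for i using cp that unfolding cond_pairwise_indep_def by auto
  have cp2: "has_cond_prob M F (E i \<inter> E j) (\<lambda>\<omega>. q i \<omega> * q j \<omega>)" if "i \<in> I" "j \<in> I" "i \<noteq> j" for i j
    using cp that unfolding cond_pairwise_indep_def by auto
  note GM[measurable] = measurable_from_subalg[OF subalg G]
  have m[measurable]: "E i \<in> sets M" "q i \<in> borel_measurable M" if "i \<in> I" for i
    using cond_probD(1)[OF cp1[OF that]] measurable_from_subalg[OF subalg cond_probD(2)[OF cp1[OF that]]] by auto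
  define d where "d i j = (if i = j then 1 else 0 :: ennreal)" for i j :: 'b
  define joint where "joint i j \<omega> = G \<omega> * (indicator (E i) \<omega> * indicator (E j) \<omega>)" for i j \<omega>
  define bound where "bound i j \<omega> = G \<omega> * (ennreal (q i \<omega>) * d i j + ennreal (q i \<omega>) * ennreal (q j \<omega>))" for i j \<omega>
  have [measurable]: "joint i j \<in> borel_measurable M" "bound i j \<in> borel_measurable M" if "i \<in> I" "j \<in> I" for i j
    unfolding joint_def[abs_def] bound_def[abs_def] using that by measurable
  have pair: "(\<integral>\<^sup>+\<omega>. joint i j \<omega> \<partial>M)
     \<le> (\<integral>\<^sup>+\<omega>. bound i j \<omega> \<partial>M)"
    if ij: "i \<in> I" "j \<in> I" for i j
  proof (cases "i = j")
    case True
    have "(\<integral>\<^sup>+\<omega>. joint i j \<omega> \<partial>M) = (\<integral>\<^sup>+\<omega>. G \<omega> * indicator (E i) \<omega> \<partial>M)"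
      using True by (intro nn_integral_cong) (auto simp: joint_def indicator_def)
    also have "\<dots> = (\<integral>\<^sup>+\<omega>. G \<omega> * ennreal (q i \<omega>) \<partial>M)" by (rule nn_integral_cond_prob[OF cp1[OF ij(1)] G])
    also have "\<dots> \<le> (\<integral>\<^sup>+\<omega>. bound i j \<omega> \<partial>M)"
      unfolding bound_def using True by (intro nn_integral_mono mult_left_mono) (auto simp: d_def)
    finally show ?thesis .
  next
    case False
    have "(\<integral>\<^sup>+\<omega>. joint i j \<omega> \<partial>M) = (\<integral>\<^sup>+\<omega>. G \<omega> * indicator (E i \<inter> E j) \<omega> \<partial>M)"
      by (simp add: joint_def indicator_inter_arith)
    also have "\<dots> = (\<integral>\<^sup>+\<omega>. G \<omega> * ennreal (q i \<omega> * q j \<omega>) \<partial>M)" by (rule nn_integral_cond_prob[OF cp2[OF ij False] G])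
    also have "\<dots> = (\<integral>\<^sup>+\<omega>. bound i j \<omega> \<partial>M)"
      using cond_probD(3)[OF cp1[OF ij(1)]] cond_probD(3)[OF cp1[OF ij(2)]]
      by (intro nn_integral_cong) (auto simp: bound_def d_def False ennreal_mult)
    finally show ?thesis by simp
  qed
  have "(\<integral>\<^sup>+\<omega>. G \<omega> * (occurrences I E \<omega> * occurrences I E \<omega>) \<partial>M)
     = (\<integral>\<^sup>+\<omega>. \<integral>\<^sup>+i. \<integral>\<^sup>+j. joint i j \<omega> \<partial>count_space I \<partial>count_space I \<partial>M)"
    unfolding occurrences_def joint_def by (simp add: nn_integral_cmult nn_integral_multc)
  also have "\<dots> = (\<integral>\<^sup>+i. \<integral>\<^sup>+\<omega>. \<integral>\<^sup>+j. joint i j \<omega> \<partial>count_space I \<partial>M \<partial>count_space I)"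
    by (rule nn_integral_count_space_nn_integral[OF I], rule measurable_nn_integral_count_space[OF I]) auto
  also have "\<dots> = (\<integral>\<^sup>+i. \<integral>\<^sup>+j. \<integral>\<^sup>+\<omega>. joint i j \<omega> \<partial>M \<partial>count_space I \<partial>count_space I)"
    by (intro nn_integral_cong nn_integral_count_space_nn_integral[OF I]) auto
  also have "\<dots> \<le> (\<integral>\<^sup>+i. \<integral>\<^sup>+j. \<integral>\<^sup>+\<omega>. bound i j \<omega> \<partial>M \<partial>count_space I \<partial>count_space I)"
    by (rule nn_integral_mono, rule nn_integral_mono, rule pair) auto
  also have "\<dots> = (\<integral>\<^sup>+i. \<integral>\<^sup>+\<omega>. \<integral>\<^sup>+j. bound i j \<omega> \<partial>count_space I \<partial>M \<partial>count_space I)"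
    by (intro nn_integral_cong nn_integral_count_space_nn_integral[OF I, symmetric]) auto
  also have "\<dots> = (\<integral>\<^sup>+\<omega>. \<integral>\<^sup>+i. \<integral>\<^sup>+j. bound i j \<omega> \<partial>count_space I \<partial>count_space I \<partial>M)"
    by (rule nn_integral_count_space_nn_integral[OF I, symmetric], rule measurable_nn_integral_count_space[OF I]) auto
  also have "\<dots> = (\<integral>\<^sup>+\<omega>. G \<omega> * (cond_mean I q \<omega> + cond_mean I q \<omega> * cond_mean I q \<omega>) \<partial>M)"
  proof (intro nn_integral_cong)
    fix \<omega>
    have dd: "(\<integral>\<^sup>+j. d i j \<partial>count_space I) = 1" if "i \<in> I" for i
    proof -
      have "(\<integral>\<^sup>+j. d i j \<partial>count_space I) = (\<integral>\<^sup>+j. 1 * indicator {i} j \<partial>count_space I)"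
        by (intro nn_integral_cong) (auto simp: d_def)
      then show ?thesis using that by simp
    qed
    have "(\<integral>\<^sup>+i. \<integral>\<^sup>+j. bound i j \<omega> \<partial>count_space I \<partial>count_space I)
      = (\<integral>\<^sup>+i. G \<omega> * (ennreal (q i \<omega>) + ennreal (q i \<omega>) * cond_mean I q \<omega>) \<partial>count_space I)"
      unfolding cond_mean_def bound_def by (intro nn_integral_cong) (simp add: nn_integral_cmult nn_integral_add dd)
    also have "\<dots> = G \<omega> * (cond_mean I q \<omega> + cond_mean I q \<omega> * cond_mean I q \<omega>)"
      by (simp add: nn_integral_cmult nn_integral_add nn_integral_multc flip: cond_mean_def)
    finally show "(\<integral>\<^sup>+i. \<integral>\<^sup>+j. bound i j \<omega> \<partial>count_space I \<partial>count_space I)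
      = G \<omega> * (cond_mean I q \<omega> + cond_mean I q \<omega> * cond_mean I q \<omega>)" .
  qed
  finally show ?thesis .
qed

lemma measurable_occurrences:
  assumes "countable I" "\<And>i. i \<in> I \<Longrightarrow> E i \<in> sets N"
  shows "occurrences I E \<in> borel_measurable N"
  unfolding occurrences_def using assms by (auto intro!: measurable_nn_integral_count_space)

lemma measurable_cond_mean:
  assumes "countable I" "\<And>i. i \<in> I \<Longrightarrow> q i \<in> borel_measurable N"
  shows "cond_mean I q \<in> borel_measurable N"
  unfolding cond_mean_def using assms by (auto intro!: measurable_nn_integral_count_space)

text \<open>When the square is expanded, the off-diagonal part and the square of the conditional mean cancel
  against the mixed term, which leaves the diagonal. The set $H$ keeps the cancelling terms finite.\<close>
lemma cond_variance_occurrences_le: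
  assumes I: "countable I" and cp: "cond_pairwise_indep M F I E q"
    and H: "H \<in> sets F" and K: "\<And>\<omega>. \<omega> \<in> H \<Longrightarrow> cond_mean I q \<omega> \<le> ennreal K"
  shows "(\<integral>\<^sup>+\<omega>. indicator H \<omega> * ennreal ((enn2real (occurrences I E \<omega>) - enn2real (cond_mean I q \<omega>))\<^sup>2) \<partial>M)
    \<le> ennreal K * emeasure M (space M)"
proof -
  define X where "X = occurrences I E"
  define Q where "Q = cond_mean I q"
  have cp1: "has_cond_prob M F (E i) (q i)" if "i \<in> I" for i using cp that unfolding cond_pairwise_indep_def by auto
  have QF[measurable]: "Q \<in> borel_measurable F"
    unfolding Q_def using I cond_probD(2)[OF cp1] by (rule measurable_cond_mean)
  have QM[measurable]: "Q \<in> borel_measurable M" by (rule measurable_from_subalg[OF subalg QF])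
  have XM[measurable]: "X \<in> borel_measurable M"
    unfolding X_def using I cond_probD(1)[OF cp1] by (rule measurable_occurrences)
  have HM[measurable]: "H \<in> sets M" and HF[measurable]: "H \<in> sets F" using H subalg unfolding subalgebra_def by auto
  have fin: "emeasure M (space M) < \<top>" by (simp add: less_top[symmetric])
  have QH: "(\<integral>\<^sup>+\<omega>. indicator H \<omega> * Q \<omega> \<partial>M) \<le> ennreal K * emeasure M (space M)"
  proof -
    have "(\<integral>\<^sup>+\<omega>. indicator H \<omega> * Q \<omega> \<partial>M) \<le> (\<integral>\<^sup>+\<omega>. ennreal K \<partial>M)"
      by (intro nn_integral_mono) (use K in \<open>auto simp: indicator_def Q_def\<close>)
    then show ?thesis by simp
  qed
  \<comment> \<open>the term that cancels\<close>
  define c where "c = (\<integral>\<^sup>+\<omega>. indicator H \<omega> * (Q \<omega> * Q \<omega>) \<partial>M)"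
  have "c \<le> (\<integral>\<^sup>+\<omega>. ennreal K * ennreal K \<partial>M)" unfolding c_def
      by (intro nn_integral_mono) (use K in \<open>auto simp: indicator_def Q_def intro!: mult_mono\<close>)
  also have "\<dots> < \<top>" using fin by (simp add: ennreal_mult_less_top)
  finally have c: "c < \<top>" .
  have EX: "(\<integral>\<^sup>+\<omega>. indicator H \<omega> * X \<omega> \<partial>M) = (\<integral>\<^sup>+\<omega>. indicator H \<omega> * Q \<omega> \<partial>M)"
    unfolding X_def Q_def by (rule nn_integral_occurrences[OF I cp1]) auto
  have EXQ: "(\<integral>\<^sup>+\<omega>. (indicator H \<omega> * Q \<omega>) * X \<omega> \<partial>M) = c"
    unfolding X_def c_def by (subst nn_integral_occurrences[OF I cp1]) (auto simp: Q_def[symmetric] mult.assoc)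
  have EXX: "(\<integral>\<^sup>+\<omega>. indicator H \<omega> * (X \<omega> * X \<omega>) \<partial>M) \<le> (\<integral>\<^sup>+\<omega>. indicator H \<omega> * Q \<omega> \<partial>M) + c"
  proof -
    have "(\<integral>\<^sup>+\<omega>. indicator H \<omega> * (X \<omega> * X \<omega>) \<partial>M) \<le> (\<integral>\<^sup>+\<omega>. indicator H \<omega> * (Q \<omega> + Q \<omega> * Q \<omega>) \<partial>M)"
      unfolding X_def Q_def by (rule nn_integral_occurrences_square_le[OF I cp]) auto
    also have "\<dots> = (\<integral>\<^sup>+\<omega>. indicator H \<omega> * Q \<omega> \<partial>M) + c"
      unfolding c_def by (simp add: distrib_left nn_integral_add)
    finally show ?thesis .
  qed
  have "(\<integral>\<^sup>+\<omega>. indicator H \<omega> * X \<omega> \<partial>M) \<noteq> \<infinity>"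
    using QH fin unfolding EX by (metis ennreal_mult_less_top ennreal_less_top infinity_ennreal_def leD)
  then have "AE \<omega> in M. indicator H \<omega> * X \<omega> \<noteq> \<infinity>"
    by (intro nn_integral_PInf_AE) auto
  then have "AE \<omega> in M. indicator H \<omega> * ennreal ((enn2real (X \<omega>) - enn2real (Q \<omega>))\<^sup>2) + 2 * ((indicator H \<omega> * Q \<omega>) * X \<omega>)
     = indicator H \<omega> * (X \<omega> * X \<omega>) + indicator H \<omega> * (Q \<omega> * Q \<omega>)"
  proof eventually_elim
    case (elim \<omega>)
    show ?case
    proof (cases "\<omega> \<in> H")
      case True
      obtain x where x: "X \<omega> = ennreal x" "x \<ge> 0" using elim True by (cases "X \<omega>") auto
      obtain y where y: "Q \<omega> = ennreal y" "y \<ge> 0" using K[OF True] by (cases "Q \<omega>") (auto simp: Q_def top_unique)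
      have "ennreal ((x - y)\<^sup>2) + 2 * (ennreal y * ennreal x) = ennreal ((x - y)\<^sup>2) + ennreal (2 * (y * x))"
        using x(2) y(2) by (simp add: ennreal_mult)
      also have "\<dots> = ennreal ((x - y)\<^sup>2 + 2 * (y * x))"
        using x(2) y(2) by (intro ennreal_plus[symmetric]) auto
      also have "(x - y)\<^sup>2 + 2 * (y * x) = x * x + y * y" by (simp add: power2_eq_square algebra_simps)
      also have "ennreal (x * x + y * y) = ennreal x * ennreal x + ennreal y * ennreal y"
        using x(2) y(2) by (simp add: ennreal_mult)
      finally show ?thesis using True x y by simp
    qed auto
  qed
  then have "(\<integral>\<^sup>+\<omega>. indicator H \<omega> * ennreal ((enn2real (X \<omega>) - enn2real (Q \<omega>))\<^sup>2) + 2 * ((indicator H \<omega> * Q \<omega>) * X \<omega>) \<partial>M)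
     = (\<integral>\<^sup>+\<omega>. indicator H \<omega> * (X \<omega> * X \<omega>) + indicator H \<omega> * (Q \<omega> * Q \<omega>) \<partial>M)"
    by (rule nn_integral_cong_AE)
  then have "(\<integral>\<^sup>+\<omega>. indicator H \<omega> * ennreal ((enn2real (X \<omega>) - enn2real (Q \<omega>))\<^sup>2) \<partial>M) + 2 * c
     = (\<integral>\<^sup>+\<omega>. indicator H \<omega> * (X \<omega> * X \<omega>) \<partial>M) + c"
    by (simp add: nn_integral_add nn_integral_cmult EXQ c_def[symmetric])
  also have "\<dots> \<le> ((\<integral>\<^sup>+\<omega>. indicator H \<omega> * Q \<omega> \<partial>M) + c) + c"
    using EXX by (rule add_right_mono)
  also have "\<dots> = (\<integral>\<^sup>+\<omega>. indicator H \<omega> * Q \<omega> \<partial>M) + 2 * c" by (simp add: mult_2 add.assoc)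
  finally have "(\<integral>\<^sup>+\<omega>. indicator H \<omega> * ennreal ((enn2real (X \<omega>) - enn2real (Q \<omega>))\<^sup>2) \<partial>M) \<le> (\<integral>\<^sup>+\<omega>. indicator H \<omega> * Q \<omega> \<partial>M)"
    using c by (auto simp: ennreal_mult_eq_top_iff)
  with QH show ?thesis unfolding X_def Q_def by simp
qed

text \<open>When the conditional means are of the order of $b_n$, the squares of the relative
  fluctuations have expectations of the order of $1/b_n$; these are summable, so the fluctuations tend
  to zero almost surely. The constant in the order of magnitude may depend on the realization: the sets on which
  the constant $K$ works from index $K$ on belong to the sub-sigma-algebra and exhaust the
  realizations in question.\<close>
lemma cond_law_of_large_numbers:
  fixes I :: "nat \<Rightarrow> 'i set" and b :: "nat \<Rightarrow> real"
  assumes I: "\<And>n. countable (I n)" and cp: "\<And>n. cond_pairwise_indep M F (I n) (E n) (q n)"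
    and b: "\<forall>\<^sub>F n in sequentially. b n > 0" "summable (\<lambda>n. 1 / b n)"
  shows "AE \<omega> in M. (\<exists>K::nat. \<forall>n\<ge>K. cond_mean (I n) (q n) \<omega> \<le> ennreal (K * b n)) \<longrightarrow>
    (\<lambda>n. (enn2real (occurrences (I n) (E n) \<omega>) - enn2real (cond_mean (I n) (q n) \<omega>)) / b n) \<longlonglongrightarrow> 0"
proof -
  define X where "X n = occurrences (I n) (E n)" for n
  define Q where "Q n = cond_mean (I n) (q n)" for n
  have cp1: "has_cond_prob M F (E n i) (q n i)" if "i \<in> I n" for n i
    using cp that unfolding cond_pairwise_indep_def by auto
  have QF[measurable]: "Q n \<in> borel_measurable F" for n
    unfolding Q_def using I cond_probD(2)[OF cp1] by (rule measurable_cond_mean)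
  have QM[measurable]: "Q n \<in> borel_measurable M" for n by (rule measurable_from_subalg[OF subalg QF])
  have XM[measurable]: "X n \<in> borel_measurable M" for n
    unfolding X_def using I cond_probD(1)[OF cp1] by (rule measurable_occurrences)
  obtain n0 where n0: "\<And>n. n \<ge> n0 \<Longrightarrow> b n > 0" using b(1) by (auto simp: eventually_sequentially)
  have "AE \<omega> in M. (\<forall>n\<ge>K. Q n \<omega> \<le> ennreal (K * b n)) \<longrightarrow>
    (\<lambda>n. (enn2real (X n \<omega>) - enn2real (Q n \<omega>)) / b n) \<longlonglongrightarrow> 0" for K :: nat
  proof -
    define N where "N = max n0 K"
    define H where "H = {\<omega>\<in>space F. \<forall>n\<in>{K..}. Q n \<omega> \<le> ennreal (K * b n)}"
    have HF: "H \<in> sets F" unfolding H_def by measurable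
    then have HM[measurable]: "H \<in> sets M" using subalg unfolding subalgebra_def by auto
    define Z where "Z n \<omega> = ((enn2real (X n \<omega>) - enn2real (Q n \<omega>)) / b n)\<^sup>2" for n \<omega>
    have Zm[measurable]: "Z n \<in> borel_measurable M" for n unfolding Z_def by measurable
    have Z: "(\<integral>\<^sup>+\<omega>. indicator H \<omega> * ennreal (Z n \<omega>) \<partial>M) \<le> ennreal (real K * (1 / b n)) * emeasure M (space M)" if n: "n \<ge> N" for n
    proof -
      have bn: "b n > 0" using n0 n unfolding N_def by auto
      have "ennreal (Z n \<omega>) = ennreal (1 / (b n)\<^sup>2) * ennreal ((enn2real (X n \<omega>) - enn2real (Q n \<omega>))\<^sup>2)" for \<omega>
        unfolding Z_def by (simp add: power_divide ennreal_mult[symmetric] mult.commute)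
      then have "(\<integral>\<^sup>+\<omega>. indicator H \<omega> * ennreal (Z n \<omega>) \<partial>M)
         = ennreal (1 / (b n)\<^sup>2) * (\<integral>\<^sup>+\<omega>. indicator H \<omega> * ennreal ((enn2real (X n \<omega>) - enn2real (Q n \<omega>))\<^sup>2) \<partial>M)"
        by (subst nn_integral_cmult[symmetric]) (auto simp: mult_ac)
      also have "\<dots> \<le> ennreal (1 / (b n)\<^sup>2) * (ennreal (K * b n) * emeasure M (space M))"
        unfolding X_def Q_def
        by (intro mult_left_mono cond_variance_occurrences_le[OF I cp HF]) (use n in \<open>auto simp: H_def N_def Q_def\<close>)
      also have "\<dots> = ennreal (1 / (b n)\<^sup>2 * (K * b n)) * emeasure M (space M)"
        using bn by (subst ennreal_mult) (auto simp: mult.assoc)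
      also have "1 / (b n)\<^sup>2 * (K * b n) = real K * (1 / b n)"
        using bn by (simp add: power2_eq_square)
      finally show ?thesis .
    qed
    have "(\<integral>\<^sup>+\<omega>. (\<Sum>n. indicator H \<omega> * ennreal (Z (n + N) \<omega>)) \<partial>M) = (\<Sum>n. \<integral>\<^sup>+\<omega>. indicator H \<omega> * ennreal (Z (n + N) \<omega>) \<partial>M)"
      by (rule nn_integral_suminf) auto
    also have "\<dots> \<le> (\<Sum>n. ennreal (real K * (1 / b (n + N))) * emeasure M (space M))"
      by (intro suminf_le Z) auto
    also have "\<dots> = (\<Sum>n. ennreal (real K * (1 / b (n + N)))) * emeasure M (space M)"
      by simp
    also have "(\<Sum>n. ennreal (real K * (1 / b (n + N)))) = ennreal (\<Sum>n. real K * (1 / b (n + N)))"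
    proof (rule suminf_ennreal2)
      show "0 \<le> real K * (1 / b (n + N))" for n
      proof -
        have "b (n + N) > 0" by (rule n0) (simp add: N_def)
        then show ?thesis by simp
      qed
      show "summable (\<lambda>n. real K * (1 / b (n + N)))"
        by (intro summable_mult summable_ignore_initial_segment[OF b(2)])
    qed
    also have "\<dots> * emeasure M (space M) < \<top>"
      using emeasure_finite[of "space M"] by (simp add: ennreal_mult_less_top less_top del: emeasure_finite)
    finally have "AE \<omega> in M. (\<Sum>n. indicator H \<omega> * ennreal (Z (n + N) \<omega>)) \<noteq> \<infinity>"
      by (intro nn_integral_PInf_AE) auto
    then show ?thesis
      using AE_space
    proof eventually_elim
      case (elim \<omega>)
      show ?case
      proof
        assume "\<forall>n\<ge>K. Q n \<omega> \<le> ennreal (K * b n)"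
        then have "\<omega> \<in> H" using elim(2) subalg unfolding H_def subalgebra_def by auto
        then have "(\<Sum>n. ennreal (Z (n + N) \<omega>)) \<noteq> \<infinity>" using elim(1) by simp
        then have "summable (\<lambda>n. Z (n + N) \<omega>)"
          by (intro summable_suminf_not_top) (auto simp: Z_def)
        then have "(\<lambda>n. Z n \<omega>) \<longlonglongrightarrow> 0"
          by (intro summable_LIMSEQ_zero) (simp add: summable_iff_shift[of "\<lambda>n. Z n \<omega>"])
        then show "(\<lambda>n. (enn2real (X n \<omega>) - enn2real (Q n \<omega>)) / b n) \<longlonglongrightarrow> 0"
          using tendsto_real_sqrt[of "\<lambda>n. Z n \<omega>" 0 sequentially]
          by (simp add: Z_def tendsto_rabs_zero_iff)
      qed
    qed
  qed
  then have "AE \<omega> in M. \<forall>K::nat. (\<forall>n\<ge>K. Q n \<omega> \<le> ennreal (K * b n)) \<longrightarrow>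
    (\<lambda>n. (enn2real (X n \<omega>) - enn2real (Q n \<omega>)) / b n) \<longlonglongrightarrow> 0"
    by (subst AE_all_countable) blast
  then show ?thesis unfolding X_def Q_def by eventually_elim blast
qed

end

section \<open>Tails of slowly varying functions\<close>

locale slowly_varying_tail =
  fixes L :: "real \<Rightarrow> real"
  assumes sv: "slowly_varying L"
    and tail_finite: "\<forall>\<^sub>F x in at_top. set_integrable lborel {x..} (\<lambda>u. L u / u)"
begin

abbreviation "tail \<equiv> tail_integral L"

text \<open>Past this threshold the tail integral is finite and doubling the argument costs at most the
  factor $3/4$. Any factor between $1/2$ and $1$ would serve: what matters is that $2\cdot 3/4>1$, which makes
  the integrals of $L$ over dyadic blocks grow geometrically.\<close>
definition onset :: real where
  "onset = (SOME X. X > 0 \<and> set_integrable lborel {X..} (\<lambda>u. L u / u) \<and> (\<forall>u\<ge>X. 3/4 * L u \<le> L (2 * u)))"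

lemma onset: "onset > 0" "set_integrable lborel {onset..} (\<lambda>u. L u / u)"
  "\<And>u. u \<ge> onset \<Longrightarrow> 3/4 * L u \<le> L (2 * u)"
proof -
  have "((\<lambda>x. L (2 * x) / L x) \<longlongrightarrow> 1) at_top" using sv unfolding slowly_varying_def by auto
  then have "\<forall>\<^sub>F x in at_top. 3/4 < L (2 * x) / L x" by (rule order_tendstoD) simp
  then have "\<forall>\<^sub>F x in at_top. 3/4 * L x \<le> L (2 * x)"
    using eventually_gt_at_top[of 0]
  proof eventually_elim
    case (elim x)
    then have "L x > 0" using sv unfolding slowly_varying_def by auto
    then show ?case using elim by (simp add: field_simps)
  qed
  then obtain X1 where X1: "\<And>u. u \<ge> X1 \<Longrightarrow> 3/4 * L u \<le> L (2 * u)" by (auto simp: eventually_at_top_linorder)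
  obtain X2 where X2: "\<And>x. x \<ge> X2 \<Longrightarrow> set_integrable lborel {x..} (\<lambda>u. L u / u)"
    using tail_finite by (auto simp: eventually_at_top_linorder)
  have "\<exists>X. X > 0 \<and> set_integrable lborel {X..} (\<lambda>u. L u / u) \<and> (\<forall>u\<ge>X. 3/4 * L u \<le> L (2 * u))"
    by (rule exI[of _ "max 1 (max X1 X2)"]) (use X1 X2 in auto)
  from someI_ex[OF this] show "onset > 0" "set_integrable lborel {onset..} (\<lambda>u. L u / u)"
    "\<And>u. u \<ge> onset \<Longrightarrow> 3/4 * L u \<le> L (2 * u)" unfolding onset_def[symmetric] by auto
qed

lemma L_pos: "x > 0 \<Longrightarrow> L x > 0"
  using sv unfolding slowly_varying_def by auto

lemma set_integrable_tail:
  assumes "A \<in> sets borel" "A \<subseteq> {onset..}"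
  shows "set_integrable lborel A (\<lambda>u. L u / u)"
  using onset(2) by (rule set_integrable_subset) (use assms in auto)

text \<open>The substitution $u=2v$ leaves the measure $du/u$ invariant, so a pointwise comparison of
  $L(2v)$ with $L(v)$ is enough. It will be applied to half-lines and to dyadic blocks.\<close>
lemma set_integral_double:
  assumes A: "A \<in> sets borel" "A \<subseteq> {onset..}"
  shows "3/4 * (LBINT u:A. L u / u) \<le> (LBINT u:{u. u / 2 \<in> A}. L u / u)"
proof -
  have meas: "{u. u / 2 \<in> A} \<in> sets borel"
    using measurable_sets[of "\<lambda>u::real. u / 2" borel borel A] A by (simp add: vimage_def)
  have sub: "{u. u / 2 \<in> A} \<subseteq> {onset..}" using A onset(1) by (force)
  have int: "set_integrable lborel {u. u / 2 \<in> A} (\<lambda>u. L u / u)"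
    by (rule set_integrable_tail[OF meas sub])
  have "(LBINT u:{u. u / 2 \<in> A}. L u / u) = 2 * (LBINT u. indicator {u. u / 2 \<in> A} (2 * u) * (L (2 * u) / (2 * u)))"
    unfolding set_lebesgue_integral_def by (subst lborel_integral_real_affine[of 2 _ 0]) auto
  also have "\<dots> = (LBINT u:A. L (2 * u) / u)"
    unfolding set_lebesgue_integral_def
    by (subst Bochner_Integration.integral_mult_right_zero[symmetric]) (auto intro!: Bochner_Integration.integral_cong simp: indicator_def)
  finally have eq: "(LBINT u:{u. u / 2 \<in> A}. L u / u) = (LBINT u:A. L (2 * u) / u)" .
  have "set_integrable lborel A (\<lambda>u. L (2 * u) / u)"
  proof -
    have "integrable lborel (\<lambda>u. indicator {u. u / 2 \<in> A} (0 + 2 * u) *\<^sub>R (L (0 + 2 * u) / (0 + 2 * u)))"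
      using int unfolding set_integrable_def by (rule lborel_integrable_real_affine) simp
    then have "integrable lborel (\<lambda>u. 2 * (indicator {u. u / 2 \<in> A} (0 + 2 * u) *\<^sub>R (L (0 + 2 * u) / (0 + 2 * u))))"
      by (rule integrable_mult_right)
    then show ?thesis unfolding set_integrable_def
      by (rule Bochner_Integration.integrable_cong[THEN iffD1, rotated -1]) (auto simp: indicator_def)
  qed
  then have "(LBINT u:A. 3/4 * (L u / u)) \<le> (LBINT u:A. L (2 * u) / u)"
  proof (rule set_integral_mono[rotated])
    show "set_integrable lborel A (\<lambda>u. 3/4 * (L u / u))"
      using set_integrable_tail[OF A] by (rule set_integrable_mult_right)
    fix u assume "u \<in> A"
    then show "3/4 * (L u / u) \<le> L (2 * u) / u"
      using onset(1) onset(3)[of u] A by (auto simp: divide_simps)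
  qed
  then show ?thesis unfolding eq by (simp only: set_integral_mult_right)
qed

lemma tail_split:
  assumes "onset \<le> x" "x \<le> y"
  shows "tail x = (LBINT u:{x..<y}. L u / u) + tail y"
proof -
  have "{x..} = {x..<y} \<union> {y..}" using assms by auto
  then show ?thesis unfolding tail_integral_def
    by (simp only:) (rule set_integral_Un, use assms in \<open>auto intro!: set_integrable_tail\<close>)
qed

lemma set_integral_tail_pos:
  assumes "onset \<le> x" "x < y"
  shows "0 < (LBINT u:{x..<y}. L u / u)"
proof -
  have nn: "0 \<le> indicator {x..<y} u *\<^sub>R (L u / u)" for u :: real
    using assms onset(1) L_pos[of u] by (auto simp: indicator_def)
  have int: "integrable lborel (\<lambda>u. indicator {x..<y} u *\<^sub>R (L u / u))"
    using set_integrable_tail[of "{x..<y}"] assms unfolding set_integrable_def by fastforce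
  have "(LBINT u:{x..<y}. L u / u) \<noteq> 0"
  proof
    assume "(LBINT u:{x..<y}. L u / u) = 0"
    then have "AE u in lborel. indicator {x..<y} u *\<^sub>R (L u / u) = 0"
      unfolding set_lebesgue_integral_def
      using integral_nonneg_eq_0_iff_AE[OF int] nn by simp
    then have "AE u in lborel. u \<notin> {x..<y}"
    proof eventually_elim
      case (elim u)
      then show ?case using L_pos[of u] onset(1) assms by (auto simp: indicator_def split: if_splits)
    qed
    then have "{x..<y} \<in> null_sets lborel" by (subst AE_iff_null_sets) auto
    then show False using assms by (auto simp: null_sets_def)
  qed
  moreover have "0 \<le> (LBINT u:{x..<y}. L u / u)"
    unfolding set_lebesgue_integral_def using nn by (intro integral_nonneg_AE) auto
  ultimately show ?thesis by simp
qed

lemma tail_nonneg: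
  assumes "onset \<le> x" shows "0 \<le> tail x"
  unfolding tail_integral_def set_lebesgue_integral_def
proof (intro integral_nonneg_AE AE_I2)
  fix u show "0 \<le> indicat_real {x..} u *\<^sub>R (L u / u)"
    using assms onset(1) L_pos[of u] by (auto simp: indicator_def)
qed

lemma tail_strict_antimono:
  assumes "onset \<le> x" "x < y" shows "tail y < tail x"
  using tail_split[of x y] set_integral_tail_pos[of x y] assms by simp

lemma tail_antimono:
  assumes "onset \<le> x" "x \<le> y" shows "tail y \<le> tail x"
  using tail_strict_antimono[of x y] assms by (cases "x = y") auto

lemma tail_pos: "onset \<le> x \<Longrightarrow> 0 < tail x"
  using tail_strict_antimono[of x "x + 1"] tail_nonneg[of "x + 1"] by simp

lemma tail_double:
  assumes "onset \<le> x" shows "3/4 * tail x \<le> tail (2 * x)"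
proof -
  have "{u. u / 2 \<in> {x..}} = {2 * x..}" by auto
  then show ?thesis using set_integral_double[of "{x..}"] assms unfolding tail_integral_def by auto
qed

lemma tail_pow_le:
  assumes "onset \<le> x" shows "(3/4) ^ k * tail x \<le> tail (2 ^ k * x)"
proof (induction k)
  case (Suc k)
  have "x \<le> 2 ^ k * x" using assms onset(1) by simp
  then have "3/4 * tail (2 ^ k * x) \<le> tail (2 ^ Suc k * x)"
    using tail_double[of "2 ^ k * x"] assms by (simp add: mult.assoc)
  then show ?case using Suc by simp
qed simp

definition block :: "nat \<Rightarrow> real" where
  "block k = (LBINT u:{2 ^ k..<2 ^ Suc k}. L u / u)"

lemma block_pos: "onset \<le> 2 ^ k \<Longrightarrow> 0 < block k"
  unfolding block_def by (rule set_integral_tail_pos) auto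

lemma block_eq: "onset \<le> 2 ^ k \<Longrightarrow> block k = tail (2 ^ k) - tail (2 ^ Suc k)"
  unfolding block_def using tail_split[of "2 ^ k" "2 ^ Suc k"] by simp

lemma block_Suc:
  assumes "onset \<le> 2 ^ k" shows "3/4 * block k \<le> block (Suc k)"
proof -
  have eq: "{u::real. u / 2 \<in> {2 ^ k..<2 ^ Suc k}} = {2 ^ Suc k..<2 ^ Suc (Suc k)}" by auto
  have "3/4 * (LBINT u:{2 ^ k..<2 ^ Suc k}. L u / u) \<le> (LBINT u:{u. u / 2 \<in> {2 ^ k..<2 ^ Suc k}}. L u / u)"
    by (rule set_integral_double) (use assms in auto)
  then show ?thesis unfolding block_def eq .
qed

lemma tail_LIMSEQ: "(\<lambda>n. tail (2 ^ n)) \<longlonglongrightarrow> 0"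
proof -
  define h where "h u = indicator {onset..} u *\<^sub>R (L u / u)" for u
  have h: "integrable lborel h" using onset(2) unfolding set_integrable_def h_def[abs_def] .
  have "(\<lambda>n::nat. LBINT u. indicator {2 ^ n..} u *\<^sub>R h u) \<longlonglongrightarrow> (LBINT u::real. 0)"
  proof (rule integral_dominated_convergence[where w = "\<lambda>u. norm (h u)"])
    show "integrable lborel (\<lambda>u. norm (h u))"
      using h by (rule integrable_norm)
    have [measurable]: "h \<in> borel_measurable lborel"
      using h by simp
    show "(\<lambda>u. indicator {2 ^ n..} u *\<^sub>R h u) \<in> borel_measurable lborel" for n :: nat
      by measurable
    show "AE u in lborel. (\<lambda>n::nat. indicator {2 ^ n..} u *\<^sub>R h u) \<longlonglongrightarrow> 0"
    proof (rule AE_I2)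
      fix u :: real
      obtain N where "u < 2 ^ N" using real_arch_pow[of 2 u] by auto
      then have "\<not> 2 ^ n \<le> u" if "n \<ge> N" for n
        using power_increasing[OF that, of "2::real"] by linarith
      then have "\<forall>n\<ge>N. indicator {2 ^ n..} u *\<^sub>R h u = 0"
        by (auto simp: indicator_def)
      then show "(\<lambda>n::nat. indicator {2 ^ n..} u *\<^sub>R h u) \<longlonglongrightarrow> 0"
        by (intro tendsto_eventually) (auto simp: eventually_sequentially)
    qed
  qed (auto simp: indicator_def)
  moreover have "\<forall>\<^sub>F n in sequentially. (LBINT u. indicator {2 ^ n..} u *\<^sub>R h u) = tail (2 ^ n)"
  proof -
    obtain N where N: "onset < 2 ^ N" using real_arch_pow[of 2 onset] by auto
    have "(LBINT u. indicator {2 ^ n..} u *\<^sub>R h u) = tail (2 ^ n)" if "n \<ge> N" for n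
    proof -
      have "onset < 2 ^ n" using N power_increasing[OF that, of "2::real"] by linarith
      then show ?thesis unfolding tail_integral_def set_lebesgue_integral_def
        by (intro Bochner_Integration.integral_cong) (auto simp: h_def indicator_def)
    qed
    then show ?thesis by (auto simp: eventually_sequentially)
  qed
  ultimately show ?thesis by (simp add: tendsto_cong)
qed

lemma block_sums:
  assumes "onset \<le> 2 ^ n" shows "(\<lambda>k. block (k + n)) sums tail (2 ^ n)"
proof -
  have le: "onset \<le> 2 ^ (k + n)" for k
    using assms power_increasing[of n "k + n" "2::real"] by linarith
  have "(\<lambda>k. - tail (2 ^ (k + n))) \<longlonglongrightarrow> - 0"
    by (intro tendsto_minus LIMSEQ_ignore_initial_segment tail_LIMSEQ)
  then have "(\<lambda>k. - tail (2 ^ (Suc k + n)) - - tail (2 ^ (k + n))) sums (- 0 - - tail (2 ^ (0 + n)))"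
    by (rule telescope_sums)
  then show ?thesis using block_eq[OF le] by simp
qed

lemma eventually_onset_le: "\<forall>\<^sub>F n in sequentially. onset \<le> 2 ^ n"
proof -
  obtain N where N: "onset < 2 ^ N" using real_arch_pow[of 2 onset] by auto
  then have "onset \<le> 2 ^ n" if "n \<ge> N" for n using power_increasing[OF that, of "2::real"] by linarith
  then show ?thesis by (auto simp: eventually_sequentially)
qed

end

text \<open>The map $x\mapsto -1/x$ is increasing, so that the substitution rule for increasing maps applies
  after a reflection.\<close>
lemma nn_integral_substitution_inverse:
  fixes F :: "real \<Rightarrow> ennreal"
  assumes F: "F \<in> borel_measurable borel" and ab: "0 < a" "a < b"
  shows "(\<integral>\<^sup>+x. F (1 / x) * ennreal (1 / x\<^sup>2) * indicator {a..b} x \<partial>lborel) = (\<integral>\<^sup>+u. F u * indicator {1/b..1/a} u \<partial>lborel)"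
proof -
  have "(\<integral>\<^sup>+u. F (- u) * indicator {- (1/a)..- (1/b)} u \<partial>lborel) = (\<integral>\<^sup>+x. F (- (- (1 / x))) * ennreal (1 / x\<^sup>2) * indicator {a..b} x \<partial>lborel)"
  proof (rule nn_integral_substitution_aux)
    show "(\<lambda>u. F (- u)) \<in> borel_measurable borel" using F by measurable
    show "((\<lambda>x. - (1 / x)) has_real_derivative 1 / x\<^sup>2) (at x)" if "x \<in> {a..b}" for x
      using that ab by (auto intro!: derivative_eq_intros simp: power2_eq_square)
    show "continuous_on {a..b} (\<lambda>x. 1 / x\<^sup>2)" using ab by (intro continuous_intros) auto
  qed (use ab in auto)
  moreover have "(\<integral>\<^sup>+u. F u * indicator {1/b..1/a} u \<partial>lborel) = (\<integral>\<^sup>+u. F (- u) * indicator {- (1/a)..- (1/b)} u \<partial>lborel)"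
  proof -
    have "(\<integral>\<^sup>+u. F u * indicator {1/b..1/a} u \<partial>lborel) = (\<integral>\<^sup>+u. F (0 + (-1) * u) * indicator {1/b..1/a} (0 + (-1) * u) \<partial>lborel)"
      using F by (subst nn_integral_real_affine[of _ "-1" 0]) auto
    also have "\<dots> = (\<integral>\<^sup>+u. F (- u) * indicator {- (1/a)..- (1/b)} u \<partial>lborel)"
      by (intro nn_integral_cong) (auto simp: indicator_def)
    finally show ?thesis .
  qed
  ultimately show ?thesis by simp
qed

section \<open>Counting the points of a Poisson process\<close>

text \<open>Shifting the summation index once and twice gives the factorial moments $r$ and $r^2$, from which
  the variance is assembled.\<close>
lemma poisson_variance_sums:
  fixes r :: real
  shows "(\<lambda>k. (real k - r)\<^sup>2 * (r ^ k / fact k * exp (- r))) sums r"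
proof -
  have s0: "(\<lambda>k. r ^ k / fact k) sums exp r"
    using exp_converges[of r] by (simp add: field_simps)
  have s1: "(\<lambda>k. real k * (r ^ k / fact k)) sums (r * exp r)"
  proof -
    have "real (Suc k) * (r ^ Suc k / fact (Suc k)) = r * (r ^ k / fact k)" for k
      by (simp add: field_simps del: of_nat_Suc)
    then have "(\<lambda>k. real (Suc k) * (r ^ Suc k / fact (Suc k))) sums (r * exp r)"
      using sums_mult[OF s0, of r] by simp
    from sums_Suc[OF this] show ?thesis by simp
  qed
  have s2: "(\<lambda>k. real k * (real k - 1) * (r ^ k / fact k)) sums (r * (r * exp r))"
  proof -
    have "real (Suc k) * (real (Suc k) - 1) * (r ^ Suc k / fact (Suc k)) = r * (real k * (r ^ k / fact k))" for k
    proof -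
      have "real (Suc k) * (real (Suc k) - 1) * (r ^ Suc k / fact (Suc k)) = real k * (real (Suc k) * (r ^ Suc k / fact (Suc k)))"
        by simp
      also have "real (Suc k) * (r ^ Suc k / fact (Suc k)) = r * (r ^ k / fact k)"
        by (simp add: field_simps del: of_nat_Suc)
      finally show ?thesis by simp
    qed
    then have "(\<lambda>k. real (Suc k) * (real (Suc k) - 1) * (r ^ Suc k / fact (Suc k))) sums (r * (r * exp r))"
      using sums_mult[OF s1, of r] by (simp only:)
    from sums_Suc[OF this] show ?thesis by simp
  qed
  have "(\<lambda>k. exp (- r) * (real k * (real k - 1) * (r ^ k / fact k) + real k * (r ^ k / fact k)
       - 2 * r * (real k * (r ^ k / fact k)) + r\<^sup>2 * (r ^ k / fact k)))
     sums (exp (- r) * (r * (r * exp r) + r * exp r - 2 * r * (r * exp r) + r\<^sup>2 * exp r))"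
    by (intro sums_mult sums_add sums_diff s0 s1 s2)
  moreover have "exp (- r) * (r * (r * exp r) + r * exp r - 2 * r * (r * exp r) + r\<^sup>2 * exp r) = r"
    by (simp add: exp_minus field_simps power2_eq_square)
  moreover have "exp (- r) * (real k * (real k - 1) * y + real k * y - 2 * r * (real k * y) + r\<^sup>2 * y)
      = (real k - r)\<^sup>2 * (y * exp (- r))" for k y
    by (simp add: algebra_simps power2_eq_square)
  ultimately show ?thesis by (simp only:)
qed

lemma poisson_sums_1: "(\<lambda>k. (r::real) ^ k / fact k * exp (- r)) sums 1"
proof -
  have "(\<lambda>k. r ^ k / fact k * exp (- r)) sums (exp r * exp (- r))"
    using exp_converges[of r] by (intro sums_mult2) (simp add: field_simps)
  then show ?thesis by (simp add: exp_minus)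
qed

lemma num_points_eq_nn_integral: "num_points w A \<omega> = (\<integral>\<^sup>+i. indicator A (w i \<omega>) \<partial>count_space UNIV)"
proof -
  have "num_points w A \<omega> = (\<integral>\<^sup>+i. indicator {i. w i \<omega> \<in> A} i \<partial>count_space UNIV)"
    unfolding num_points_def by simp
  also have "\<dots> = (\<integral>\<^sup>+i. indicator A (w i \<omega>) \<partial>count_space UNIV)"
    by (intro nn_integral_cong) (auto simp: indicator_def)
  finally show ?thesis .
qed

context poisson_process
begin

lemma measurable_num_points [measurable]:
  assumes A: "A \<in> sets \<nu>" shows "num_points w A \<in> borel_measurable M"
proof -
  note [measurable] = A weight_measurable
  have "(\<lambda>\<omega>. \<Sum>i. indicator A (w i \<omega>) :: ennreal) \<in> borel_measurable M" by measurable
  then show ?thesis by (simp add: num_points_eq_nn_integral[abs_def] nn_integral_count_space_nat)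
qed

text \<open>The Poisson probabilities of the finite values already add up to one.\<close>
lemma AE_num_points_finite:
  assumes A: "A \<in> sets \<nu>" "emeasure \<nu> A < \<infinity>"
  shows "AE \<omega> in M. num_points w A \<omega> < \<infinity>"
proof -
  note [measurable] = A(1)
  define B where "B k = {\<omega> \<in> space M. num_points w A \<omega> = of_nat k}" for k :: nat
  have Bm: "range B \<subseteq> sets M" unfolding B_def by auto
  have "disjoint_family B" unfolding disjoint_family_on_def B_def by auto
  then have "(\<lambda>k. prob (B k)) sums prob (\<Union>k. B k)" using Bm by (rule finite_measure_UNION[rotated])
  then have "prob (\<Union>k. B k) = 1"
    using poisson_sums_1[of "measure \<nu> A"] poisson_counts[OF A] sums_unique2 unfolding B_def by simp
  then have "AE \<omega> in M. \<omega> \<in> (\<Union>k. B k)" using Bm by (intro AE_prob_1) auto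
  then show ?thesis by eventually_elim (auto simp: B_def ennreal_of_nat_eq_real_of_nat)
qed

text \<open>This is Chebyshev's inequality, carried out on the Poisson weights: subtracting
  $4(k-r)^2/r^2$ times the weight of $k$ leaves a nonpositive number unless $k$ is within $r/2$ of $r$.\<close>
lemma prob_num_points_deviation_le:
  assumes A: "A \<in> sets \<nu>" "emeasure \<nu> A < \<infinity>" and pos: "measure \<nu> A > 0"
  shows "prob {\<omega> \<in> space M. \<not> (ennreal (measure \<nu> A / 2) \<le> num_points w A \<omega> \<and>
      num_points w A \<omega> \<le> ennreal (3/2 * measure \<nu> A))} \<le> 4 / measure \<nu> A"
proof -
  note [measurable] = A(1)
  define r where "r = measure \<nu> A"
  have r: "r > 0" using pos unfolding r_def .
  define p where "p k = r ^ k / fact k * exp (- r)" for k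
  define B where "B k = {\<omega> \<in> space M. num_points w A \<omega> = of_nat k}" for k :: nat
  define good where "good = {\<omega> \<in> space M. ennreal (r / 2) \<le> num_points w A \<omega> \<and> num_points w A \<omega> \<le> ennreal (3/2 * r)}"
  have [measurable]: "good \<in> sets M" "B k \<in> sets M" for k unfolding good_def B_def by auto
  have pB: "prob (B k) = p k" for k using poisson_counts[OF A] unfolding B_def p_def r_def by simp
  define G where "G = {k::nat. \<bar>real k - r\<bar> \<le> r / 2}"
  have "G \<subseteq> {..nat \<lceil>3/2 * r\<rceil>}" unfolding G_def by (auto simp: abs_if split: if_splits) linarith+
  then have finG: "finite G" by (rule finite_subset) simp
  have sub: "(\<Union>k\<in>G. B k) \<subseteq> good"
  proof clarify
    fix \<omega> k assume k: "k \<in> G" and "\<omega> \<in> B k"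
    then have \<omega>: "\<omega> \<in> space M" "num_points w A \<omega> = of_nat k" by (auto simp: B_def)
    have "r / 2 \<le> real k" "real k \<le> 3/2 * r" using k unfolding G_def by (auto simp: abs_if split: if_splits)
    then show "\<omega> \<in> good" using \<omega> unfolding good_def by (auto simp: ennreal_of_nat_eq_real_of_nat intro!: ennreal_leI)
  qed
  have sums1: "(\<lambda>k. p k - 4 / r\<^sup>2 * ((real k - r)\<^sup>2 * p k)) sums (1 - 4 / r\<^sup>2 * r)"
    unfolding p_def by (intro sums_diff sums_mult poisson_sums_1 poisson_variance_sums)
  have sums2: "(\<lambda>k. if k \<in> G then p k else 0) sums (\<Sum>k\<in>G. p k)"
    using finG by (rule sums_If_finite_set)
  have le: "p k - 4 / r\<^sup>2 * ((real k - r)\<^sup>2 * p k) \<le> (if k \<in> G then p k else 0)" for k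
  proof (cases "k \<in> G")
    case True
    then show ?thesis using r unfolding p_def by simp
  next
    case False
    then have "(r / 2)\<^sup>2 \<le> (real k - r)\<^sup>2" using r unfolding G_def by (intro iffD1[OF abs_le_square_iff]) auto
    then have "1 \<le> 4 / r\<^sup>2 * (real k - r)\<^sup>2" using r by (simp add: field_simps power2_eq_square)
    then have "1 * p k \<le> (4 / r\<^sup>2 * (real k - r)\<^sup>2) * p k" using r by (intro mult_right_mono) (auto simp: p_def)
    then show ?thesis using False by (simp add: mult.assoc)
  qed
  from le sums1 sums2 have "1 - 4 / r\<^sup>2 * r \<le> (\<Sum>k\<in>G. p k)" by (rule sums_le)
  also have "\<dots> = prob (\<Union>k\<in>G. B k)"
    unfolding pB[symmetric]
    by (rule finite_measure_finite_Union[symmetric]) (use finG in \<open>auto simp: disjoint_family_on_def B_def\<close>)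
  also have "\<dots> \<le> prob good" using sub by (intro finite_measure_mono) auto
  finally have "1 - 4 / r \<le> prob good" using r by (simp add: power2_eq_square)
  moreover have "{\<omega> \<in> space M. \<not> (ennreal (r / 2) \<le> num_points w A \<omega> \<and> num_points w A \<omega> \<le> ennreal (3/2 * r))} = space M - good"
    unfolding good_def by auto
  ultimately show ?thesis unfolding r_def[symmetric] by (simp add: prob_compl)
qed

lemma AE_num_points_concentrated:
  fixes A :: "nat \<Rightarrow> real set"
  assumes A: "\<And>k. A k \<in> sets \<nu>" "\<And>k. emeasure \<nu> (A k) < \<infinity>"
    and pos: "\<forall>\<^sub>F k in sequentially. measure \<nu> (A k) > 0" and sum: "summable (\<lambda>k. 1 / measure \<nu> (A k))"
  shows "AE \<omega> in M. \<forall>\<^sub>F k in sequentially. ennreal (measure \<nu> (A k) / 2) \<le> num_points w (A k) \<omega> \<and>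
      num_points w (A k) \<omega> \<le> ennreal (3/2 * measure \<nu> (A k))"
proof -
  note [measurable] = A(1)
  define bad where "bad k = {\<omega> \<in> space M. \<not> (ennreal (measure \<nu> (A k) / 2) \<le> num_points w (A k) \<omega> \<and>
      num_points w (A k) \<omega> \<le> ennreal (3/2 * measure \<nu> (A k)))}" for k
  have "summable (\<lambda>k. prob (bad k))"
  proof (rule summable_comparison_test_ev)
    show "summable (\<lambda>k. 4 * (1 / measure \<nu> (A k)))" using sum by (rule summable_mult)
    show "\<forall>\<^sub>F k in sequentially. norm (prob (bad k)) \<le> 4 * (1 / measure \<nu> (A k))"
      using pos prob_num_points_deviation_le[OF A] unfolding bad_def by (auto elim!: eventually_mono)
  qed
  then have "AE \<omega> in M. \<forall>\<^sub>F k in sequentially. \<omega> \<in> space M - bad k"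
    by (intro borel_cantelli_AE1) (auto simp: bad_def less_top[symmetric])
  then show ?thesis
    by eventually_elim (auto simp: bad_def elim!: eventually_mono)
qed

end

lemma (in rate_measure) emeasure_rate_finite:
  assumes a: "a > 0"
  shows "emeasure \<nu> {a<..1} < \<infinity>"
proof -
  have A: "{a<..1} \<in> sets \<nu>" using a by (auto simp: sets_rate sets_restrict_space image_iff intro!: bexI[of _ "{a<..1}"])
  have "ennreal a * emeasure \<nu> {a<..1} = (\<integral>\<^sup>+x. ennreal a * indicator {a<..1} x \<partial>\<nu>)"
    using A by (simp add: nn_integral_cmult_indicator)
  also have "\<dots> \<le> (\<integral>\<^sup>+x. ennreal x \<partial>\<nu>)"
    by (intro nn_integral_mono) (auto simp: indicator_def intro!: ennreal_leI)
  also have "\<dots> < \<infinity>" by (rule finite_mean_rate)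
  finally show ?thesis using a by (auto simp: ennreal_mult_less_top)
qed

section \<open>Rates of the dyadic shells\<close>

text \<open>Half-open intervals, so that the shells partition the positive weights.\<close>
definition shell :: "nat \<Rightarrow> real set" where
  "shell k = {1 / 2 ^ Suc k<..1 / 2 ^ k}"

context slowly_varying_tail
begin

text \<open>Up to constants, the expected number of weights in a shell.\<close>
definition block_size :: "nat \<Rightarrow> real" where
  "block_size k = 2 ^ k * block k"

text \<open>Up to constants, the number of vertices at time $2^n$.\<close>
definition growth :: "nat \<Rightarrow> real" where
  "growth n = 2 ^ n * tail (2 ^ n)"

lemma block_size_pos: "onset \<le> 2 ^ k \<Longrightarrow> 0 < block_size k"
  unfolding block_size_def using block_pos by simp

lemma block_size_Suc: "onset \<le> 2 ^ k \<Longrightarrow> 3/2 * block_size k \<le> block_size (Suc k)"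
  unfolding block_size_def using block_Suc[of k] by simp

lemma block_size_le_growth: "onset \<le> 2 ^ k \<Longrightarrow> block_size k \<le> growth k"
proof -
  assume *: "onset \<le> 2 ^ k"
  then have "0 \<le> tail (2 ^ Suc k)" using onset(1) by (intro tail_nonneg) simp
  then show ?thesis unfolding block_size_def growth_def using block_eq[OF *] by simp
qed

lemma growth_pos: "onset \<le> 2 ^ n \<Longrightarrow> 0 < growth n"
  unfolding growth_def using tail_pos by simp

lemma summable_inverse_block_size: "summable (\<lambda>k. 1 / block_size k)"
proof -
  obtain N where N: "\<And>n. n \<ge> N \<Longrightarrow> onset \<le> 2 ^ n"
    using eventually_onset_le by (auto simp: eventually_sequentially)
  show ?thesis
  proof (rule summable_ratio_test[of "2/3" N])
    fix n assume "N \<le> n"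
    then have n: "onset \<le> 2 ^ n" "onset \<le> 2 ^ Suc n" using N[of n] N[of "Suc n"] by auto
    have "3/2 * block_size n \<le> block_size (Suc n)" by (rule block_size_Suc[OF n(1)])
    then show "norm (1 / block_size (Suc n)) \<le> 2/3 * norm (1 / block_size n)"
      using block_size_pos[OF n(1)] block_size_pos[OF n(2)] by (simp add: field_simps)
  qed simp
qed

lemma summable_inverse_growth: "summable (\<lambda>n. 1 / growth n)"
proof (rule summable_comparison_test_ev[OF _ summable_inverse_block_size])
  show "\<forall>\<^sub>F n in sequentially. norm (1 / growth n) \<le> 1 / block_size n"
    using eventually_onset_le
  proof eventually_elim
    case (elim n)
    then show ?case using block_size_pos[OF elim] block_size_le_growth[OF elim] growth_pos[OF elim]
      by (simp add: frac_le)
  qed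
qed

lemma measurable_above_onset: "(\<lambda>u. L u * indicator {onset..} u) \<in> borel_measurable borel"
proof -
  have [measurable]: "(\<lambda>u. indicator {onset..} u *\<^sub>R (L u / u)) \<in> borel_measurable borel"
  proof -
    have "(\<lambda>u. indicator {onset..} u *\<^sub>R (L u / u)) \<in> borel_measurable lborel"
      using onset(2) unfolding set_integrable_def by (rule borel_measurable_integrable)
    then show ?thesis by simp
  qed
  have "(\<lambda>u. u * (indicator {onset..} u *\<^sub>R (L u / u))) \<in> borel_measurable borel" by measurable
  also have "(\<lambda>u. u * (indicator {onset..} u *\<^sub>R (L u / u))) = (\<lambda>u. L u * indicator {onset..} u)"
    using onset(1) by (auto simp: fun_eq_iff indicator_def)
  finally show ?thesis .
qed

text \<open>On the block, $L(u)$ and $2^k L(u)/u$ differ by a factor between one and two.\<close>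
lemma nn_integral_block:
  assumes "onset \<le> 2 ^ k"
  shows "ennreal (block_size k) \<le> (\<integral>\<^sup>+u. ennreal (L u * indicator {onset..} u) * indicator {2 ^ k..2 ^ Suc k} u \<partial>lborel)" (is "_ \<le> ?I")
    "(\<integral>\<^sup>+u. ennreal (L u * indicator {onset..} u) * indicator {2 ^ k..2 ^ Suc k} u \<partial>lborel) \<le> ennreal (2 * block_size k)"
proof -
  define h where "h u = indicator {2 ^ k..<2 ^ Suc k} u *\<^sub>R (L u / u)" for u
  have nn: "0 \<le> h u" for u :: real
    using assms onset(1) L_pos[of u] by (auto simp: h_def indicator_def)
  have int: "integrable lborel h"
    using set_integrable_tail[of "{2 ^ k..<2 ^ Suc k}"] assms unfolding set_integrable_def h_def[abs_def] by fastforce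
  have [measurable]: "h \<in> borel_measurable lborel"
    using int by (rule borel_measurable_integrable)
  have m: "(\<lambda>u. ennreal (h u)) \<in> borel_measurable lborel"
    by measurable
  have B: "(\<integral>\<^sup>+u. ennreal (h u) \<partial>lborel) = ennreal (block k)"
    unfolding block_def set_lebesgue_integral_def h_def[abs_def, symmetric] by (rule nn_integral_eq_integral[OF int]) (use nn in auto)
  have "ennreal (block_size k) = ennreal (2 ^ k) * (\<integral>\<^sup>+u. ennreal (h u) \<partial>lborel)"
    unfolding B block_size_def using block_pos[OF assms] by (simp add: ennreal_mult less_imp_le)
  also have "\<dots> = (\<integral>\<^sup>+u. ennreal (2 ^ k) * ennreal (h u) \<partial>lborel)"
    by (rule nn_integral_cmult[OF m, symmetric])
  also have "\<dots> \<le> ?I"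
  proof (rule nn_integral_mono)
    fix u :: real
    show "ennreal (2 ^ k) * ennreal (h u) \<le> ennreal (L u * indicator {onset..} u) * indicator {2 ^ k..2 ^ Suc k} u"
    proof (cases "u \<in> {2 ^ k..<2 ^ Suc k}")
      case True
      then have u: "2 ^ k \<le> u" "u > 0" "u \<ge> onset" using assms onset(1) by auto
      have "2 ^ k * L u \<le> u * L u" using u L_pos[of u] by (intro mult_right_mono) auto
      then have "2 ^ k * (L u / u) \<le> L u" using u by (simp add: field_simps)
      then show ?thesis using True u L_pos[of u] by (simp add: h_def ennreal_mult[symmetric] ennreal_leI)
    qed (simp add: h_def)
  qed
  finally show "ennreal (block_size k) \<le> ?I" .
  have "?I = (\<integral>\<^sup>+u. ennreal (L u * indicator {onset..} u) * indicator {2 ^ k..<2 ^ Suc k} u \<partial>lborel)"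
  proof (rule nn_integral_cong_AE)
    show "AE u in lborel. ennreal (L u * indicator {onset..} u) * indicator {2 ^ k..2 ^ Suc k} u
       = ennreal (L u * indicator {onset..} u) * indicator {2 ^ k..<2 ^ Suc k} u"
      using AE_lborel_singleton[of "2 ^ Suc k"] by eventually_elim (auto simp: indicator_def)
  qed
  also have "\<dots> \<le> (\<integral>\<^sup>+u. ennreal (2 ^ Suc k) * ennreal (h u) \<partial>lborel)"
  proof (rule nn_integral_mono)
    fix u :: real
    show "ennreal (L u * indicator {onset..} u) * indicator {2 ^ k..<2 ^ Suc k} u \<le> ennreal (2 ^ Suc k) * ennreal (h u)"
    proof (cases "u \<in> {2 ^ k..<2 ^ Suc k}")
      case True
      then have u: "u \<le> 2 ^ Suc k" "u > 0" "u \<ge> onset" using assms onset(1) by auto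
      have "u * L u \<le> 2 ^ Suc k * L u" using u L_pos[of u] by (intro mult_right_mono) auto
      then have "L u \<le> 2 ^ Suc k * (L u / u)" using u by (simp add: field_simps)
      then show ?thesis using True u L_pos[of u] by (simp add: h_def ennreal_mult[symmetric] ennreal_leI)
    qed (simp add: h_def)
  qed
  also have "\<dots> = ennreal (2 ^ Suc k) * (\<integral>\<^sup>+u. ennreal (h u) \<partial>lborel)"
    by (rule nn_integral_cmult[OF m])
  also have "\<dots> = ennreal (2 * block_size k)"
    unfolding B block_size_def using block_pos[OF assms] by (simp add: ennreal_mult[symmetric] less_imp_le mult.assoc)
  finally show "?I \<le> ennreal (2 * block_size k)" .
qed

text \<open>The substitution $u=1/x$ turns $x^{-2}L(1/x)\,dx$ on a shell into $L(u)\,du$ on the dyadic block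
  of the same index. The constants leave a factor of two for the asymptotic equivalence and, in
  the upper bound, another one for the width of the block.\<close>
lemma shell_rate_bounds:
  fixes f :: "real \<Rightarrow> real"
  assumes meas: "f \<in> borel_measurable (restrict_space lborel {0..1})"
    and dens: "\<nu> = density (restrict_space lborel {0..1}) (\<lambda>x. ennreal (f x))"
    and c: "c > 0"
    and asymp: "f \<sim>[at_right 0] (\<lambda>x. c * x powr (-2) * L (1 / x))"
  shows "\<forall>\<^sub>F k in sequentially. ennreal (c/2 * block_size k) \<le> emeasure \<nu> (shell k) \<and>
      emeasure \<nu> (shell k) \<le> ennreal (4 * c * block_size k)"
proof -
  have "\<forall>\<^sub>F x in at_right 0. c * x powr (-2) * L (1 / x) \<noteq> 0"
    using eventually_at_right_less[of "0::real"]
  proof eventually_elim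
    case (elim x)
    then show ?case using c L_pos[of "1 / x"] by simp
  qed
  then have "((\<lambda>x. f x / (c * x powr (-2) * L (1 / x))) \<longlongrightarrow> 1) (at_right 0)"
    by (intro asymp_equivD_strong[OF asymp]) (auto elim!: eventually_mono)
  then have "\<forall>\<^sub>F x in at_right 0. 1/2 < f x / (c * x powr (-2) * L (1 / x)) \<and> f x / (c * x powr (-2) * L (1 / x)) < 2"
    by (intro eventually_conj) (rule order_tendstoD, assumption, simp)+
  then have "\<forall>\<^sub>F x in at_right 0. c/2 * (L (1 / x) * (1 / x\<^sup>2)) \<le> f x \<and> f x \<le> 2 * c * (L (1 / x) * (1 / x\<^sup>2))"
    using eventually_at_right_less[of "0::real"]
  proof eventually_elim
    case (elim x)
    have "x powr (-2) = 1 / x powr 2" by (rule powr_minus_divide)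
    also have "x powr 2 = x\<^sup>2" using elim by (intro powr_numeral) simp
    finally have eq: "c * x powr (-2) * L (1 / x) = c * (L (1 / x) * (1 / x\<^sup>2))" by simp
    define p where "p = c * (L (1 / x) * (1 / x\<^sup>2))"
    have "L (1 / x) > 0" using elim L_pos[of "1 / x"] by simp
    then have "p > 0" unfolding p_def using elim c by simp
    moreover have "1/2 < f x / p" "f x / p < 2" using elim unfolding eq p_def by auto
    ultimately have "1/2 * p \<le> f x" "f x \<le> 2 * p" by (simp_all add: field_simps)
    then show ?case unfolding p_def by simp
  qed
  then obtain \<delta> where \<delta>: "\<delta> > 0"
    "\<And>x. 0 < x \<Longrightarrow> x < \<delta> \<Longrightarrow> c/2 * (L (1 / x) * (1 / x\<^sup>2)) \<le> f x"
    "\<And>x. 0 < x \<Longrightarrow> x < \<delta> \<Longrightarrow> f x \<le> 2 * c * (L (1 / x) * (1 / x\<^sup>2))"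
    by (auto simp: eventually_at_right_field)
  have "(\<lambda>k. (1/2::real) ^ k) \<longlonglongrightarrow> 0" by (rule LIMSEQ_power_zero) simp
  then have "\<forall>\<^sub>F k in sequentially. (1/2::real) ^ k < \<delta>" using \<delta>(1) by (rule order_tendstoD)
  then show ?thesis using eventually_onset_le
  proof eventually_elim
    case (elim k)
    define a b where "a = (1 / 2 ^ Suc k :: real)" and "b = (1 / 2 ^ k :: real)"
    have ab: "0 < a" "a < b" "b < \<delta>" "b \<le> 1" "1 / b = 2 ^ k" "1 / a = 2 ^ Suc k"
      using elim(1) by (auto simp: a_def b_def power_divide divide_simps)
    have sub: "shell k = {a<..b}" unfolding shell_def a_def b_def ..
    have "emeasure \<nu> {a<..b} = (\<integral>\<^sup>+x. ennreal (f x) * indicator {a<..b} x \<partial>restrict_space lborel {0..1})"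
      unfolding dens by (rule emeasure_density) (use meas ab in \<open>auto simp: sets_restrict_space image_iff intro!: bexI[of _ "{a<..b}"]\<close>)
    also have "\<dots> = (\<integral>\<^sup>+x. ennreal (f x) * indicator {a<..b} x * indicator {0..1} x \<partial>lborel)"
      by (subst nn_integral_restrict_space) auto
    also have "\<dots> = (\<integral>\<^sup>+x. ennreal (f x) * indicator {a..b} x \<partial>lborel)"
    proof (rule nn_integral_cong_AE)
      show "AE x in lborel. ennreal (f x) * indicator {a<..b} x * indicator {0..1} x = ennreal (f x) * indicator {a..b} x"
        using AE_lborel_singleton[of a] by eventually_elim (use ab in \<open>auto simp: indicator_def\<close>)
    qed
    finally have \<nu>: "emeasure \<nu> (shell k) = (\<integral>\<^sup>+x. ennreal (f x) * indicator {a..b} x \<partial>lborel)" unfolding sub .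
    define F where "F u = ennreal (L u * indicator {onset..} u)" for u
    have F[measurable]: "F \<in> borel_measurable borel" unfolding F_def using measurable_above_onset by measurable
    have Fm[measurable]: "(\<lambda>x. F (1 / x) * ennreal (1 / x\<^sup>2) * indicator {a..b} x) \<in> borel_measurable lborel"
      by measurable
    have FF: "F (1 / x) * ennreal (1 / x\<^sup>2) = ennreal (L (1 / x) * (1 / x\<^sup>2))" and Lx: "0 < L (1 / x)" and x: "0 < x" "x < \<delta>" if "x \<in> {a..b}" for x
    proof -
      show "0 < x" "x < \<delta>" using that ab by auto
      then show "0 < L (1 / x)" by (intro L_pos) simp
      have "2 ^ k \<le> 1 / x" unfolding ab(5)[symmetric] using that ab by (intro divide_left_mono) auto
      then have "onset \<le> 1 / x" using elim(2) by simp
      then show "F (1 / x) * ennreal (1 / x\<^sup>2) = ennreal (L (1 / x) * (1 / x\<^sup>2))"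
        unfolding F_def using \<open>0 < L (1 / x)\<close> by (subst ennreal_mult) auto
    qed
    have sub: "(\<integral>\<^sup>+x. F (1 / x) * ennreal (1 / x\<^sup>2) * indicator {a..b} x \<partial>lborel) = (\<integral>\<^sup>+u. F u * indicator {2 ^ k..2 ^ Suc k} u \<partial>lborel)"
      using nn_integral_substitution_inverse[OF F ab(1,2)] unfolding ab(5,6) .
    have "ennreal (c/2 * block_size k) = ennreal (c/2) * ennreal (block_size k)"
      using c block_size_pos[OF elim(2)] by (subst ennreal_mult) auto
    also have "\<dots> \<le> ennreal (c/2) * (\<integral>\<^sup>+u. F u * indicator {2 ^ k..2 ^ Suc k} u \<partial>lborel)"
      unfolding F_def by (intro mult_left_mono nn_integral_block(1)[OF elim(2)]) simp
    also have "\<dots> = (\<integral>\<^sup>+x. ennreal (c/2) * (F (1 / x) * ennreal (1 / x\<^sup>2) * indicator {a..b} x) \<partial>lborel)"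
      unfolding sub[symmetric] by (rule nn_integral_cmult[symmetric]) (rule Fm)
    also have "\<dots> \<le> (\<integral>\<^sup>+x. ennreal (f x) * indicator {a..b} x \<partial>lborel)"
    proof (rule nn_integral_mono)
      fix x show "ennreal (c/2) * (F (1 / x) * ennreal (1 / x\<^sup>2) * indicator {a..b} x) \<le> ennreal (f x) * indicator {a..b} x"
      proof (cases "x \<in> {a..b}")
        case True
        have "ennreal (c/2) * ennreal (L (1 / x) * (1 / x\<^sup>2)) = ennreal (c/2 * (L (1 / x) * (1 / x\<^sup>2)))"
          using c Lx[OF True] by (intro ennreal_mult[symmetric]) auto
        also have "\<dots> \<le> ennreal (f x)" using \<delta>(2) x[OF True] by (intro ennreal_leI) auto
        finally show ?thesis using True by (simp only: FF[OF True]) simp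
      qed simp
    qed
    finally have lower: "ennreal (c/2 * block_size k) \<le> emeasure \<nu> (shell k)" unfolding \<nu> .
    have "emeasure \<nu> (shell k) \<le> (\<integral>\<^sup>+x. ennreal (2 * c) * (F (1 / x) * ennreal (1 / x\<^sup>2) * indicator {a..b} x) \<partial>lborel)"
      unfolding \<nu>
    proof (rule nn_integral_mono)
      fix x show "ennreal (f x) * indicator {a..b} x \<le> ennreal (2 * c) * (F (1 / x) * ennreal (1 / x\<^sup>2) * indicator {a..b} x)"
      proof (cases "x \<in> {a..b}")
        case True
        have "ennreal (f x) \<le> ennreal (2 * c * (L (1 / x) * (1 / x\<^sup>2)))" using \<delta>(3) x[OF True] by (intro ennreal_leI) auto
        also have "\<dots> = ennreal (2 * c) * ennreal (L (1 / x) * (1 / x\<^sup>2))"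
          using c Lx[OF True] by (intro ennreal_mult) auto
        finally show ?thesis using True by (simp only: FF[OF True]) simp
      qed simp
    qed
    also have "\<dots> = ennreal (2 * c) * (\<integral>\<^sup>+u. F u * indicator {2 ^ k..2 ^ Suc k} u \<partial>lborel)"
      unfolding sub[symmetric] by (rule nn_integral_cmult) (rule Fm)
    also have "\<dots> \<le> ennreal (2 * c) * ennreal (2 * block_size k)"
      unfolding F_def by (intro mult_left_mono nn_integral_block(2)[OF elim(2)]) simp
    also have "\<dots> = ennreal (4 * c * block_size k)"
      using c block_size_pos[OF elim(2)] by (subst ennreal_mult[symmetric]) (auto simp: algebra_simps)
    finally show ?case using lower by simp
  qed
qed

end

section \<open>Weights of a typical realization\<close>

lemma suminf_ennreal_eq_of_sums:
  assumes "\<And>k. 0 \<le> f k" "f sums x"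
  shows "(\<Sum>k. ennreal (f k)) = ennreal x"
  using suminf_ennreal2[OF assms(1) sums_summable[OF assms(2)]] sums_unique[OF assms(2)] by simp

lemma UN_shell: "(\<Union>k. shell (k + n)) = {0<..1 / 2 ^ n}"
proof (intro equalityI subsetI)
  fix x :: real assume "x \<in> (\<Union>k. shell (k + n))"
  then obtain k where x: "1 / 2 ^ Suc (k + n) < x" "x \<le> 1 / 2 ^ (k + n)" by (auto simp: shell_def)
  have "(1::real) / 2 ^ (k + n) \<le> 1 / 2 ^ n" by (intro divide_left_mono power_increasing) auto
  moreover have "0 < x" using x(1) by (rule less_trans[rotated]) simp
  ultimately show "x \<in> {0<..1 / 2 ^ n}" using x(2) by simp
next
  fix x :: real assume x: "x \<in> {0<..1 / 2 ^ n}"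
  define k where "k = (LEAST k. 1 / 2 ^ Suc (k + n) < x)"
  have "\<exists>k. 1 / 2 ^ Suc (k + n) < x"
  proof -
    obtain N where N: "(1/2::real) ^ N < x" using real_arch_pow_inv[of x "1/2"] x by auto
    have "(1/2::real) ^ Suc (N + n) \<le> (1/2) ^ N" by (rule power_decreasing) auto
    then show ?thesis using N by (intro exI[of _ N]) (simp add: power_divide)
  qed
  then have k: "1 / 2 ^ Suc (k + n) < x" unfolding k_def by (rule LeastI_ex)
  have "x \<le> 1 / 2 ^ (k + n)"
  proof (cases k)
    case 0
    then show ?thesis using x by simp
  next
    case (Suc k')
    then have "\<not> 1 / 2 ^ Suc (k' + n) < x" using not_less_Least[of k' "\<lambda>k. 1 / 2 ^ Suc (k + n) < x"] unfolding k_def by auto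
    then show ?thesis using Suc by simp
  qed
  then show "x \<in> (\<Union>k. shell (k + n))" using k by (auto simp: shell_def simp del: power_Suc)
qed

lemma shell_disjoint: "disjoint_family (\<lambda>k. shell (k + n))"
proof -
  have "shell k \<inter> shell l = {}" if "k < l" for k l
  proof -
    have "(1::real) / 2 ^ l \<le> 1 / 2 ^ Suc k" using that by (intro divide_left_mono power_increasing) auto
    then show ?thesis unfolding shell_def by (auto simp del: power_Suc)
  qed
  then show ?thesis unfolding disjoint_family_on_def
    by (metis Int_commute add_right_cancel linorder_neqE_nat)
qed

definition small_mass :: "(nat \<Rightarrow> 'a \<Rightarrow> real) \<Rightarrow> nat \<Rightarrow> 'a \<Rightarrow> ennreal" where
  "small_mass w n \<omega> = (\<integral>\<^sup>+i. ennreal (w i \<omega>) * indicator {..1 / 2 ^ n} (w i \<omega>) \<partial>count_space UNIV)"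

definition shell_mass :: "(nat \<Rightarrow> 'a \<Rightarrow> real) \<Rightarrow> nat \<Rightarrow> 'a \<Rightarrow> ennreal" where
  "shell_mass w k \<omega> = (\<integral>\<^sup>+i. ennreal (w i \<omega>) * indicator (shell k) (w i \<omega>) \<partial>count_space UNIV)"

lemma num_points_Un:
  assumes "A \<inter> B = {}"
  shows "num_points w (A \<union> B) \<omega> = num_points w A \<omega> + num_points w B \<omega>"
  unfolding num_points_eq_nn_integral
  by (subst nn_integral_add[symmetric]) (use assms in \<open>auto simp: indicator_def intro!: nn_integral_cong\<close>)

lemma small_mass_eq_suminf:
  assumes nn: "\<And>i. 0 \<le> w i \<omega>"
  shows "small_mass w n \<omega> = (\<Sum>k. shell_mass w (k + n) \<omega>)"
proof -
  have "ennreal (w i \<omega>) * indicator {..1 / 2 ^ n} (w i \<omega>) = (\<Sum>k. ennreal (w i \<omega>) * indicator (shell (k + n)) (w i \<omega>))" for i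
  proof -
    have "(\<Sum>k. ennreal (w i \<omega>) * indicator (shell (k + n)) (w i \<omega>)) = ennreal (w i \<omega>) * indicator {0<..1 / 2 ^ n} (w i \<omega>)"
      unfolding UN_shell[of n, symmetric] by (subst suminf_indicator[OF shell_disjoint, symmetric]) simp
    also have "\<dots> = ennreal (w i \<omega>) * indicator {..1 / 2 ^ n} (w i \<omega>)"
      using nn[of i] by (cases "w i \<omega> = 0") (auto simp: indicator_def)
    finally show ?thesis ..
  qed
  then have "small_mass w n \<omega> = (\<integral>\<^sup>+i. (\<Sum>k. ennreal (w i \<omega>) * indicator (shell (k + n)) (w i \<omega>)) \<partial>count_space UNIV)"
    unfolding small_mass_def by simp
  also have "\<dots> = (\<Sum>k. shell_mass w (k + n) \<omega>)"
    unfolding shell_mass_def by (rule nn_integral_suminf) simp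
  finally show ?thesis .
qed

lemma shell_mass_bounds:
  shows "ennreal (1 / 2 ^ Suc k) * num_points w (shell k) \<omega> \<le> shell_mass w k \<omega>"
    "shell_mass w k \<omega> \<le> ennreal (1 / 2 ^ k) * num_points w (shell k) \<omega>"
  unfolding shell_mass_def num_points_eq_nn_integral nn_integral_cmult[OF borel_measurable_count_space, symmetric]
  by (intro nn_integral_mono; auto simp: indicator_def shell_def ennreal_leI simp del: power_Suc)+

context slowly_varying_tail
begin

text \<open>A weight in shell $k$ is at most $2^{-k}$, so the shell contributes at most a multiple of the
  integral of $L(u)/u$ over block $k$; these add up to the tail.\<close>
lemma small_mass_le:
  assumes nn: "\<And>i. 0 \<le> w i \<omega>" and C: "C \<ge> 0"
    and le: "\<forall>\<^sub>F k in sequentially. num_points w (shell k) \<omega> \<le> ennreal (C * block_size k)"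
  shows "\<forall>\<^sub>F n in sequentially. small_mass w n \<omega> \<le> ennreal (C * tail (2 ^ n))"
  using eventually_all_ge_at_top[OF eventually_conj[OF le eventually_onset_le]]
proof eventually_elim
  case (elim n)
  have on: "onset \<le> 2 ^ (k + n)" and Dk: "num_points w (shell (k + n)) \<omega> \<le> ennreal (C * block_size (k + n))" for k
    using elim by auto
  have "small_mass w n \<omega> \<le> (\<Sum>k. ennreal (C * block (k + n)))"
    unfolding small_mass_eq_suminf[of w \<omega>, OF nn]
  proof (intro suminf_le)
    fix k
    have "shell_mass w (k + n) \<omega>
      \<le> ennreal (1 / 2 ^ (k + n)) * num_points w (shell (k + n)) \<omega>" by (rule shell_mass_bounds)
    also have "\<dots> \<le> ennreal (1 / 2 ^ (k + n)) * ennreal (C * block_size (k + n))" by (intro mult_left_mono Dk) simp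
    also have "\<dots> = ennreal (C * block (k + n))"
      using C block_pos[OF on[of k]] by (simp add: ennreal_mult[symmetric] block_size_def)
    finally show "shell_mass w (k + n) \<omega> \<le> ennreal (C * block (k + n))" .
  qed auto
  also have "\<dots> = ennreal (C * tail (2 ^ n))"
  proof -
    have s: "(\<lambda>k. C * block (k + n)) sums (C * tail (2 ^ n))"
      using block_sums[OF on[of 0, simplified]] by (rule sums_mult)
    have "0 \<le> C * block (k + n)" for k using C block_pos[OF on[of k]] by simp
    then show ?thesis using s by (rule suminf_ennreal_eq_of_sums)
  qed
  finally show ?case .
qed

lemma small_mass_ge:
  assumes nn: "\<And>i. 0 \<le> w i \<omega>" and c: "c \<ge> 0"
    and ge: "\<forall>\<^sub>F k in sequentially. ennreal (c * block_size k) \<le> num_points w (shell k) \<omega>"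
  shows "\<forall>\<^sub>F n in sequentially. ennreal (c / 2 * tail (2 ^ n)) \<le> small_mass w n \<omega>"
  using eventually_all_ge_at_top[OF eventually_conj[OF ge eventually_onset_le]]
proof eventually_elim
  case (elim n)
  have on: "onset \<le> 2 ^ (k + n)" and Dk: "ennreal (c * block_size (k + n)) \<le> num_points w (shell (k + n)) \<omega>" for k
    using elim by auto
  have "ennreal (c / 2 * tail (2 ^ n)) = (\<Sum>k. ennreal (c / 2 * block (k + n)))"
  proof -
    have s: "(\<lambda>k. c / 2 * block (k + n)) sums (c / 2 * tail (2 ^ n))"
      using block_sums[OF on[of 0, simplified]] by (rule sums_mult)
    have "0 \<le> c / 2 * block (k + n)" for k using c block_pos[OF on[of k]] by simp
    then show ?thesis using s by (rule suminf_ennreal_eq_of_sums[symmetric])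
  qed
  also have "\<dots> \<le> small_mass w n \<omega>"
    unfolding small_mass_eq_suminf[of w \<omega>, OF nn]
  proof (intro suminf_le)
    fix k
    have "ennreal (c / 2 * block (k + n)) = ennreal (1 / 2 ^ Suc (k + n)) * ennreal (c * block_size (k + n))"
      using c block_pos[OF on[of k]] by (simp add: ennreal_mult[symmetric] block_size_def)
    also have "\<dots> \<le> ennreal (1 / 2 ^ Suc (k + n)) * num_points w (shell (k + n)) \<omega>" by (intro mult_left_mono Dk) simp
    also have "\<dots> \<le> shell_mass w (k + n) \<omega>" by (rule shell_mass_bounds)
    finally show "ennreal (c / 2 * block (k + n)) \<le> shell_mass w (k + n) \<omega>" .
  qed auto
  finally show ?case .
qed

text \<open>The numbers of weights in the shells grow geometrically, so their sum is of the order of the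
  last term: with $K\ge 2C$, adding the shell of index $n$ multiplies the bound by at most $3/2$, which is what
  the growth of the blocks provides.\<close>
lemma num_large_le:
  assumes C: "C > 0" and le: "\<forall>\<^sub>F k in sequentially. num_points w (shell k) \<omega> \<le> ennreal (C * block_size k)"
    and fin: "\<And>n. num_points w {1 / 2 ^ n<..1} \<omega> < \<infinity>"
  shows "\<exists>K>0. \<forall>\<^sub>F n in sequentially. num_points w {1 / 2 ^ n<..1} \<omega> \<le> ennreal (K * growth n)"
proof -
  obtain N where N: "\<And>k. k \<ge> N \<Longrightarrow> num_points w (shell k) \<omega> \<le> ennreal (C * block_size k)" "\<And>k. k \<ge> N \<Longrightarrow> onset \<le> 2 ^ k"
    using eventually_conj[OF le eventually_onset_le] unfolding eventually_sequentially by blast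
  obtain B where B: "num_points w {1 / 2 ^ N<..1} \<omega> = ennreal B" "B \<ge> 0"
    using fin[of N] by (cases "num_points w {1 / 2 ^ N<..1} \<omega>") auto
  define K where "K = max (2 * C) (B / block_size N)"
  have K: "K > 0" "2 * C \<le> K" unfolding K_def using C by auto
  have "num_points w {1 / 2 ^ n<..1} \<omega> \<le> ennreal (K * block_size n)" if "n \<ge> N" for n
    using that
  proof (induction n rule: dec_induct)
    case base
    have "B \<le> K * block_size N"
      using block_size_pos[OF N(2)[of N]] unfolding K_def by (simp add: pos_divide_le_eq[symmetric])
    then show ?case unfolding B by (rule ennreal_leI)
  next
    case (step n)
    have pos: "block_size n > 0" using block_size_pos[OF N(2)] step by auto
    have "(1::real) / 2 ^ Suc n \<le> 1 / 2 ^ n" "(1::real) / 2 ^ n \<le> 1" by (auto simp: divide_simps)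
    moreover have *: "{a<..1} = {b<..1} \<union> {a<..b}" if "a \<le> b" "b \<le> 1" for a b :: real using that by auto
    ultimately have eq: "{1 / 2 ^ Suc n<..1} = {1 / 2 ^ n<..1} \<union> shell n" unfolding shell_def by blast
    have "num_points w {1 / 2 ^ Suc n<..1} \<omega> = num_points w {1 / 2 ^ n<..1} \<omega> + num_points w (shell n) \<omega>"
      unfolding eq by (rule num_points_Un) (auto simp: shell_def)
    also have "\<dots> \<le> ennreal (K * block_size n) + ennreal (C * block_size n)"
      using step N(1)[of n] by (intro add_mono) auto
    also have "\<dots> = ennreal (K * block_size n + C * block_size n)"
      using pos K C by (intro ennreal_plus[symmetric]) auto
    also have "\<dots> \<le> ennreal (K * block_size (Suc n))"
    proof (rule ennreal_leI)
      have "C * block_size n \<le> K / 2 * block_size n" using K(2) pos by (intro mult_right_mono) auto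
      then have "K * block_size n + C * block_size n \<le> K * (3/2 * block_size n)" by (simp add: algebra_simps)
      also have "\<dots> \<le> K * block_size (Suc n)" using block_size_Suc[OF N(2)] step K(1) by (intro mult_left_mono) auto
      finally show "K * block_size n + C * block_size n \<le> K * block_size (Suc n)" .
    qed
    finally show ?case .
  qed
  moreover have "ennreal (K * block_size n) \<le> ennreal (K * growth n)" if "n \<ge> N" for n
    using block_size_le_growth[OF N(2)[OF that]] K(1) by (intro ennreal_leI mult_left_mono) auto
  ultimately show ?thesis using K(1) unfolding eventually_sequentially by (blast intro: order_trans)
qed

end

text \<open>All that the graph needs to know about a realization of the weights: the order of magnitude of the
  mass below each level $2^{-n}$, and a bound for the number of weights above it.\<close>
definition typical_weights :: "(real \<Rightarrow> real) \<Rightarrow> (nat \<Rightarrow> 'a \<Rightarrow> real) \<Rightarrow> 'a \<Rightarrow> bool" where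
  "typical_weights L w \<omega> \<longleftrightarrow>
     (\<forall>i. 0 \<le> w i \<omega> \<and> w i \<omega> \<le> 1) \<and>
     (\<exists>c>0. \<forall>\<^sub>F n in sequentially. ennreal (c * tail_integral L (2 ^ n)) \<le> small_mass w n \<omega>) \<and>
     (\<exists>C>0. \<forall>\<^sub>F n in sequentially. small_mass w n \<omega> \<le> ennreal (C * tail_integral L (2 ^ n))) \<and>
     (\<exists>C>0. \<forall>\<^sub>F n in sequentially. num_points w {1 / 2 ^ n<..1} \<omega> \<le> ennreal (C * (2 ^ n * tail_integral L (2 ^ n))))"

lemma (in rate_measure) space_rate: "space \<nu> = {0..1}"
  using sets_eq_imp_space_eq[OF sets_rate] by (simp add: space_restrict_space)

lemma (in rate_measure) sets_rateI: "A \<in> sets borel \<Longrightarrow> A \<subseteq> {0..1} \<Longrightarrow> A \<in> sets \<nu>"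
  by (auto simp: sets_rate sets_restrict_space image_iff)

lemma shell_subset: "shell k \<subseteq> {1 / 2 ^ Suc k<..1}"
proof -
  have "(1::real) / 2 ^ k \<le> 1" by (simp add: divide_simps)
  moreover have "{a<..b} \<subseteq> {a<..1}" if "b \<le> 1" for a b :: real using that by auto
  ultimately show ?thesis unfolding shell_def by blast
qed

text \<open>The expected numbers of weights in the shells grow geometrically, so the actual numbers are of
  the same order for all but finitely many shells. The weights in the remaining shells are finite in
  number and only affect the constants.\<close>
lemma (in poisson_process) AE_typical_weights:
  fixes f :: "real \<Rightarrow> real"
  assumes L: "slowly_varying_tail L"
    and meas: "f \<in> borel_measurable (restrict_space lborel {0..1})"
    and dens: "\<nu> = density (restrict_space lborel {0..1}) (\<lambda>x. ennreal (f x))"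
    and c: "c > 0"
    and asymp: "f \<sim>[at_right 0] (\<lambda>x. c * x powr (-2) * L (1 / x))"
  shows "AE \<omega> in M. typical_weights L w \<omega>"
proof -
  interpret slowly_varying_tail L by fact
  note rates = shell_rate_bounds[OF meas dens c asymp]
  have sub01: "{1 / 2 ^ n<..1} \<subseteq> {0..1::real}" for n :: nat
  proof -
    have "{a<..1} \<subseteq> {0..1}" if "0 < a" for a :: real using that by auto
    then show ?thesis by simp
  qed
  have large: "{1 / 2 ^ n<..1} \<in> sets \<nu>" "emeasure \<nu> {1 / 2 ^ n<..1} < \<infinity>" for n :: nat
    using sub01[of n] emeasure_rate_finite[of "1 / 2 ^ n"] by (auto intro!: sets_rateI)
  have shell: "shell k \<in> sets \<nu>" "emeasure \<nu> (shell k) < \<infinity>" for k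
  proof -
    show "shell k \<in> sets \<nu>" using shell_subset[of k] sub01[of "Suc k"] by (intro sets_rateI) (auto simp: shell_def)
    have "emeasure \<nu> (shell k) \<le> emeasure \<nu> {1 / 2 ^ Suc k<..1}" by (rule emeasure_mono[OF shell_subset large(1)])
    then show "emeasure \<nu> (shell k) < \<infinity>" using large(2)[of "Suc k"] by (rule le_less_trans)
  qed
  have rate: "\<forall>\<^sub>F k in sequentially. c/2 * block_size k \<le> measure \<nu> (shell k) \<and> measure \<nu> (shell k) \<le> 4 * c * block_size k \<and> block_size k > 0"
    using rates eventually_onset_le
  proof eventually_elim
    case (elim k)
    have pos: "block_size k > 0" by (rule block_size_pos[OF elim(2)])
    have "emeasure \<nu> (shell k) = ennreal (measure \<nu> (shell k))"
      using shell(2)[of k] by (intro emeasure_eq_ennreal_measure) (auto simp: less_top)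
    then show ?case using elim(1) pos c by (auto simp: ennreal_le_iff)
  qed
  have "AE \<omega> in M. \<forall>\<^sub>F k in sequentially. ennreal (measure \<nu> (shell k) / 2) \<le> num_points w (shell k) \<omega> \<and>
      num_points w (shell k) \<omega> \<le> ennreal (3/2 * measure \<nu> (shell k))"
  proof (rule AE_num_points_concentrated[OF shell])
    show "\<forall>\<^sub>F k in sequentially. 0 < measure \<nu> (shell k)"
      using rate
    proof eventually_elim
      case (elim k)
      have "0 < c/2 * block_size k" using elim c by simp
      then show ?case using elim by linarith
    qed
    show "summable (\<lambda>k. 1 / measure \<nu> (shell k))"
    proof (rule summable_comparison_test_ev)
      show "summable (\<lambda>k. 2 / c * (1 / block_size k))" by (intro summable_mult summable_inverse_block_size)
      show "\<forall>\<^sub>F k in sequentially. norm (1 / measure \<nu> (shell k)) \<le> 2 / c * (1 / block_size k)"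
        using rate
      proof eventually_elim
        case (elim k)
        have "0 < c/2 * block_size k" using elim c by simp
        moreover from this have "0 < measure \<nu> (shell k)" using elim by linarith
        ultimately have "1 / measure \<nu> (shell k) \<le> 1 / (c/2 * block_size k)"
          using elim c by (intro divide_left_mono mult_pos_pos) auto
        then show ?case by simp
      qed
    qed
  qed
  moreover have "AE \<omega> in M. \<forall>n. num_points w {1 / 2 ^ n<..1} \<omega> < \<infinity>"
    using AE_num_points_finite[OF large] by (subst AE_all_countable) blast
  ultimately show ?thesis using AE_space
  proof eventually_elim
    case (elim \<omega>)
    have w01: "0 \<le> w i \<omega>" "w i \<omega> \<le> 1" for i
      using measurable_space[OF weight_measurable elim(3), of i] by (auto simp: space_rate)
    have upper: "\<forall>\<^sub>F k in sequentially. num_points w (shell k) \<omega> \<le> ennreal (6 * c * block_size k)"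
      using elim(1) rate
    proof eventually_elim
      case (elim k)
      have "ennreal (3/2 * measure \<nu> (shell k)) \<le> ennreal (6 * c * block_size k)" using elim by (intro ennreal_leI) simp
      from conjunct2[OF elim(1)] this show ?case by (rule order_trans)
    qed
    have lower: "\<forall>\<^sub>F k in sequentially. ennreal (c/4 * block_size k) \<le> num_points w (shell k) \<omega>"
      using elim(1) rate
    proof eventually_elim
      case (elim k)
      have "ennreal (c/4 * block_size k) \<le> ennreal (measure \<nu> (shell k) / 2)" using elim by (intro ennreal_leI) simp
      from this conjunct1[OF elim(1)] show ?case by (rule order_trans)
    qed
    have fin: "num_points w {1 / 2 ^ n<..1} \<omega> < \<infinity>" for n :: nat using elim(2) by simp
    have "\<exists>c>0. \<forall>\<^sub>F n in sequentially. ennreal (c * tail_integral L (2 ^ n)) \<le> small_mass w n \<omega>"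
      using small_mass_ge[OF w01(1) _ lower] c by (intro exI[of _ "c/4/2"]) auto
    moreover have "\<exists>C>0. \<forall>\<^sub>F n in sequentially. small_mass w n \<omega> \<le> ennreal (C * tail_integral L (2 ^ n))"
      using small_mass_le[OF w01(1) _ upper] c by (intro exI[of _ "6*c"]) auto
    moreover have "\<exists>C>0. \<forall>\<^sub>F n in sequentially. num_points w {1 / 2 ^ n<..1} \<omega> \<le> ennreal (C * (2 ^ n * tail_integral L (2 ^ n)))"
      using num_large_le[OF _ upper fin] c unfolding growth_def by auto
    ultimately show ?case unfolding typical_weights_def using w01 by blast
  qed
qed

section \<open>Edges and neighbours as conditionally independent events\<close>

lemma nn_integral_count_space_restrict:
  "(\<integral>\<^sup>+x. f x \<partial>count_space A) = (\<integral>\<^sup>+x. f x * indicator A x \<partial>count_space UNIV)"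
  by (subst nn_integral_count_space_indicator) (auto simp: NO_MATCH_def)

lemma infsum_eq_nn_integral:
  fixes f :: "'i \<Rightarrow> ennreal"
  assumes I: "countable I"
  shows "infsum f I = (\<integral>\<^sup>+i. f i \<partial>count_space I)"
proof (cases "finite I")
  case True
  then show ?thesis by (simp add: nn_integral_count_space_finite)
next
  case False
  have bij: "bij_betw (from_nat_into I) UNIV I" by (rule bij_betw_from_nat_into[OF I False])
  have "infsum f I = infsum (\<lambda>n. f (from_nat_into I n)) UNIV"
    by (rule infsum_reindex_bij_betw[OF bij, symmetric])
  also have "\<dots> = (\<Sum>n. f (from_nat_into I n))"
    by (rule sums_unique[OF has_sum_imp_sums[OF has_sum_infsum]]) (rule nonneg_summable_on_complete, simp)
  also have "\<dots> = (\<integral>\<^sup>+n. f (from_nat_into I n) \<partial>count_space UNIV)" by (rule nn_integral_count_space_nat[symmetric])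
  also have "\<dots> = (\<integral>\<^sup>+i. f i \<partial>count_space I)" by (rule nn_integral_bij_count_space[OF bij])
  finally show ?thesis .
qed

lemma countable_vertex_pairs: "countable vertex_pairs"
proof (rule countable_subset)
  show "vertex_pairs \<subseteq> {e. finite e}" unfolding vertex_pairs_def by (auto intro: card_ge_0_finite)
  show "countable {e::nat set. finite e}" using countable_Collect_finite_subset[of "UNIV :: nat set"] by simp
qed

lemma bij_betw_vertex_pairs: "bij_betw (\<lambda>(i, j). {i, j}) {(i, j). i < j} vertex_pairs"
  unfolding bij_betw_def
proof
  show "inj_on (\<lambda>(i, j). {i, j}) {(i::nat, j). i < j}"
    by (auto simp: inj_on_def doubleton_eq_iff)
  show "(\<lambda>(i, j). {i, j}) ` {(i, j). i < j} = vertex_pairs"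
  proof (intro equalityI subsetI)
    fix e assume "e \<in> vertex_pairs"
    then obtain i j where e: "e = {i, j}" "i \<noteq> j" by (auto simp: vertex_pairs_def card_2_iff)
    then consider "i < j" | "j < i" by linarith
    then show "e \<in> (\<lambda>(i, j). {i, j}) ` {(i, j). i < j}"
    proof cases
      case 1 then show ?thesis using e by (intro image_eqI[of _ _ "(i, j)"]) auto
    next
      case 2 then show ?thesis using e by (intro image_eqI[of _ _ "(j, i)"]) auto
    qed
  qed (auto simp: vertex_pairs_def card_2_iff)
qed

lemma nn_integral_vertex_pairs:
  "(\<integral>\<^sup>+(i, j). g {i, j} \<partial>count_space {(i, j). i < j}) = (\<integral>\<^sup>+e. g e \<partial>count_space vertex_pairs)"
  using nn_integral_bij_count_space[OF bij_betw_vertex_pairs, of g] by (simp add: case_prod_unfold)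

text \<open>Each edge is seen from both of its ends.\<close>
lemma infsum_ordered_pairs:
  fixes g :: "nat set \<Rightarrow> ennreal"
  shows "(\<Sum>\<^sub>\<infinity>(i, j)\<in>{(i, j). i \<noteq> j}. g {i, j}) = 2 * (\<integral>\<^sup>+e. g e \<partial>count_space vertex_pairs)"
proof -
  have swap: "bij_betw prod.swap {(i::nat, j). j < i} {(i, j). i < j}"
    by (rule bij_betw_byWitness[where f' = prod.swap]) auto
  have "(\<Sum>\<^sub>\<infinity>(i, j)\<in>{(i, j). i \<noteq> j}. g {i, j}) = (\<integral>\<^sup>+(i, j). g {i, j} \<partial>count_space {(i, j). i \<noteq> j})"
    by (rule infsum_eq_nn_integral) simp
  also have "\<dots> = (\<integral>\<^sup>+x. (case x of (i, j) \<Rightarrow> g {i, j}) * indicator {(i, j). i < j} x + (case x of (i, j) \<Rightarrow> g {i, j}) * indicator {(i, j). j < i} x \<partial>count_space UNIV)"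
    by (subst nn_integral_count_space_restrict, intro nn_integral_cong) (auto simp: indicator_def split: prod.split)
  also have "\<dots> = (\<integral>\<^sup>+(i, j). g {i, j} \<partial>count_space {(i, j). i < j}) + (\<integral>\<^sup>+(i, j). g {i, j} \<partial>count_space {(i, j). j < i})"
    unfolding nn_integral_count_space_restrict[where A = "{(i, j). i < j}"] nn_integral_count_space_restrict[where A = "{(i, j). j < i}"]
    by (rule nn_integral_add) auto
  also have "(\<integral>\<^sup>+(i, j). g {i, j} \<partial>count_space {(i, j). j < i}) = (\<integral>\<^sup>+(i, j). g {i, j} \<partial>count_space {(i, j). i < j})"
    using nn_integral_bij_count_space[OF swap, of "\<lambda>(i, j). g {i, j}"] by (simp add: case_prod_unfold insert_commute)
  finally show ?thesis unfolding nn_integral_vertex_pairs by (simp add: mult_2)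
qed

lemma nn_integral_finite_times_count_space:
  fixes h :: "'i \<Rightarrow> 'j \<Rightarrow> ennreal"
  assumes A: "finite A" and J: "countable J"
  shows "(\<integral>\<^sup>+(p, e). h p e \<partial>count_space (A \<times> J)) = (\<Sum>p\<in>A. \<integral>\<^sup>+e. h p e \<partial>count_space J)"
proof -
  interpret sigma_finite_measure "count_space J"
    by (rule sigma_finite_measure_count_space_countable[OF J])
  have P: "count_space A \<Otimes>\<^sub>M count_space J = count_space (A \<times> J)"
    by (rule pair_measure_countable) (use A J in \<open>auto intro: countable_finite\<close>)
  have "(\<integral>\<^sup>+(p, e). h p e \<partial>(count_space A \<Otimes>\<^sub>M count_space J)) = (\<integral>\<^sup>+p. \<integral>\<^sup>+e. h p e \<partial>count_space J \<partial>count_space A)"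
    by (subst nn_integral_fst[symmetric]) (auto simp: P)
  then show ?thesis unfolding P by (simp add: nn_integral_count_space_finite A)
qed

text \<open>Copies of an edge are told apart by the step at which they are added.\<close>
definition edge_occurrences :: "(nat \<Rightarrow> nat set \<Rightarrow> 'a \<Rightarrow> bool) \<Rightarrow> nat \<Rightarrow> 'a \<Rightarrow> (nat \<times> nat set) set" where
  "edge_occurrences m t \<omega> = {(p, e). p \<in> {1..t} \<and> e \<in> vertex_pairs \<and> m p e \<omega>}"

definition active_vertices :: "(nat \<Rightarrow> nat set \<Rightarrow> 'a \<Rightarrow> bool) \<Rightarrow> nat \<Rightarrow> 'a \<Rightarrow> nat set" where
  "active_vertices m t \<omega> = {i. \<exists>j p. j \<noteq> i \<and> p \<in> {1..t} \<and> m p {i, j} \<omega>}"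

lemma num_edges_eq: "num_edges m t \<omega> = emeasure (count_space UNIV) (edge_occurrences m t \<omega>)"
proof -
  have mult: "(of_nat (multiplicity_at m t e \<omega>) :: ennreal) = (\<Sum>p = 1..t. of_bool (m p e \<omega>))" for e
    unfolding multiplicity_at_def by (simp add: of_nat_sum)
  have "num_edges m t \<omega> = (2 * (\<integral>\<^sup>+e. of_nat (multiplicity_at m t e \<omega>) \<partial>count_space vertex_pairs)) / 2"
    unfolding num_edges_def infsum_ordered_pairs[of "\<lambda>e. of_nat (multiplicity_at m t e \<omega>)"] ..
  also have "\<dots> = (\<integral>\<^sup>+e. of_nat (multiplicity_at m t e \<omega>) \<partial>count_space vertex_pairs)"
    by (subst mult.commute, rule mult_divide_eq_ennreal) auto
  also have "\<dots> = (\<Sum>p = 1..t. \<integral>\<^sup>+e. of_bool (m p e \<omega>) \<partial>count_space vertex_pairs)"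
    unfolding mult by (rule nn_integral_sum) simp
  also have "\<dots> = (\<integral>\<^sup>+(p, e). of_bool (m p e \<omega>) \<partial>count_space ({1..t} \<times> vertex_pairs))"
    by (rule nn_integral_finite_times_count_space[symmetric]) (simp_all add: countable_vertex_pairs)
  also have "\<dots> = (\<integral>\<^sup>+x. indicator (edge_occurrences m t \<omega>) x \<partial>count_space UNIV)"
    by (subst nn_integral_count_space_restrict, intro nn_integral_cong) (auto simp: indicator_def edge_occurrences_def)
  finally show ?thesis by simp
qed

lemma num_vertices_eq: "num_vertices m t \<omega> = emeasure (count_space UNIV) (active_vertices m t \<omega>)"
proof -
  have "((\<Sum>\<^sub>\<infinity>j\<in>UNIV - {i}. (of_nat (multiplicity_at m t {i, j} \<omega>) :: ennreal)) > 0) \<longleftrightarrow> i \<in> active_vertices m t \<omega>" for i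
  proof -
    have "(\<Sum>\<^sub>\<infinity>j\<in>UNIV - {i}. (of_nat (multiplicity_at m t {i, j} \<omega>) :: ennreal)) = 0 \<longleftrightarrow> (\<forall>j\<in>UNIV - {i}. multiplicity_at m t {i, j} \<omega> = 0)"
      by (subst infsum_eq_nn_integral) (auto simp: nn_integral_0_iff_AE AE_count_space)
    also have "\<dots> \<longleftrightarrow> (\<forall>j\<in>UNIV - {i}. \<forall>p\<in>{1..t}. \<not> m p {i, j} \<omega>)"
      unfolding multiplicity_at_def by (subst sum_eq_0_iff) auto
    also have "\<dots> \<longleftrightarrow> i \<notin> active_vertices m t \<omega>"
      unfolding active_vertices_def by auto
    finally show ?thesis by (simp add: zero_less_iff_neq_zero)
  qed
  then have "num_vertices m t \<omega> = (\<Sum>\<^sub>\<infinity>i. of_bool (i \<in> active_vertices m t \<omega>))"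
    unfolding num_vertices_def by simp
  also have "\<dots> = (\<integral>\<^sup>+i. indicator (active_vertices m t \<omega>) i \<partial>count_space UNIV)"
  proof -
    have eq: "of_bool (i \<in> A) = (indicator A i :: ennreal)" for i and A :: "nat set" by (simp add: indicator_def)
    show ?thesis unfolding eq by (rule infsum_eq_nn_integral) simp
  qed
  finally show ?thesis by simp
qed

lemma occurrences_eq: "occurrences I E \<omega> = emeasure (count_space UNIV) {i \<in> I. \<omega> \<in> E i}"
proof -
  have "occurrences I E \<omega> = (\<integral>\<^sup>+i. indicator {i \<in> I. \<omega> \<in> E i} i \<partial>count_space UNIV)"
    unfolding occurrences_def
    by (subst nn_integral_count_space_restrict, intro nn_integral_cong) (auto simp: indicator_def)
  then show ?thesis by simp
qed

lemma (in finite_measure_subalgebra) cond_pairwise_indep_Int: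
  assumes cp: "cond_pairwise_indep M F I E q" and B: "\<And>i. i \<in> I \<Longrightarrow> B i \<in> sets F"
  shows "cond_pairwise_indep M F I (\<lambda>i. E i \<inter> B i) (\<lambda>i \<omega>. q i \<omega> * indicator (B i) \<omega>)"
  unfolding cond_pairwise_indep_def
proof (intro conjI ballI impI)
  fix i assume "i \<in> I"
  then show "has_cond_prob M F (E i \<inter> B i) (\<lambda>\<omega>. q i \<omega> * indicator (B i) \<omega>)"
    using cp B unfolding cond_pairwise_indep_def by (intro cond_prob_Int) auto
next
  fix i j assume ij: "i \<in> I" "j \<in> I" "i \<noteq> j"
  then have "has_cond_prob M F (E i \<inter> E j \<inter> (B i \<inter> B j)) (\<lambda>\<omega>. (q i \<omega> * q j \<omega>) * indicator (B i \<inter> B j) \<omega>)"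
    using cp B unfolding cond_pairwise_indep_def by (intro cond_prob_Int) auto
  moreover have "E i \<inter> E j \<inter> (B i \<inter> B j) = (E i \<inter> B i) \<inter> (E j \<inter> B j)" by auto
  moreover have "(\<lambda>\<omega>. (q i \<omega> * q j \<omega>) * indicator (B i \<inter> B j) \<omega>) = (\<lambda>\<omega>. (q i \<omega> * indicator (B i) \<omega>) * (q j \<omega> * indicator (B j) \<omega>))"
    by (auto simp: indicator_def fun_eq_iff)
  ultimately show "has_cond_prob M F ((E i \<inter> B i) \<inter> (E j \<inter> B j)) (\<lambda>\<omega>. (q i \<omega> * indicator (B i) \<omega>) * (q j \<omega> * indicator (B j) \<omega>))"
    by simp
qed

definition edge_prob :: "(nat \<Rightarrow> 'a \<Rightarrow> real) \<Rightarrow> nat set \<Rightarrow> 'a \<Rightarrow> real" where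
  "edge_prob w e \<omega> = (\<Prod>i\<in>e. w i \<omega>)"

context poisson_process
begin

abbreviation "W \<equiv> weight_algebra M \<nu> w"

lemma weight_01: "\<omega> \<in> space M \<Longrightarrow> 0 \<le> w i \<omega> \<and> w i \<omega> \<le> 1"
  using measurable_space[OF weight_measurable, of \<omega> i] by (auto simp: space_rate)

lemma weights_in_space: "(\<lambda>\<omega> i. w i \<omega>) \<in> space M \<rightarrow> space (Pi\<^sub>M UNIV (\<lambda>_. \<nu>))"
  using weight_01 by (auto simp: space_PiM space_rate)

lemma subalgebra_weights: "subalgebra M W"
proof -
  have "(\<lambda>\<omega> i. w i \<omega>) \<in> measurable M (Pi\<^sub>M UNIV (\<lambda>_. \<nu>))"
    by (rule measurable_PiM_single') (use weight_measurable weights_in_space in \<open>auto simp: space_PiM\<close>)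
  then have "sets W \<subseteq> sets M"
    unfolding weight_algebra_def sets_vimage_algebra2[OF weights_in_space] by (auto dest: measurable_sets)
  then show ?thesis unfolding subalgebra_def weight_algebra_def by simp
qed

sublocale weights: finite_measure_subalgebra M W
  by unfold_locales (rule subalgebra_weights)

lemma weight_measurable_algebra: "w i \<in> borel_measurable W"
proof -
  have "(\<lambda>\<omega> i. w i \<omega>) \<in> measurable W (Pi\<^sub>M UNIV (\<lambda>_. \<nu>))"
    unfolding weight_algebra_def by (rule measurable_vimage_algebra1[OF weights_in_space])
  from measurable_compose[OF this measurable_component_singleton[of i UNIV]]
  have "w i \<in> measurable W \<nu>" by simp
  then have "w i \<in> measurable W (restrict_space borel {0..1})"
    by (simp add: measurable_cong_sets[OF refl sets_rate])
  then show ?thesis by (rule measurable_restrict_space2_iff[THEN iffD1, THEN conjunct1])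
qed

lemma space_W: "space W = space M" unfolding weight_algebra_def by simp

lemma edge_prob_01: "\<omega> \<in> space M \<Longrightarrow> 0 \<le> edge_prob w e \<omega> \<and> edge_prob w e \<omega> \<le> 1"
  unfolding edge_prob_def using weight_01 by (auto intro!: prod_nonneg prod_le_1)

lemma measurable_edge_prob: "edge_prob w e \<in> borel_measurable W"
  unfolding edge_prob_def[abs_def] using weight_measurable_algebra by (rule borel_measurable_prod)

end

context poisson_multigraph
begin

lemma cond_prob_pattern:
  assumes I: "finite I" "I \<subseteq> {1..} \<times> vertex_pairs"
  shows "has_cond_prob M W {\<omega> \<in> space M. \<forall>(p, e)\<in>I. m p e \<omega> = b p e}
     (\<lambda>\<omega>. \<Prod>(p, e)\<in>I. if b p e then edge_prob w e \<omega> else 1 - edge_prob w e \<omega>)"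
proof (rule weights.cond_probI_real_cond_exp)
  have [measurable]: "Measurable.pred M (m p e)" if "(p, e) \<in> I" for p e
    using that I(2) edge_measurable[of p e] by auto
  show "{\<omega> \<in> space M. \<forall>(p, e)\<in>I. m p e \<omega> = b p e} \<in> sets M"
  proof -
    have "{\<omega> \<in> space M. \<forall>x\<in>I. m (fst x) (snd x) \<omega> = b (fst x) (snd x)} \<in> sets M"
      using I(1) by measurable
    then show ?thesis by (simp add: case_prod_beta)
  qed
  note [measurable] = measurable_edge_prob
  show "(\<lambda>\<omega>. \<Prod>(p, e)\<in>I. if b p e then edge_prob w e \<omega> else 1 - edge_prob w e \<omega>) \<in> borel_measurable W"
    unfolding case_prod_beta by (intro borel_measurable_prod) auto
  fix \<omega> assume \<omega>: "\<omega> \<in> space M"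
  show "0 \<le> (\<Prod>(p, e)\<in>I. if b p e then edge_prob w e \<omega> else 1 - edge_prob w e \<omega>)"
    using edge_prob_01[OF \<omega>] by (auto intro!: prod_nonneg)
  show "(\<Prod>(p, e)\<in>I. if b p e then edge_prob w e \<omega> else 1 - edge_prob w e \<omega>) \<le> 1"
    using edge_prob_01[OF \<omega>] by (auto intro!: prod_le_1)
next
  show "AE \<omega> in M. real_cond_exp M W (indicat_real {\<omega> \<in> space M. \<forall>(p, e)\<in>I. m p e \<omega> = b p e}) \<omega> =
     (\<Prod>(p, e)\<in>I. if b p e then edge_prob w e \<omega> else 1 - edge_prob w e \<omega>)"
    using conditional_bernoulli[OF I, of b] AE_space
  proof eventually_elim
    case (elim \<omega>)
    have "pmf (bernoulli_pmf (\<Prod>i\<in>e. w i \<omega>)) (b p e) = (if b p e then edge_prob w e \<omega> else 1 - edge_prob w e \<omega>)" for p e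
      using edge_prob_01[OF elim(2), of e] unfolding edge_prob_def by (cases "b p e") auto
    then show ?case using elim(1) by simp
  qed
qed

definition edge_event :: "nat \<times> nat set \<Rightarrow> 'a set" where
  "edge_event = (\<lambda>(p, e). {\<omega> \<in> space M. m p e \<omega>})"

definition slots :: "nat \<Rightarrow> (nat \<times> nat set) set" where
  "slots t = {1..t} \<times> vertex_pairs"

lemma edge_events_indep: "cond_pairwise_indep M W (slots t) edge_event (\<lambda>x. edge_prob w (snd x))"
  unfolding cond_pairwise_indep_def
proof (intro conjI ballI impI)
  fix x assume "x \<in> slots t"
  then show "has_cond_prob M W (edge_event x) (edge_prob w (snd x))"
    using cond_prob_pattern[of "{x}" "\<lambda>_ _. True"] by (auto simp: slots_def edge_event_def case_prod_beta)
next
  fix x y assume xy: "x \<in> slots t" "y \<in> slots t" "x \<noteq> y"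
  have "has_cond_prob M W {\<omega> \<in> space M. \<forall>(p, e)\<in>{x, y}. m p e \<omega> = True}
      (\<lambda>\<omega>. \<Prod>(p, e)\<in>{x, y}. if True then edge_prob w e \<omega> else 1 - edge_prob w e \<omega>)"
    by (rule cond_prob_pattern) (use xy in \<open>auto simp: slots_def\<close>)
  moreover have "{\<omega> \<in> space M. \<forall>(p, e)\<in>{x, y}. m p e \<omega> = True} = edge_event x \<inter> edge_event y"
    by (auto simp: edge_event_def)
  ultimately show "has_cond_prob M W (edge_event x \<inter> edge_event y) (\<lambda>\<omega>. edge_prob w (snd x) \<omega> * edge_prob w (snd y) \<omega>)"
    using xy(3) by (simp add: case_prod_beta)
qed

text \<open>Not being a neighbour of $j$ by time $t$ is a pattern of absent edges, and different vertices
  involve different edges. Being a neighbour is the complementary event.\<close>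
lemma neighbours_cond_pairwise_indep:
  "cond_pairwise_indep M W (UNIV - {j}) (\<lambda>i. {\<omega> \<in> space M. \<exists>p\<in>{1..t}. m p {i, j} \<omega>})
     (\<lambda>i \<omega>. 1 - (1 - w i \<omega> * w j \<omega>) ^ t)"
proof -
  define C where "C i = {\<omega> \<in> space M. \<forall>(p, e)\<in>{1..t} \<times> {{i, j}}. m p e \<omega> = False}" for i
  have pair: "{i, j} \<in> vertex_pairs" if "i \<noteq> j" for i using that by (auto simp: vertex_pairs_def card_2_iff)
  have E: "{\<omega> \<in> space M. \<exists>p\<in>{1..t}. m p {i, j} \<omega>} = space M - C i" for i unfolding C_def by auto
  have ep: "edge_prob w {i, j} \<omega> = w i \<omega> * w j \<omega>" if "i \<noteq> j" for i \<omega> using that by (simp add: edge_prob_def)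
  have C1: "has_cond_prob M W (C i) (\<lambda>\<omega>. (1 - w i \<omega> * w j \<omega>) ^ t)" if i: "i \<noteq> j" for i
  proof -
    have "has_cond_prob M W (C i) (\<lambda>\<omega>. \<Prod>(p, e)\<in>{1..t} \<times> {{i, j}}. if False then edge_prob w e \<omega> else 1 - edge_prob w e \<omega>)"
      unfolding C_def by (rule cond_prob_pattern) (use pair[OF i] in auto)
    then show ?thesis by (simp add: prod.cartesian_product[symmetric] ep[OF i])
  qed
  have C2: "has_cond_prob M W (C i \<inter> C k) (\<lambda>\<omega>. (1 - w i \<omega> * w j \<omega>) ^ t * (1 - w k \<omega> * w j \<omega>) ^ t)" if i: "i \<noteq> j" "k \<noteq> j" "i \<noteq> k" for i k
  proof -
    have "has_cond_prob M W {\<omega> \<in> space M. \<forall>(p, e)\<in>{1..t} \<times> {{i, j}, {k, j}}. m p e \<omega> = False}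
        (\<lambda>\<omega>. \<Prod>(p, e)\<in>{1..t} \<times> {{i, j}, {k, j}}. if False then edge_prob w e \<omega> else 1 - edge_prob w e \<omega>)"
      by (rule cond_prob_pattern) (use pair i in auto)
    moreover have "{\<omega> \<in> space M. \<forall>(p, e)\<in>{1..t} \<times> {{i, j}, {k, j}}. m p e \<omega> = False} = C i \<inter> C k"
      unfolding C_def by auto
    moreover have "{i, j} \<noteq> {k, j}" using i by (auto simp: doubleton_eq_iff)
    ultimately show ?thesis
      by (simp add: prod.cartesian_product[symmetric] ep i power_mult_distrib)
  qed
  show ?thesis
    unfolding cond_pairwise_indep_def E
    using weights.cond_prob_compl[OF C1] weights.cond_prob_compl_Int_compl[OF C1 C1 C2] by auto
qed

end

section \<open>Conditional means under typical weights\<close>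

definition total_mass :: "(nat \<Rightarrow> 'a \<Rightarrow> real) \<Rightarrow> 'a \<Rightarrow> ennreal" where
  "total_mass w \<omega> = (\<integral>\<^sup>+i. ennreal (w i \<omega>) \<partial>count_space UNIV)"

definition mean_edges :: "(nat \<Rightarrow> 'a \<Rightarrow> real) \<Rightarrow> 'a \<Rightarrow> ennreal" where
  "mean_edges w \<omega> = (\<integral>\<^sup>+e. ennreal (edge_prob w e \<omega>) \<partial>count_space vertex_pairs)"

definition touches :: "(nat \<Rightarrow> 'a \<Rightarrow> real) \<Rightarrow> nat \<Rightarrow> nat set \<Rightarrow> 'a \<Rightarrow> bool" where
  "touches w n e \<omega> \<longleftrightarrow> (\<exists>i\<in>e. w i \<omega> \<le> 1 / 2 ^ n)"

definition touching_mass :: "(nat \<Rightarrow> 'a \<Rightarrow> real) \<Rightarrow> nat \<Rightarrow> 'a \<Rightarrow> ennreal" where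
  "touching_mass w n \<omega> =
    (\<integral>\<^sup>+e. ennreal (edge_prob w e \<omega> * of_bool (touches w n e \<omega>)) \<partial>count_space vertex_pairs)"

lemma total_mass_le:
  assumes "\<And>i. 0 \<le> w i \<omega> \<and> w i \<omega> \<le> 1"
  shows "total_mass w \<omega> \<le> num_points w {1 / 2 ^ n<..1} \<omega> + small_mass w n \<omega>"
proof -
  have "total_mass w \<omega> \<le> (\<integral>\<^sup>+i. indicator {1 / 2 ^ n<..1} (w i \<omega>) + ennreal (w i \<omega>) * indicator {..1 / 2 ^ n} (w i \<omega>) \<partial>count_space UNIV)"
    unfolding total_mass_def
  proof (rule nn_integral_mono)
    fix i
    show "ennreal (w i \<omega>) \<le> indicator {1 / 2 ^ n<..1} (w i \<omega>) + ennreal (w i \<omega>) * indicator {..1 / 2 ^ n} (w i \<omega>)"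
      using assms[of i] by (cases "w i \<omega> \<le> 1 / 2 ^ n") (auto simp: indicator_def ennreal_le_1)
  qed
  also have "\<dots> = num_points w {1 / 2 ^ n<..1} \<omega> + small_mass w n \<omega>"
    unfolding num_points_eq_nn_integral small_mass_def by (rule nn_integral_add) auto
  finally show ?thesis .
qed

text \<open>Passing to ordered pairs makes the sums factorize. An edge that touches a small weight has a
  small end in the first or in the second place.\<close>
lemma edge_mass_le:
  assumes nn: "\<And>i. 0 \<le> w i \<omega>"
  shows "mean_edges w \<omega> \<le> total_mass w \<omega> * total_mass w \<omega>" (is ?A)
    and "touching_mass w n \<omega> \<le> 2 * (small_mass w n \<omega> * total_mass w \<omega>)" (is ?B)
proof -
  have prob: "edge_prob w {i, j} \<omega> = w i \<omega> * w j \<omega>" if "i < j" for i j using that by (simp add: edge_prob_def)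
  have prod: "(\<integral>\<^sup>+(i, j). a i * b j \<partial>count_space UNIV) = (\<integral>\<^sup>+i. a i \<partial>count_space UNIV) * (\<integral>\<^sup>+j. b j \<partial>count_space UNIV)"
    for a b :: "nat \<Rightarrow> ennreal"
    by (subst nn_integral_fst_count_space[symmetric]) (simp add: nn_integral_cmult nn_integral_multc)
  have "mean_edges w \<omega> = (\<integral>\<^sup>+(i, j). ennreal (edge_prob w {i, j} \<omega>) \<partial>count_space {(i, j). i < j})"
    unfolding mean_edges_def by (rule nn_integral_vertex_pairs[symmetric])
  also have "\<dots> \<le> (\<integral>\<^sup>+(i, j). ennreal (w i \<omega>) * ennreal (w j \<omega>) \<partial>count_space UNIV)"
    by (subst nn_integral_count_space_restrict, rule nn_integral_mono) (auto simp: indicator_def prob ennreal_mult nn)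
  finally show ?A unfolding prod total_mass_def .
  have "touching_mass w n \<omega>
      = (\<integral>\<^sup>+(i, j). ennreal (edge_prob w {i, j} \<omega> * of_bool (touches w n {i, j} \<omega>)) \<partial>count_space {(i, j). i < j})"
    unfolding touching_mass_def by (rule nn_integral_vertex_pairs[symmetric])
  also have "\<dots> \<le> (\<integral>\<^sup>+x. (case x of (i, j) \<Rightarrow> (ennreal (w i \<omega>) * indicator {..1 / 2 ^ n} (w i \<omega>)) * ennreal (w j \<omega>))
      + (case x of (i, j) \<Rightarrow> ennreal (w i \<omega>) * (ennreal (w j \<omega>) * indicator {..1 / 2 ^ n} (w j \<omega>))) \<partial>count_space UNIV)"
    by (subst nn_integral_count_space_restrict, rule nn_integral_mono)
      (auto simp: indicator_def prob ennreal_mult nn touches_def)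
  also have "\<dots> = (\<integral>\<^sup>+(i, j). (ennreal (w i \<omega>) * indicator {..1 / 2 ^ n} (w i \<omega>)) * ennreal (w j \<omega>) \<partial>count_space UNIV)
      + (\<integral>\<^sup>+(i, j). ennreal (w i \<omega>) * (ennreal (w j \<omega>) * indicator {..1 / 2 ^ n} (w j \<omega>)) \<partial>count_space UNIV)"
    by (rule nn_integral_add) auto
  also have "\<dots> = 2 * (small_mass w n \<omega> * total_mass w \<omega>)"
    unfolding prod total_mass_def[symmetric] small_mass_def[symmetric] by (simp add: mult_2 mult.commute)
  finally show ?B .
qed

lemma one_minus_power_le: "1 - (1 - y) ^ t \<le> real t * y" if "y \<le> 1" for y :: real
  using Bernoulli_inequality[of "- y" t] that by simp

text \<open>Since $(1-y)(1+y)\le 1$, Bernoulli's inequality for $1+y$ bounds $(1-y)^t$ by $1/(1+ty)$.\<close>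
lemma one_minus_power_ge:
  fixes y :: real
  assumes y: "0 \<le> y" "y \<le> 1" "real t * y \<le> 1"
  shows "real t * y / 2 \<le> 1 - (1 - y) ^ t"
proof -
  define z where "z = real t * y"
  have z: "0 \<le> z" "z \<le> 1" using y unfolding z_def by auto
  have "(1 - y) ^ t * (1 + z) \<le> (1 - y) ^ t * (1 + y) ^ t"
    using Bernoulli_inequality[of y t] y unfolding z_def by (intro mult_left_mono) auto
  also have "\<dots> = ((1 - y) * (1 + y)) ^ t" by (rule power_mult_distrib[symmetric])
  also have "\<dots> = (1 - y * y) ^ t" by (simp add: algebra_simps)
  also have "\<dots> \<le> 1" using y by (intro power_le_one) (auto simp: mult_le_one)
  finally have "(1 - y) ^ t \<le> 1 / (1 + z)" using z by (simp add: field_simps)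
  also have "\<dots> \<le> 1 - z / 2"
  proof -
    have "0 \<le> z * (1 - z)" using z by simp
    then show ?thesis using z by (simp add: field_simps)
  qed
  finally show ?thesis unfolding z_def by simp
qed

context slowly_varying_tail
begin

lemma typical_total_mass_finite:
  assumes "typical_weights L w \<omega>" shows "total_mass w \<omega> < \<infinity>"
proof -
  have w01: "\<And>i. 0 \<le> w i \<omega> \<and> w i \<omega> \<le> 1" using assms unfolding typical_weights_def by auto
  obtain C where "\<forall>\<^sub>F n in sequentially. small_mass w n \<omega> \<le> ennreal (C * tail (2 ^ n))"
    using assms unfolding typical_weights_def by auto
  moreover obtain D where "\<forall>\<^sub>F n in sequentially. num_points w {1 / 2 ^ n<..1} \<omega> \<le> ennreal (D * (2 ^ n * tail (2 ^ n)))"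
    using assms unfolding typical_weights_def by auto
  ultimately obtain n where n: "small_mass w n \<omega> \<le> ennreal (C * tail (2 ^ n))"
    "num_points w {1 / 2 ^ n<..1} \<omega> \<le> ennreal (D * (2 ^ n * tail (2 ^ n)))"
    using eventually_happens[OF eventually_conj] by (metis (no_types, lifting) trivial_limit_sequentially)
  have "total_mass w \<omega> \<le> ennreal (D * (2 ^ n * tail (2 ^ n))) + ennreal (C * tail (2 ^ n))"
    using total_mass_le[of w \<omega> n, OF w01] add_mono[OF n(2,1)] by (rule order_trans)
  also have "\<dots> < \<infinity>" by simp
  finally show ?thesis .
qed

text \<open>Supplies two vertices of different positive weights, so that edges occur at all, and
  the vertex of positive weight whose neighbours will be counted.\<close>
lemma typical_small_weight:
  assumes "typical_weights L w \<omega>" and "\<epsilon> > 0"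
  shows "\<exists>i. 0 < w i \<omega> \<and> w i \<omega> < \<epsilon>"
proof -
  obtain c where c: "c > 0" "\<forall>\<^sub>F n in sequentially. ennreal (c * tail (2 ^ n)) \<le> small_mass w n \<omega>"
    using assms unfolding typical_weights_def by auto
  have "(\<lambda>k. (1/2::real) ^ k) \<longlonglongrightarrow> 0" by (rule LIMSEQ_power_zero) simp
  then have "\<forall>\<^sub>F k in sequentially. (1/2::real) ^ k < \<epsilon>" using assms(2) by (rule order_tendstoD)
  then have "\<forall>\<^sub>F n in sequentially. ennreal (c * tail (2 ^ n)) \<le> small_mass w n \<omega> \<and> (1/2::real) ^ n < \<epsilon> \<and> onset \<le> 2 ^ n"
    using c(2) eventually_onset_le by (auto intro: eventually_conj)
  then obtain n where n: "ennreal (c * tail (2 ^ n)) \<le> small_mass w n \<omega>" "(1/2::real) ^ n < \<epsilon>" "onset \<le> 2 ^ n"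
    using eventually_happens[of _ sequentially] by auto
  have "0 < ennreal (c * tail (2 ^ n))" using c(1) tail_pos[OF n(3)] by simp
  then have "small_mass w n \<omega> \<noteq> 0" using n(1) by auto
  then obtain i where "ennreal (w i \<omega>) * indicator {..1 / 2 ^ n} (w i \<omega>) \<noteq> 0"
    unfolding small_mass_def by (auto simp: nn_integral_0_iff_AE AE_count_space)
  then have "ennreal (w i \<omega>) \<noteq> 0" "w i \<omega> \<le> 1 / 2 ^ n" by (auto simp: indicator_def split: if_splits)
  then have "0 < w i \<omega>" "w i \<omega> < \<epsilon>" using n(2) by (auto simp: power_divide not_le[symmetric] ennreal_neg)
  then show ?thesis by blast
qed

lemma typical_mean_edges_pos:
  assumes "typical_weights L w \<omega>" shows "0 < mean_edges w \<omega>"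
proof -
  obtain i where i: "0 < w i \<omega>" using typical_small_weight[OF assms, of 1] by auto
  obtain j where j: "0 < w j \<omega>" "w j \<omega> < w i \<omega>" using typical_small_weight[OF assms i] by auto
  then have "i \<noteq> j" by auto
  then have "{i, j} \<in> vertex_pairs" "edge_prob w {i, j} \<omega> > 0"
    using i j by (auto simp: vertex_pairs_def card_2_iff edge_prob_def)
  then have "mean_edges w \<omega> \<noteq> 0"
    unfolding mean_edges_def by (force simp: nn_integral_0_iff_AE AE_count_space)
  then show ?thesis by (simp add: zero_less_iff_neq_zero)
qed

lemma typical_mean_edges_finite:
  assumes "typical_weights L w \<omega>" shows "mean_edges w \<omega> < \<infinity>"
proof -
  have "mean_edges w \<omega> \<le> total_mass w \<omega> * total_mass w \<omega>"
    using assms unfolding typical_weights_def by (intro edge_mass_le) auto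
  also have "\<dots> < \<infinity>" using typical_total_mass_finite[OF assms] by (auto simp: ennreal_mult_less_top)
  finally show ?thesis .
qed

lemma typical_touching_mass_le:
  assumes "typical_weights L w \<omega>"
  shows "\<exists>K>0. \<forall>\<^sub>F n in sequentially.
    touching_mass w n \<omega> \<le> ennreal (K * tail (2 ^ n))"
proof -
  obtain C where C: "C > 0" "\<forall>\<^sub>F n in sequentially. small_mass w n \<omega> \<le> ennreal (C * tail (2 ^ n))"
    using assms unfolding typical_weights_def by auto
  obtain S where S: "total_mass w \<omega> = ennreal S" "S \<ge> 0"
    using typical_total_mass_finite[OF assms] by (cases "total_mass w \<omega>") auto
  have "\<forall>\<^sub>F n in sequentially. touching_mass w n \<omega> \<le> ennreal (2 * C * (S + 1) * tail (2 ^ n))"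
    using C(2) eventually_onset_le
  proof eventually_elim
    case (elim n)
    have T: "0 \<le> tail (2 ^ n)" using tail_pos[OF elim(2)] by simp
    have "touching_mass w n \<omega> \<le> 2 * (small_mass w n \<omega> * total_mass w \<omega>)"
      using assms unfolding typical_weights_def by (intro edge_mass_le) auto
    also have "\<dots> \<le> 2 * (ennreal (C * tail (2 ^ n)) * ennreal (S + 1))"
      using elim(1) S by (intro mult_left_mono mult_mono) (auto simp: ennreal_leI)
    also have "\<dots> = ennreal (2 * (C * tail (2 ^ n) * (S + 1)))"
      using T C(1) S(2) by (simp add: ennreal_mult)
    also have "2 * (C * tail (2 ^ n) * (S + 1)) = 2 * C * (S + 1) * tail (2 ^ n)" by simp
    finally show ?case .
  qed
  then show ?thesis using C(1) S(2) by (intro exI[of _ "2 * C * (S + 1)"]) auto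
qed

definition mean_neighbours :: "(nat \<Rightarrow> 'a \<Rightarrow> real) \<Rightarrow> nat \<Rightarrow> nat \<Rightarrow> 'a \<Rightarrow> ennreal" where
  "mean_neighbours w j t \<omega> = (\<integral>\<^sup>+i. ennreal (1 - (1 - w i \<omega> * w j \<omega>) ^ t) \<partial>count_space (UNIV - {j}))"

text \<open>A weight above $2^{-n}$ contributes at most one, a smaller weight at most $2^n$ times itself.\<close>
lemma typical_mean_neighbours_le:
  assumes typical: "typical_weights L w \<omega>"
  shows "\<exists>K>0. \<forall>\<^sub>F n in sequentially. mean_neighbours w j (2 ^ n) \<omega> \<le> ennreal (K * growth n)"
proof -
  have w01: "0 \<le> w i \<omega>" "w i \<omega> \<le> 1" for i using typical unfolding typical_weights_def by auto
  obtain C where C: "C > 0" "\<forall>\<^sub>F n in sequentially. small_mass w n \<omega> \<le> ennreal (C * tail (2 ^ n))"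
    using typical unfolding typical_weights_def by auto
  obtain D where D: "D > 0" "\<forall>\<^sub>F n in sequentially. num_points w {1 / 2 ^ n<..1} \<omega> \<le> ennreal (D * growth n)"
    using typical unfolding typical_weights_def growth_def by auto
  have "\<forall>\<^sub>F n in sequentially. mean_neighbours w j (2 ^ n) \<omega> \<le> ennreal ((C + D) * growth n)"
    using C(2) D(2) eventually_onset_le
  proof eventually_elim
    case (elim n)
    have "mean_neighbours w j (2 ^ n) \<omega> \<le> (\<integral>\<^sup>+i. indicator {1 / 2 ^ n<..1} (w i \<omega>) + ennreal (2 ^ n) * (ennreal (w i \<omega>) * indicator {..1 / 2 ^ n} (w i \<omega>)) \<partial>count_space UNIV)"
      unfolding mean_neighbours_def
    proof (subst nn_integral_count_space_restrict, rule nn_integral_mono)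
      fix i
      have y: "0 \<le> w i \<omega> * w j \<omega>" "w i \<omega> * w j \<omega> \<le> w i \<omega>" "w i \<omega> * w j \<omega> \<le> 1"
        using w01 by (auto intro: mult_right_le_one_le mult_le_one)
      have "ennreal (1 - (1 - w i \<omega> * w j \<omega>) ^ 2 ^ n) \<le> indicator {1 / 2 ^ n<..1} (w i \<omega>) + ennreal (2 ^ n) * (ennreal (w i \<omega>) * indicator {..1 / 2 ^ n} (w i \<omega>))"
      proof (cases "w i \<omega> \<le> 1 / 2 ^ n")
        case True
        have "1 - (1 - w i \<omega> * w j \<omega>) ^ 2 ^ n \<le> 2 ^ n * (w i \<omega> * w j \<omega>)"
          using one_minus_power_le[OF y(3), of "2 ^ n"] by simp
        also have "\<dots> \<le> 2 ^ n * w i \<omega>" using y(2) by (intro mult_left_mono) auto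
        finally show ?thesis using True w01 by (simp add: ennreal_mult[symmetric] ennreal_leI)
      next
        case False
        have "0 \<le> (1 - w i \<omega> * w j \<omega>) ^ 2 ^ n" using y(3) by simp
        then show ?thesis using False w01[of i] by (simp add: ennreal_le_1)
      qed
      then show "ennreal (1 - (1 - w i \<omega> * w j \<omega>) ^ 2 ^ n) * indicator (UNIV - {j}) i \<le> indicator {1 / 2 ^ n<..1} (w i \<omega>) + ennreal (2 ^ n) * (ennreal (w i \<omega>) * indicator {..1 / 2 ^ n} (w i \<omega>))"
        by (auto simp: indicator_def)
    qed
    also have "\<dots> = num_points w {1 / 2 ^ n<..1} \<omega> + ennreal (2 ^ n) * small_mass w n \<omega>"
      unfolding num_points_eq_nn_integral small_mass_def by (subst nn_integral_add) (auto simp: nn_integral_cmult)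
    also have "\<dots> \<le> ennreal (D * growth n) + ennreal (2 ^ n) * ennreal (C * tail (2 ^ n))"
      using elim by (intro add_mono mult_left_mono) auto
    also have "\<dots> = ennreal ((C + D) * growth n)"
      using C D growth_pos[OF elim(3)] tail_pos[OF elim(3)]
      by (simp add: ennreal_mult[symmetric] ennreal_plus[symmetric] growth_def algebra_simps del: ennreal_plus)
    finally show ?case .
  qed
  then show ?thesis using C(1) D(1) by (intro exI[of _ "C + D"]) auto
qed

text \<open>For large $n$ the vertex $j$ itself is not among the weights below $2^{-n}$, so leaving it out
  of the sum does not change their mass.\<close>
lemma typical_mean_neighbours_ge:
  assumes typical: "typical_weights L w \<omega>" and j: "w j \<omega> > 0"
  shows "\<exists>c>0. \<forall>\<^sub>F n in sequentially. ennreal (c * growth n) \<le> mean_neighbours w j (2 ^ n) \<omega>"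
proof -
  have w01: "0 \<le> w i \<omega>" "w i \<omega> \<le> 1" for i using typical unfolding typical_weights_def by auto
  obtain c where c: "c > 0" "\<forall>\<^sub>F n in sequentially. ennreal (c * tail (2 ^ n)) \<le> small_mass w n \<omega>"
    using typical unfolding typical_weights_def by auto
  have "(\<lambda>k. (1/2::real) ^ k) \<longlonglongrightarrow> 0" by (rule LIMSEQ_power_zero) simp
  then have "\<forall>\<^sub>F k in sequentially. (1/2::real) ^ k < w j \<omega>" using j by (rule order_tendstoD)
  then have "\<forall>\<^sub>F n in sequentially. ennreal (w j \<omega> / 2 * c * growth n) \<le> mean_neighbours w j (2 ^ n) \<omega>"
    using c(2) eventually_onset_le
  proof eventually_elim
    case (elim n)
    have nj: "\<not> w j \<omega> \<le> 1 / 2 ^ n" using elim(1) by (simp add: power_divide)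
    have T: "0 < tail (2 ^ n)" by (rule tail_pos[OF elim(3)])
    have "ennreal (w j \<omega> / 2 * c * growth n) = ennreal (2 ^ n * w j \<omega> / 2) * ennreal (c * tail (2 ^ n))"
      using T c(1) j by (simp add: growth_def ennreal_mult[symmetric] mult_ac)
    also have "\<dots> \<le> ennreal (2 ^ n * w j \<omega> / 2) * small_mass w n \<omega>" by (intro mult_left_mono elim(2)) simp
    also have "\<dots> = (\<integral>\<^sup>+i. ennreal (2 ^ n * w j \<omega> / 2) * (ennreal (w i \<omega>) * indicator {..1 / 2 ^ n} (w i \<omega>)) \<partial>count_space UNIV)"
      unfolding small_mass_def by (rule nn_integral_cmult[symmetric]) simp
    also have "\<dots> \<le> mean_neighbours w j (2 ^ n) \<omega>"
      unfolding mean_neighbours_def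
    proof (subst (2) nn_integral_count_space_restrict, rule nn_integral_mono)
      fix i
      show "ennreal (2 ^ n * w j \<omega> / 2) * (ennreal (w i \<omega>) * indicator {..1 / 2 ^ n} (w i \<omega>)) \<le> ennreal (1 - (1 - w i \<omega> * w j \<omega>) ^ 2 ^ n) * indicator (UNIV - {j}) i"
      proof (cases "w i \<omega> \<le> 1 / 2 ^ n")
        case True
        then have ij: "i \<noteq> j" using nj by auto
        have y: "0 \<le> w i \<omega> * w j \<omega>" "w i \<omega> * w j \<omega> \<le> w i \<omega>" "w i \<omega> * w j \<omega> \<le> 1"
          using w01 by (auto intro: mult_right_le_one_le mult_le_one)
        have "2 ^ n * (w i \<omega> * w j \<omega>) \<le> 2 ^ n * (1 / 2 ^ n)" using y(2) True by (intro mult_left_mono) auto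
        then have "2 ^ n * (w i \<omega> * w j \<omega>) / 2 \<le> 1 - (1 - w i \<omega> * w j \<omega>) ^ 2 ^ n"
          using one_minus_power_ge[OF y(1,3), of "2 ^ n"] by simp
        then show ?thesis using True ij w01 by (simp add: ennreal_mult[symmetric] ennreal_leI mult_ac)
      qed simp
    qed
    finally show ?case .
  qed
  then show ?thesis using c(1) j by (intro exI[of _ "w j \<omega> / 2 * c"]) auto
qed

end

section \<open>Growth along the powers of two\<close>

lemma eventually_ratio_close:
  fixes a :: "nat \<Rightarrow> real"
  assumes lim: "(\<lambda>n. (a n - d n) / b n) \<longlonglongrightarrow> 0" and b: "\<forall>\<^sub>F n in sequentially. b n > 0" and \<epsilon>: "\<epsilon> > 0"
  shows "\<forall>\<^sub>F n in sequentially. \<bar>a n - d n\<bar> \<le> \<epsilon> * b n"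
proof -
  have "\<forall>\<^sub>F n in sequentially. dist ((a n - d n) / b n) 0 < \<epsilon>" using lim \<epsilon> by (rule tendstoD)
  then show ?thesis using b
  proof eventually_elim
    case (elim n)
    then show ?case by (simp add: dist_real_def abs_divide field_simps)
  qed
qed

lemma eventually_le_nat_multiple:
  fixes a :: "nat \<Rightarrow> ennreal" and b :: "nat \<Rightarrow> real" and K :: real
  assumes le: "\<forall>\<^sub>F n in sequentially. a n \<le> ennreal (K * b n)" and b: "\<forall>\<^sub>F n in sequentially. b n > 0"
  shows "\<exists>N::nat. \<forall>n\<ge>N. a n \<le> ennreal (N * b n)"
proof -
  obtain N0 where N0: "\<And>n. n \<ge> N0 \<Longrightarrow> a n \<le> ennreal (K * b n) \<and> b n > 0"
    using eventually_conj[OF le b] unfolding eventually_sequentially by blast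
  obtain k :: nat where k: "K \<le> k" using real_arch_simple by blast
  have "a n \<le> ennreal (max N0 k * b n)" if n: "n \<ge> max N0 k" for n
  proof -
    have "a n \<le> ennreal (K * b n)" "b n > 0" using N0[of n] n by auto
    moreover have "K * b n \<le> max N0 k * b n" using k \<open>b n > 0\<close> by (intro mult_right_mono) auto
    ultimately show ?thesis by (meson ennreal_leI order_trans)
  qed
  then show ?thesis by blast
qed

context poisson_multigraph
begin

definition touching_event :: "nat \<Rightarrow> nat \<times> nat set \<Rightarrow> 'a set" where
  "touching_event n = (\<lambda>(p, e). {\<omega> \<in> space M. touches w n e \<omega>})"

lemma countable_slots: "countable (slots t)"
  unfolding slots_def using countable_vertex_pairs by auto

lemma cond_mean_slots: "cond_mean (slots t) (\<lambda>x \<omega>. q (snd x) \<omega>) \<omega> = of_nat t * (\<integral>\<^sup>+e. ennreal (q e \<omega>) \<partial>count_space vertex_pairs)"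
  unfolding cond_mean_def slots_def
  using nn_integral_finite_times_count_space[of "{1..t}" vertex_pairs "\<lambda>p e. ennreal (q e \<omega>)"]
  by (simp add: countable_vertex_pairs case_prod_unfold)

lemma touching_event_sets: assumes "x \<in> slots t" shows "touching_event n x \<in> sets W"
proof -
  obtain p e where x: "x = (p, e)" by (cases x)
  have "card e = 2" using assms by (auto simp: x slots_def vertex_pairs_def)
  then have fin: "finite e" by (intro card_ge_0_finite) simp
  note [measurable] = weight_measurable_algebra
  have "{\<omega> \<in> space W. \<exists>i\<in>e. w i \<omega> \<le> 1 / 2 ^ n} \<in> sets W" using fin by measurable
  then show ?thesis unfolding touching_event_def touches_def by (simp add: x space_W)
qed

lemma num_edges_occurrences:
  "\<omega> \<in> space M \<Longrightarrow> num_edges m t \<omega> = occurrences (slots t) edge_event \<omega>"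
  unfolding num_edges_eq occurrences_eq edge_occurrences_def
  by (rule arg_cong[where f = "emeasure (count_space UNIV)"]) (auto simp: slots_def edge_event_def)

text \<open>Given the weights, the mean number of edges at time $t$ is exactly $t$ times that of a single
  step, and the fluctuations are negligible by the law of large numbers.\<close>
lemma AE_num_edges_growth:
  assumes L: "slowly_varying_tail L" and typical: "AE \<omega> in M. typical_weights L w \<omega>"
  shows "AE \<omega> in M. \<exists>c>0. \<exists>C>0. \<forall>\<^sub>F n in sequentially. ennreal (c * 2 ^ n) \<le> num_edges m (2 ^ n) \<omega> \<and>
     num_edges m (2 ^ n) \<omega> \<le> ennreal (C * 2 ^ n)"
proof -
  interpret slowly_varying_tail L by fact
  have "AE \<omega> in M. (\<exists>K::nat. \<forall>n\<ge>K. cond_mean (slots (2 ^ n)) (\<lambda>x. edge_prob w (snd x)) \<omega> \<le> ennreal (real K * 2 ^ n)) \<longrightarrow>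
    (\<lambda>n. (enn2real (occurrences (slots (2 ^ n)) edge_event \<omega>) - enn2real (cond_mean (slots (2 ^ n)) (\<lambda>x. edge_prob w (snd x)) \<omega>)) / 2 ^ n) \<longlonglongrightarrow> 0"
  proof (rule weights.cond_law_of_large_numbers)
    show "summable (\<lambda>n. 1 / (2::real) ^ n)"
      using summable_geometric[of "1/2::real"] by (simp add: power_divide)
  qed (use countable_slots edge_events_indep in auto)
  then show ?thesis using typical AE_space
  proof eventually_elim
    case (elim \<omega>)
    obtain \<mu> where \<mu>: "mean_edges w \<omega> = ennreal \<mu>" "\<mu> > 0"
      using typical_mean_edges_finite[OF elim(2)] typical_mean_edges_pos[OF elim(2)] by (cases "mean_edges w \<omega>") auto
    have Q: "cond_mean (slots (2 ^ n)) (\<lambda>x. edge_prob w (snd x)) \<omega> = ennreal (\<mu> * 2 ^ n)" for n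
      using cond_mean_slots[of "2 ^ n" "edge_prob w" \<omega>] \<mu>
      unfolding mean_edges_def[symmetric] by (simp add: ennreal_of_nat_eq_real_of_nat ennreal_mult[symmetric] mult.commute)
    have "\<exists>K::nat. \<forall>n\<ge>K. cond_mean (slots (2 ^ n)) (\<lambda>x. edge_prob w (snd x)) \<omega> \<le> ennreal (real K * 2 ^ n)"
    proof -
      obtain K :: nat where "\<mu> \<le> K" using real_arch_simple by blast
      then show ?thesis unfolding Q by (intro exI[of _ K]) (auto intro!: ennreal_leI)
    qed
    with elim have "(\<lambda>n. (enn2real (num_edges m (2 ^ n) \<omega>) - \<mu> * 2 ^ n) / 2 ^ n) \<longlonglongrightarrow> 0"
      using \<mu>(2) by (simp add: Q num_edges_occurrences)
    then have "\<forall>\<^sub>F n in sequentially. \<bar>enn2real (num_edges m (2 ^ n) \<omega>) - \<mu> * 2 ^ n\<bar> \<le> \<mu> / 2 * 2 ^ n"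
      by (rule eventually_ratio_close) (use \<mu>(2) in auto)
    then have "\<forall>\<^sub>F n in sequentially. ennreal (\<mu> / 2 * 2 ^ n) \<le> num_edges m (2 ^ n) \<omega> \<and>
      num_edges m (2 ^ n) \<omega> \<le> ennreal (2 * \<mu> * 2 ^ n)"
    proof eventually_elim
      case (elim n)
      have pos: "0 < \<mu> * 2 ^ n" using \<mu>(2) by simp
      have "\<bar>x - y\<bar> \<le> y / 2 \<Longrightarrow> 0 < y \<Longrightarrow> y / 2 \<le> x \<and> x \<le> 2 * y" for x y :: real by linarith
      from this[OF _ pos] have b: "\<mu> / 2 * 2 ^ n \<le> enn2real (num_edges m (2 ^ n) \<omega>)" "enn2real (num_edges m (2 ^ n) \<omega>) \<le> 2 * \<mu> * 2 ^ n"
        using elim by (simp_all add: mult.assoc)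
      then have "0 < enn2real (num_edges m (2 ^ n) \<omega>)" using pos by linarith
      then have "num_edges m (2 ^ n) \<omega> < \<top>" by (simp add: enn2real_positive_iff)
      then have "ennreal (enn2real (num_edges m (2 ^ n) \<omega>)) = num_edges m (2 ^ n) \<omega>" by simp
      then show ?case using b by (metis ennreal_leI)
    qed
    then show ?case using \<mu>(2) by (intro exI[of _ "\<mu>/2"] exI[of _ "2 * \<mu>"] conjI) auto
  qed
qed

definition num_touching :: "nat \<Rightarrow> 'a \<Rightarrow> ennreal" where
  "num_touching n = occurrences (slots (2 ^ n)) (\<lambda>x. edge_event x \<inter> touching_event n x)"

text \<open>The edges that touch a vertex of small weight are counted in place of these vertices,
  because the edges are conditionally independent and the vertices are not.\<close>
lemma AE_num_touching_le:
  assumes L: "slowly_varying_tail L" and typical: "AE \<omega> in M. typical_weights L w \<omega>"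
  shows "AE \<omega> in M. \<exists>C>0. \<forall>\<^sub>F n in sequentially. num_touching n \<omega> \<le> ennreal (C * (2 ^ n * tail_integral L (2 ^ n)))"
proof -
  interpret slowly_varying_tail L by fact
  define q where "q n x \<omega> = edge_prob w (snd x) \<omega> * indicator (touching_event n x) \<omega>" for n and x :: "nat \<times> nat set" and \<omega>
  have growth: "\<forall>\<^sub>F n in sequentially. 0 < growth n"
    using eventually_onset_le by eventually_elim (rule growth_pos)
  have "AE \<omega> in M. (\<exists>K::nat. \<forall>n\<ge>K. cond_mean (slots (2 ^ n)) (q n) \<omega> \<le> ennreal (K * growth n)) \<longrightarrow>
    (\<lambda>n. (enn2real (num_touching n \<omega>) - enn2real (cond_mean (slots (2 ^ n)) (q n) \<omega>)) / growth n) \<longlonglongrightarrow> 0"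
    unfolding q_def num_touching_def
    by (rule weights.cond_law_of_large_numbers[OF countable_slots weights.cond_pairwise_indep_Int[OF edge_events_indep touching_event_sets] growth summable_inverse_growth])
  then show ?thesis using typical AE_space AE_num_edges_growth[OF L typical]
  proof eventually_elim
    case (elim \<omega>)
    obtain K where K: "K > 0" "\<forall>\<^sub>F n in sequentially.
      touching_mass w n \<omega> \<le> ennreal (K * tail_integral L (2 ^ n))"
      using typical_touching_mass_le[OF elim(2)] by auto
    have Q: "cond_mean (slots (2 ^ n)) (q n) \<omega> = of_nat (2 ^ n) * touching_mass w n \<omega>" for n
    proof -
      have "cond_mean (slots (2 ^ n)) (q n) \<omega> = cond_mean (slots (2 ^ n)) (\<lambda>x \<omega>. edge_prob w (snd x) \<omega> * of_bool (touches w n (snd x) \<omega>)) \<omega>"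
        unfolding cond_mean_def q_def using elim(3)
        by (intro nn_integral_cong) (auto simp: touching_event_def indicator_def case_prod_unfold)
      then show ?thesis using cond_mean_slots[of "2 ^ n" "\<lambda>e \<omega>. edge_prob w e \<omega> * of_bool (touches w n e \<omega>)" \<omega>]
        by (simp add: touching_mass_def)
    qed
    have QK: "\<forall>\<^sub>F n in sequentially. cond_mean (slots (2 ^ n)) (q n) \<omega> \<le> ennreal (K * growth n)"
      using K(2) eventually_onset_le
    proof eventually_elim
      case (elim n)
      have "cond_mean (slots (2 ^ n)) (q n) \<omega> \<le> ennreal (2 ^ n) * ennreal (K * tail_integral L (2 ^ n))"
        unfolding Q by (intro mult_mono elim) (auto simp: ennreal_of_nat_eq_real_of_nat)
      also have "\<dots> = ennreal (K * growth n)"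
        using K(1) tail_pos[OF elim(2)] by (simp add: ennreal_mult[symmetric] growth_def mult_ac)
      finally show ?case .
    qed
    have "\<exists>K::nat. \<forall>n\<ge>K. cond_mean (slots (2 ^ n)) (q n) \<omega> \<le> ennreal (K * growth n)"
      using QK growth by (rule eventually_le_nat_multiple)
    with elim(1) have "(\<lambda>n. (enn2real (num_touching n \<omega>) - enn2real (cond_mean (slots (2 ^ n)) (q n) \<omega>)) / growth n) \<longlonglongrightarrow> 0"
      by simp
    then have close: "\<forall>\<^sub>F n in sequentially. \<bar>enn2real (num_touching n \<omega>) - enn2real (cond_mean (slots (2 ^ n)) (q n) \<omega>)\<bar> \<le> 1 * growth n"
      using growth by (rule eventually_ratio_close) simp
    obtain C' where fin: "\<forall>\<^sub>F n in sequentially. num_edges m (2 ^ n) \<omega> \<le> ennreal (C' * 2 ^ n)"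
      using elim(4) unfolding eventually_conj_iff by blast
    have "\<forall>\<^sub>F n in sequentially. num_touching n \<omega> \<le> ennreal ((K + 1) * growth n)"
      using close QK fin growth
    proof eventually_elim
      case (elim n)
      have "num_touching n \<omega> \<le> num_edges m (2 ^ n) \<omega>"
        unfolding num_touching_def num_edges_occurrences[OF \<open>\<omega> \<in> space M\<close>] occurrences_def
        by (intro nn_integral_mono) (auto simp: indicator_def)
      also have "\<dots> < \<top>" using elim(3) by (rule le_less_trans) simp
      finally have "num_touching n \<omega> = ennreal (enn2real (num_touching n \<omega>))" by simp
      also have "\<dots> \<le> ennreal ((K + 1) * growth n)"
      proof (rule ennreal_leI)
        have "enn2real (cond_mean (slots (2 ^ n)) (q n) \<omega>) \<le> K * growth n"
          using elim(2,4) K(1) by (intro enn2real_leI) auto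
        then show "enn2real (num_touching n \<omega>) \<le> (K + 1) * growth n"
          using elim(1) by (simp add: abs_le_iff algebra_simps)
      qed
      finally show ?case .
    qed
    then show ?case using K(1) unfolding growth_def by (intro exI[of _ "K + 1"]) auto
  qed
qed

definition num_neighbours :: "nat \<Rightarrow> nat \<Rightarrow> 'a \<Rightarrow> ennreal" where
  "num_neighbours j t = occurrences (UNIV - {j}) (\<lambda>i. {\<omega> \<in> space M. \<exists>p\<in>{1..t}. m p {i, j} \<omega>})"

text \<open>The neighbours of one vertex arise independently given the weights, and their expected number
  is already of the full order of magnitude.\<close>
lemma AE_num_neighbours_ge:
  assumes L: "slowly_varying_tail L" and typical: "AE \<omega> in M. typical_weights L w \<omega>"
  shows "AE \<omega> in M. w j \<omega> > 0 \<longrightarrow> (\<exists>c>0. \<forall>\<^sub>F n in sequentially.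
     ennreal (c * (2 ^ n * tail_integral L (2 ^ n))) \<le> num_neighbours j (2 ^ n) \<omega>)"
proof -
  interpret slowly_varying_tail L by fact
  define q where "q t i \<omega> = 1 - (1 - w i \<omega> * w j \<omega>) ^ t" for t i \<omega>
  have growth: "\<forall>\<^sub>F n in sequentially. 0 < growth n"
    using eventually_onset_le by eventually_elim (rule growth_pos)
  have Q: "cond_mean (UNIV - {j}) (q t) \<omega> = mean_neighbours w j t \<omega>" for t \<omega>
    unfolding cond_mean_def mean_neighbours_def q_def ..
  have "AE \<omega> in M. (\<exists>K::nat. \<forall>n\<ge>K. cond_mean (UNIV - {j}) (q (2 ^ n)) \<omega> \<le> ennreal (K * growth n)) \<longrightarrow>
    (\<lambda>n. (enn2real (num_neighbours j (2 ^ n) \<omega>) - enn2real (cond_mean (UNIV - {j}) (q (2 ^ n)) \<omega>)) / growth n) \<longlonglongrightarrow> 0"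
    unfolding q_def[abs_def] num_neighbours_def
    by (rule weights.cond_law_of_large_numbers[OF _ neighbours_cond_pairwise_indep growth summable_inverse_growth]) simp
  then show ?thesis using typical
  proof eventually_elim
    case (elim \<omega>)
    have "\<exists>c>0. \<forall>\<^sub>F n in sequentially. ennreal (c * growth n) \<le> num_neighbours j (2 ^ n) \<omega>" if j: "0 < w j \<omega>"
    proof -
    obtain c where c: "c > 0" "\<forall>\<^sub>F n in sequentially. ennreal (c * growth n) \<le> mean_neighbours w j (2 ^ n) \<omega>"
      using typical_mean_neighbours_ge[OF elim(2) j] by auto
    obtain K where K: "K > 0" "\<forall>\<^sub>F n in sequentially. mean_neighbours w j (2 ^ n) \<omega> \<le> ennreal (K * growth n)"
      using typical_mean_neighbours_le[OF elim(2)] by auto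
    have "\<exists>K::nat. \<forall>n\<ge>K. mean_neighbours w j (2 ^ n) \<omega> \<le> ennreal (K * growth n)"
      using K(2) growth by (rule eventually_le_nat_multiple)
    with elim(1) have "(\<lambda>n. (enn2real (num_neighbours j (2 ^ n) \<omega>) - enn2real (mean_neighbours w j (2 ^ n) \<omega>)) / growth n) \<longlonglongrightarrow> 0"
      unfolding Q by simp
    then have close: "\<forall>\<^sub>F n in sequentially. \<bar>enn2real (num_neighbours j (2 ^ n) \<omega>) - enn2real (mean_neighbours w j (2 ^ n) \<omega>)\<bar> \<le> c / 2 * growth n"
      using growth by (rule eventually_ratio_close) (use c in simp)
    have "\<forall>\<^sub>F n in sequentially. ennreal (c / 2 * growth n) \<le> num_neighbours j (2 ^ n) \<omega>"
      using close c(2) K(2) growth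
    proof eventually_elim
      case (elim n)
      have "mean_neighbours w j (2 ^ n) \<omega> < \<top>" using elim(3) by (rule le_less_trans) simp
      then have "c * growth n \<le> enn2real (mean_neighbours w j (2 ^ n) \<omega>)"
        using elim(2,4) c(1) by (cases "mean_neighbours w j (2 ^ n) \<omega>") auto
      then have "c / 2 * growth n \<le> enn2real (num_neighbours j (2 ^ n) \<omega>)"
        using elim(1) by linarith
      then have "ennreal (c / 2 * growth n) \<le> ennreal (enn2real (num_neighbours j (2 ^ n) \<omega>))" by (rule ennreal_leI)
      also have "\<dots> \<le> num_neighbours j (2 ^ n) \<omega>" by (cases "num_neighbours j (2 ^ n) \<omega>") auto
      finally show ?case .
    qed
    then show ?thesis using c(1) by (intro exI[of _ "c / 2"]) auto
    qed
    then show ?case unfolding growth_def by blast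
  qed
qed

lemma num_neighbours_le_num_vertices: "num_neighbours j t \<omega> \<le> num_vertices m t \<omega>"
proof -
  have "{i \<in> UNIV - {j}. \<omega> \<in> {\<omega> \<in> space M. \<exists>p\<in>{1..t}. m p {i, j} \<omega>}} \<subseteq> active_vertices m t \<omega>"
  proof
    fix i assume "i \<in> {i \<in> UNIV - {j}. \<omega> \<in> {\<omega> \<in> space M. \<exists>p\<in>{1..t}. m p {i, j} \<omega>}}"
    then obtain p where "j \<noteq> i \<and> p \<in> {1..t} \<and> m p {i, j} \<omega>" by auto
    then show "i \<in> active_vertices m t \<omega>" unfolding active_vertices_def by (intro CollectI exI)
  qed
  then show ?thesis unfolding num_neighbours_def occurrences_eq num_vertices_eq
    by (rule emeasure_mono) simp
qed

text \<open>A vertex of small weight can only be active through an edge that touches it, and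
  an edge has two ends.\<close>
lemma num_vertices_le:
  assumes \<omega>: "\<omega> \<in> space M" and fin: "num_touching n \<omega> < \<infinity>"
  shows "num_vertices m (2 ^ n) \<omega> \<le> num_points w {1 / 2 ^ n<..1} \<omega> + 2 * num_touching n \<omega>"
proof -
  define A where "A = {x \<in> slots (2 ^ n). \<omega> \<in> edge_event x \<inter> touching_event n x}"
  have A: "num_touching n \<omega> = emeasure (count_space UNIV) A" unfolding num_touching_def occurrences_eq A_def ..
  have finA: "finite A" using fin unfolding A by (cases "finite A") auto
  have card2: "card (snd x) = 2" if "x \<in> A" for x using that by (auto simp: A_def slots_def vertex_pairs_def)
  have finU: "finite (\<Union>x\<in>A. snd x)" 
  proof (rule finite_UN_I[OF finA])
    fix x assume "x \<in> A"
    then show "finite (snd x)" using card2[of x] by (intro card_ge_0_finite) simp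
  qed
  have sub: "active_vertices m (2 ^ n) \<omega> \<subseteq> {i. w i \<omega> \<in> {1 / 2 ^ n<..1}} \<union> (\<Union>x\<in>A. snd x)"
  proof
    fix i assume "i \<in> active_vertices m (2 ^ n) \<omega>"
    then obtain j p where jp: "j \<noteq> i" "p \<in> {1..2 ^ n}" "m p {i, j} \<omega>" by (auto simp: active_vertices_def)
    show "i \<in> {i. w i \<omega> \<in> {1 / 2 ^ n<..1}} \<union> (\<Union>x\<in>A. snd x)"
    proof (cases "w i \<omega> \<le> 1 / 2 ^ n")
      case True
      then have "(p, {i, j}) \<in> A"
        using jp \<omega> by (auto simp: A_def slots_def vertex_pairs_def card_2_iff edge_event_def touching_event_def touches_def)
      then show ?thesis by force
    next
      case False
      then show ?thesis using weight_01[OF \<omega>] by auto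
    qed
  qed
  have "num_vertices m (2 ^ n) \<omega> \<le> emeasure (count_space UNIV) ({i. w i \<omega> \<in> {1 / 2 ^ n<..1}} \<union> (\<Union>x\<in>A. snd x))"
    unfolding num_vertices_eq using sub by (rule emeasure_mono) simp
  also have "\<dots> \<le> num_points w {1 / 2 ^ n<..1} \<omega> + emeasure (count_space UNIV) (\<Union>x\<in>A. snd x)"
    unfolding num_points_def by (rule emeasure_subadditive) auto
  also have "emeasure (count_space UNIV) (\<Union>x\<in>A. snd x) = of_nat (card (\<Union>x\<in>A. snd x))"
    using finU by simp
  also have "card (\<Union>x\<in>A. snd x) \<le> 2 * card A"
    using card_UN_le[OF finA, of snd] card2 by simp
  also have "of_nat (2 * card A) = 2 * num_touching n \<omega>" unfolding A using finA by simp
  finally show ?thesis by (simp add: add_left_mono)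
qed

lemma AE_num_vertices_growth:
  assumes L: "slowly_varying_tail L" and typical: "AE \<omega> in M. typical_weights L w \<omega>"
  shows "AE \<omega> in M. \<exists>c>0. \<exists>C>0. \<forall>\<^sub>F n in sequentially.
     ennreal (c * (2 ^ n * tail_integral L (2 ^ n))) \<le> num_vertices m (2 ^ n) \<omega> \<and>
     num_vertices m (2 ^ n) \<omega> \<le> ennreal (C * (2 ^ n * tail_integral L (2 ^ n)))"
proof -
  interpret slowly_varying_tail L by fact
  have "AE \<omega> in M. \<forall>j. w j \<omega> > 0 \<longrightarrow> (\<exists>c>0. \<forall>\<^sub>F n in sequentially.
     ennreal (c * (2 ^ n * tail_integral L (2 ^ n))) \<le> num_neighbours j (2 ^ n) \<omega>)"
    using AE_num_neighbours_ge[OF L typical] by (subst AE_all_countable) blast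
  then show ?thesis using typical AE_space AE_num_touching_le[OF L typical]
  proof eventually_elim
    case (elim \<omega>)
    obtain j where "w j \<omega> > 0" using typical_small_weight[OF elim(2), of 1] by auto
    then obtain c where c: "c > 0" "\<forall>\<^sub>F n in sequentially. ennreal (c * growth n) \<le> num_neighbours j (2 ^ n) \<omega>"
      using elim(1) unfolding growth_def by blast
    obtain B where B: "B > 0" "\<forall>\<^sub>F n in sequentially. num_touching n \<omega> \<le> ennreal (B * growth n)"
      using elim(4) unfolding growth_def by blast
    obtain D where D: "D > 0" "\<forall>\<^sub>F n in sequentially. num_points w {1 / 2 ^ n<..1} \<omega> \<le> ennreal (D * growth n)"
      using elim(2) unfolding typical_weights_def growth_def by blast
    have "\<forall>\<^sub>F n in sequentially. ennreal (c * growth n) \<le> num_vertices m (2 ^ n) \<omega> \<and>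
      num_vertices m (2 ^ n) \<omega> \<le> ennreal ((D + 2 * B) * growth n)"
      using c(2) B(2) D(2) eventually_onset_le
    proof eventually_elim
      case (elim n)
      have pos: "0 < growth n" by (rule growth_pos[OF elim(4)])
      have "num_touching n \<omega> < \<infinity>" using elim(2) by (rule le_less_trans) simp
      with \<open>\<omega> \<in> space M\<close> have "num_vertices m (2 ^ n) \<omega> \<le> num_points w {1 / 2 ^ n<..1} \<omega> + 2 * num_touching n \<omega>"
        by (rule num_vertices_le)
      also have "\<dots> \<le> ennreal (D * growth n) + 2 * ennreal (B * growth n)"
        using elim by (intro add_mono mult_left_mono) auto
      also have "\<dots> = ennreal (D * growth n + 2 * (B * growth n))"
        using pos B(1) D(1) by (subst ennreal_plus) (auto simp: ennreal_mult)
      also have "D * growth n + 2 * (B * growth n) = (D + 2 * B) * growth n" by (simp add: algebra_simps)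
      finally show ?case using order_trans[OF elim(1) num_neighbours_le_num_vertices] by simp
    qed
    then show ?case using c(1) B(1) D(1) unfolding growth_def by (intro exI[of _ c] exI[of _ "D + 2 * B"] conjI) auto
  qed
qed

end

section \<open>Interpolation in time and inversion\<close>

lemma bigtheta_of_bounds:
  fixes f g :: "nat \<Rightarrow> real"
  assumes c: "c > 0" and ev: "\<forall>\<^sub>F t in sequentially. 0 \<le> g t \<and> c * g t \<le> f t \<and> f t \<le> C * g t"
  shows "f \<in> \<Theta>(g)"
proof (rule bigthetaI)
  have nn: "0 \<le> f t" if "0 \<le> g t" "c * g t \<le> f t" for t
    using that c by (meson mult_nonneg_nonneg less_imp_le order_trans)
  have "\<forall>\<^sub>F t in sequentially. norm (f t) \<le> C * norm (g t)"
    using ev by eventually_elim (use nn in auto)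
  then show "f \<in> O(g)" by (rule bigoI)
  have "\<forall>\<^sub>F t in sequentially. norm (g t) \<le> (1 / c) * norm (f t)"
    using ev by eventually_elim (use nn c in \<open>auto simp: field_simps\<close>)
  then have "g \<in> O(f)" by (rule bigoI)
  then show "f \<in> \<Omega>(g)" by (simp add: bigomega_iff_bigo)
qed

lemma eventually_dyadic_block:
  assumes "\<forall>\<^sub>F n in sequentially. P n"
  shows "\<forall>\<^sub>F t in sequentially. \<exists>n. P n \<and> 2 ^ n \<le> t \<and> t < 2 ^ Suc n"
proof -
  obtain N where N: "\<And>n. n \<ge> N \<Longrightarrow> P n" using assms by (auto simp: eventually_sequentially)
  have "\<exists>n. P n \<and> 2 ^ n \<le> t \<and> t < 2 ^ Suc n" if t: "t \<ge> 2 ^ N" for t :: nat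
  proof -
    have "1 \<le> t" using t by (meson one_le_power order_trans one_le_numeral)
    then obtain n where n: "2 ^ n \<le> t" "t < 2 ^ Suc n" using ex_power_ivl1[of 2 t] by auto
    have "(2::nat) ^ N < 2 ^ Suc n" using t n(2) by (rule le_less_trans)
    then have "N < Suc n" by (rule power_less_imp_less_exp[rotated]) simp
    then have "n \<ge> N" by simp
    then show ?thesis using N n by blast
  qed
  then show ?thesis unfolding eventually_sequentially by blast
qed

text \<open>Between two powers of two, monotonicity compares $a$ with its values at the ends, and the bounds
  change by at most a factor of two.\<close>
lemma dyadic_interpolation:
  fixes a :: "nat \<Rightarrow> ennreal" and b y :: "nat \<Rightarrow> real"
  assumes mono: "mono a" and c: "c > 0" and C: "C > 0"
    and bounds: "\<forall>\<^sub>F n in sequentially. ennreal (c * b n) \<le> a (2 ^ n) \<and> a (2 ^ n) \<le> ennreal (C * b n)"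
    and b: "\<forall>\<^sub>F n in sequentially. \<forall>t. 2 ^ n \<le> t \<and> t < 2 ^ Suc n \<longrightarrow> y t \<le> 2 * b n \<and> b (Suc n) \<le> 2 * y t \<and> 0 < b (Suc n)"
  shows "\<forall>\<^sub>F t in sequentially. c / 2 * y t \<le> enn2real (a t) \<and> enn2real (a t) \<le> 2 * C * y t"
proof -
  have "\<forall>\<^sub>F n in sequentially. ennreal (c * b n) \<le> a (2 ^ n) \<and> a (2 ^ Suc n) \<le> ennreal (C * b (Suc n)) \<and>
     (\<forall>t. 2 ^ n \<le> t \<and> t < 2 ^ Suc n \<longrightarrow> y t \<le> 2 * b n \<and> b (Suc n) \<le> 2 * y t \<and> 0 < b (Suc n))"
    using eventually_all_ge_at_top[OF bounds] b
  proof eventually_elim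
    case (elim n)
    show ?case
      by (intro conjI conjunct1[OF elim(1)[rule_format, of n]] conjunct2[OF elim(1)[rule_format, of "Suc n"]] elim(2)) simp_all
  qed
  then have "\<forall>\<^sub>F t in sequentially. \<exists>n. (ennreal (c * b n) \<le> a (2 ^ n) \<and> a (2 ^ Suc n) \<le> ennreal (C * b (Suc n)) \<and>
     (\<forall>t. 2 ^ n \<le> t \<and> t < 2 ^ Suc n \<longrightarrow> y t \<le> 2 * b n \<and> b (Suc n) \<le> 2 * y t \<and> 0 < b (Suc n))) \<and> 2 ^ n \<le> t \<and> t < 2 ^ Suc n"
    by (rule eventually_dyadic_block)
  then show ?thesis
  proof eventually_elim
    case (elim t)
    then obtain n where n: "ennreal (c * b n) \<le> a (2 ^ n)" "a (2 ^ Suc n) \<le> ennreal (C * b (Suc n))"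
      "y t \<le> 2 * b n" "b (Suc n) \<le> 2 * y t" "0 < b (Suc n)" "2 ^ n \<le> t" "t < 2 ^ Suc n" by blast
    have low: "ennreal (c * b n) \<le> a t" using n(1) monoD[OF mono n(6)] by (rule order_trans)
    have upp: "a t \<le> ennreal (C * b (Suc n))" using monoD[OF mono less_imp_le[OF n(7)]] n(2) by (rule order_trans)
    have ypos: "0 < y t" using n(4,5) by simp
    then have bpos: "0 < b n" using n(3) by linarith
    obtain r where r: "a t = ennreal r" "r \<ge> 0" using upp by (cases "a t") (auto simp: top_unique)
    have "c * b n \<le> r" using low r bpos c by (simp add: ennreal_le_iff)
    moreover have "r \<le> C * b (Suc n)" using upp r n(5) C by (simp add: ennreal_le_iff)
    moreover have "c / 2 * y t \<le> c / 2 * (2 * b n)" using n(3) c by (intro mult_left_mono) auto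
    moreover have "C * b (Suc n) \<le> C * (2 * y t)" using n(4) C by (intro mult_left_mono) auto
    ultimately show ?case using r by simp
  qed
qed

context slowly_varying_tail
begin

lemma tail_shrink_le:
  assumes "onset \<le> x / 2 ^ k" shows "tail (x / 2 ^ k) \<le> (4/3) ^ k * tail x"
proof -
  have "(3/4) ^ k * tail (x / 2 ^ k) \<le> tail x" using tail_pow_le[OF assms, of k] by simp
  then have "(4/3) ^ k * ((3/4) ^ k * tail (x / 2 ^ k)) \<le> (4/3) ^ k * tail x"
    by (intro mult_left_mono) auto
  also have "(4/3) ^ k * ((3/4) ^ k * tail (x / 2 ^ k)) = tail (x / 2 ^ k)"
    by (simp add: mult.assoc[symmetric] power_mult_distrib[symmetric])
  finally show ?thesis .
qed

text \<open>Doubling the argument changes the tail by a bounded factor, so finitely many doublings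
  compare arguments of the same order of magnitude.\<close>
lemma tail_comparable:
  fixes y x :: "nat \<Rightarrow> real"
  assumes c: "c > 0" and ytop: "filterlim y at_top sequentially"
    and ev: "\<forall>\<^sub>F t in sequentially. c * y t \<le> x t \<and> x t \<le> C * y t"
  shows "\<exists>a>0. \<exists>b>0. \<forall>\<^sub>F t in sequentially. a * tail (y t) \<le> tail (x t) \<and>
      tail (x t) \<le> b * tail (y t)"
proof -
  obtain k where k: "C < 2 ^ k" using real_arch_pow[of 2 C] by auto
  obtain l where "(1/2) ^ l < c" using real_arch_pow_inv[of c "1/2"] c by auto
  then have l: "1 / 2 ^ l < c" by (simp add: power_divide)
  have "\<forall>\<^sub>F t in sequentially. 2 ^ l * onset \<le> y t" using ytop by (simp add: filterlim_at_top)
  then have "\<forall>\<^sub>F t in sequentially. (3/4) ^ k * tail (y t) \<le> tail (x t) \<and>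
      tail (x t) \<le> (4/3) ^ l * tail (y t)"
    using ev
  proof eventually_elim
    case (elim t)
    have z: "onset \<le> y t / 2 ^ l" using elim(1) by (simp add: field_simps)
    have "0 < y t / 2 ^ l" using z onset(1) by linarith
    then have ypos: "0 < y t" by (simp add: zero_less_divide_iff)
    have "y t / 2 ^ l = 1 / 2 ^ l * y t" by simp
    also have "\<dots> \<le> c * y t" using l ypos by (intro mult_right_mono) auto
    finally have zx: "y t / 2 ^ l \<le> x t" using elim(2) by linarith
    have "x t \<le> C * y t" using elim(2) by simp
    also have "\<dots> \<le> 2 ^ k * y t" using k ypos by (intro mult_right_mono) auto
    finally have xk: "x t \<le> 2 ^ k * y t" .
    have "y t / 2 ^ l \<le> y t" using ypos by (simp add: field_simps)
    then have yon: "onset \<le> y t" using z by linarith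
    have "(3/4) ^ k * tail (y t) \<le> tail (2 ^ k * y t)" by (rule tail_pow_le[OF yon])
    also have "\<dots> \<le> tail (x t)" using z zx xk by (intro tail_antimono) auto
    finally have 1: "(3/4) ^ k * tail (y t) \<le> tail (x t)" .
    have "tail (x t) \<le> tail (y t / 2 ^ l)" using z zx by (intro tail_antimono) auto
    also have "\<dots> \<le> (4/3) ^ l * tail (y t)" by (rule tail_shrink_le[OF z])
    finally show ?case using 1 by simp
  qed
  then show ?thesis by (intro exI[of _ "(3/4) ^ k"] exI[of _ "(4/3) ^ l"] conjI) auto
qed

lemma growth_at_top: "filterlim growth at_top sequentially"
proof -
  have "(\<lambda>n. 1 / growth n) \<longlonglongrightarrow> 0" by (rule summable_LIMSEQ_zero[OF summable_inverse_growth])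
  then have "(\<lambda>n. inverse (growth n)) \<longlonglongrightarrow> 0" by (simp add: inverse_eq_divide)
  moreover have "\<forall>\<^sub>F n in sequentially. 0 < inverse (growth n)"
    using eventually_onset_le by eventually_elim (simp add: growth_pos)
  ultimately have "filterlim (\<lambda>n. inverse (inverse (growth n))) at_top sequentially"
    by (rule filterlim_inverse_at_top)
  then show ?thesis by simp
qed

lemma growth_dyadic:
  "\<forall>\<^sub>F n in sequentially. \<forall>t::nat. (2::nat) ^ n \<le> t \<and> t < (2::nat) ^ Suc n \<longrightarrow>
     t * tail t \<le> 2 * growth n \<and> growth (Suc n) \<le> 2 * (t * tail t) \<and> 0 < growth (Suc n)"
  using eventually_onset_le
proof eventually_elim
  case (elim n)
  show ?case
  proof (intro allI impI)
    fix t :: nat assume t: "(2::nat) ^ n \<le> t \<and> t < (2::nat) ^ Suc n"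
    have t': "2 ^ n \<le> real t" "real t \<le> 2 ^ Suc n"
      using t by (metis of_nat_le_iff of_nat_numeral of_nat_power, metis less_imp_le of_nat_le_iff of_nat_numeral of_nat_power)
    have on: "onset \<le> real t" by (rule order_trans[OF elim t'(1)])
    have on': "onset \<le> 2 ^ Suc n" by (rule order_trans[OF on t'(2)])
    have T: "tail t \<le> tail (2 ^ n)" "tail (2 ^ Suc n) \<le> tail t"
      by (rule tail_antimono[OF elim t'(1)], rule tail_antimono[OF on t'(2)])
    have p: "0 < tail t" "0 < tail (2 ^ Suc n)" using tail_pos[OF on] tail_pos[OF on'] by auto
    have "t * tail t \<le> 2 ^ Suc n * tail (2 ^ n)" using t' T p by (intro mult_mono) auto
    moreover have "2 ^ Suc n * tail (2 ^ Suc n) \<le> (2 * real t) * tail t" using t' T p by (intro mult_mono) auto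
    ultimately show "t * tail t \<le> 2 * growth n \<and> growth (Suc n) \<le> 2 * (t * tail t) \<and> 0 < growth (Suc n)"
      using growth_pos[OF on'] by (simp add: growth_def)
  qed
qed

lemma time_tail_at_top: "filterlim (\<lambda>t::nat. t * tail t) at_top sequentially"
  unfolding filterlim_at_top
proof
  fix Z :: real
  have "\<forall>\<^sub>F n in sequentially. 2 * Z \<le> growth (Suc n)"
    using filterlim_compose[OF growth_at_top filterlim_Suc] by (simp add: filterlim_at_top)
  then have "\<forall>\<^sub>F n in sequentially. 2 * Z \<le> growth (Suc n) \<and> (\<forall>t::nat. (2::nat) ^ n \<le> t \<and> t < (2::nat) ^ Suc n \<longrightarrow>
     t * tail t \<le> 2 * growth n \<and> growth (Suc n) \<le> 2 * (t * tail t) \<and> 0 < growth (Suc n))"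
    using growth_dyadic by (rule eventually_conj)
  then show "\<forall>\<^sub>F t in sequentially. Z \<le> t * tail t"
    by (rule eventually_mono[OF eventually_dyadic_block]) fastforce
qed

text \<open>The quotient $x_t/\ell_1(x_t)$ is of the order of $t\,\ell_1(t)/\ell_1(t\,\ell_1(t))$, and the
  assumption on $\ell_1$ is exactly what cancels the two tails.\<close>
lemma bigtheta_inversion:
  fixes E x :: "nat \<Rightarrow> real"
  assumes asymp: "(\<lambda>x. tail (x * tail x)) \<sim>[at_top] tail"
    and c: "c > 0" and x: "\<forall>\<^sub>F t in sequentially. c * (t * tail t) \<le> x t \<and> x t \<le> C * (t * tail t)"
    and d: "d > 0" and E: "\<forall>\<^sub>F t in sequentially. d * real t \<le> E t \<and> E t \<le> D * real t"
  shows "E \<in> \<Theta>(\<lambda>t. x t / tail (x t))"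
proof -
  define y where "y t = t * tail t" for t :: nat
  obtain a b where ab: "a > 0" "b > 0" "\<forall>\<^sub>F t in sequentially. a * tail (y t) \<le> tail (x t) \<and>
      tail (x t) \<le> b * tail (y t)"
    using tail_comparable[OF c, of y x C] time_tail_at_top x unfolding y_def by blast
  have on: "\<forall>\<^sub>F t in sequentially. onset \<le> real t"
    using filterlim_real_sequentially by (simp add: filterlim_at_top)
  have "((\<lambda>x. tail (x * tail x) / tail x) \<longlongrightarrow> 1) at_top"
    by (rule asymp_equivD_strong[OF asymp])
      (use eventually_ge_at_top[of onset] in \<open>eventually_elim, use tail_pos in fastforce\<close>)
  then have lim: "((\<lambda>t. tail (y t) / tail (real t)) \<longlongrightarrow> 1) sequentially"
    unfolding y_def by (rule filterlim_compose[OF _ filterlim_real_sequentially])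
  have "\<forall>\<^sub>F t in sequentially. 1/2 < tail (y t) / tail (real t)"
    "\<forall>\<^sub>F t in sequentially. tail (y t) / tail (real t) < 2"
    by (rule order_tendstoD(1)[OF lim], simp, rule order_tendstoD(2)[OF lim], simp)
  then have ratio: "\<forall>\<^sub>F t in sequentially. a / 2 * tail t \<le> tail (x t) \<and> tail (x t) \<le> 2 * b * tail t"
    using ab(3) on
  proof eventually_elim
    case (elim t)
    have T: "0 < tail t" by (rule tail_pos[OF elim(4)])
    have "1/2 * tail t \<le> tail (y t)" "tail (y t) \<le> 2 * tail t"
      using elim(1,2) T by (simp_all add: field_simps)
    then have "a * (1/2 * tail t) \<le> a * tail (y t)" "b * tail (y t) \<le> b * (2 * tail t)"
      using ab(1,2) by (auto intro: mult_left_mono)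
    then show ?case using elim(3) by auto
  qed
  have "(\<lambda>t. x t / tail (x t)) \<in> \<Theta>(\<lambda>t. real t)"
  proof (rule bigtheta_of_bounds[where c = "c / (2 * b)" and C = "2 * C / a"])
    show "0 < c / (2 * b)" using c ab by simp
    show "\<forall>\<^sub>F t in sequentially. 0 \<le> real t \<and> c / (2 * b) * real t \<le> x t / tail (x t) \<and> x t / tail (x t) \<le> 2 * C / a * real t"
      using x ratio on
    proof eventually_elim
      case (elim t)
      define S where "S = tail t"
      define U where "U = tail (x t)"
      have S: "0 < S" unfolding S_def by (rule tail_pos[OF elim(3)])
      have U: "a / 2 * S \<le> U" "U \<le> 2 * b * S" using elim(2) unfolding S_def U_def by auto
      have "0 < a / 2 * S" using ab S by simp
      then have Upos: "0 < U" using U by linarith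
      have t: "0 < real t" using elim(3) onset(1) by linarith
      have x: "c * (t * S) \<le> x t" "x t \<le> C * (t * S)" using elim(1) unfolding S_def by auto
      have "0 < c * (t * S)" using c t S by simp
      then have xpos: "0 < x t" using x by linarith
      have "c / (2 * b) * t = c * (t * S) / (2 * b * S)" using S by simp
      also have "\<dots> \<le> x t / U" using x U Upos xpos by (intro frac_le) auto
      finally have 1: "c / (2 * b) * t \<le> x t / U" .
      have "x t / U \<le> C * (t * S) / (a / 2 * S)" using x U Upos xpos \<open>0 < a / 2 * S\<close> by (intro frac_le) auto
      also have "\<dots> = 2 * C / a * t" using S by simp
      finally show ?case using 1 unfolding U_def by simp
    qed
  qed
  moreover have "E \<in> \<Theta>(\<lambda>t. real t)" using d E by (intro bigtheta_of_bounds[where c = d and C = D]) auto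
  ultimately show ?thesis using bigtheta_sym landau_theta.trans by blast
qed

end

section \<open>Logarithmic tails and the growth of the multigraph\<close>

lemma tendsto_ln_powr_zero:
  fixes b :: real assumes "b < 0"
  shows "((\<lambda>x. ln x powr b) \<longlongrightarrow> 0) at_top"
  using assms ln_at_top by (rule tendsto_neg_powr)

context slowly_varying_tail
begin

lemma tail_integral_ln_powr:
  assumes a: "a < -1" and L: "\<forall>\<^sub>F x in at_top. L x = ln x powr a"
  shows "\<forall>\<^sub>F x in at_top. tail x = ln x powr (a + 1) / (- a - 1)"
proof -
  obtain X where X: "\<And>x. x \<ge> X \<Longrightarrow> L x = ln x powr a" using L by (auto simp: eventually_at_top_linorder)
  have "tail x = ln x powr (a + 1) / (- a - 1)" if x: "x \<ge> max X 2" for x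
  proof -
    have x2: "x \<ge> 2" "x \<ge> X" using x by auto
    have "(\<integral>\<^sup>+u. ennreal (ln u powr a / u) * indicator {x..} u \<partial>lborel) = ennreal (0 - ln x powr (a + 1) / (a + 1))"
    proof (rule nn_integral_FTC_atLeast)
      show "(\<lambda>u. ln u powr a / u) \<in> borel_measurable borel" by measurable
      fix u assume "x \<le> u"
      then have u: "u > 0" "ln u > 0" using x2 by auto
      show "((\<lambda>u. ln u powr (a + 1) / (a + 1)) has_real_derivative ln u powr a / u) (at u)"
        using u a by (auto intro!: derivative_eq_intros)
      show "0 \<le> ln u powr a / u" using u by simp
    next
      have "((\<lambda>u::real. ln u powr (a + 1) / (a + 1)) \<longlongrightarrow> 0 / (a + 1)) at_top"
        by (intro tendsto_divide tendsto_ln_powr_zero tendsto_const) (use a in auto)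
      then show "((\<lambda>u::real. ln u powr (a + 1) / (a + 1)) \<longlongrightarrow> 0) at_top" by simp
    qed
    also have "0 - ln x powr (a + 1) / (a + 1) = ln x powr (a + 1) / (- a - 1)" using a by (simp add: field_simps)
    finally have *: "(\<integral>\<^sup>+u. ennreal (ln u powr a / u) * indicator {x..} u \<partial>lborel) = ennreal (ln x powr (a + 1) / (- a - 1))" .
    have "tail x = (\<integral>u. indicator {x..} u * (ln u powr a / u) \<partial>lborel)"
      unfolding tail_integral_def set_lebesgue_integral_def
      by (intro Bochner_Integration.integral_cong) (use X x2 in \<open>auto simp: indicator_def\<close>)
    also have "\<dots> = enn2real (\<integral>\<^sup>+u. ennreal (indicator {x..} u * (ln u powr a / u)) \<partial>lborel)"
      by (rule integral_eq_nn_integral) (use x2 in \<open>auto simp: indicator_def\<close>)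
    also have "(\<integral>\<^sup>+u. ennreal (indicator {x..} u * (ln u powr a / u)) \<partial>lborel) = (\<integral>\<^sup>+u. ennreal (ln u powr a / u) * indicator {x..} u \<partial>lborel)"
      by (intro nn_integral_cong) (auto simp: indicator_def)
    also have "enn2real \<dots> = ln x powr (a + 1) / (- a - 1)" unfolding * using a by simp
    finally show ?thesis .
  qed
  then show ?thesis unfolding eventually_at_top_linorder by blast
qed

text \<open>The tail depends on its argument through the logarithm alone, and $\log(x\,\ell_1(x))$ differs from
  $\log x$ by a multiple of $\log\log x$ and a constant.\<close>
lemma ln_powr_tail_stable:
  assumes a: "a < -1" and L: "\<forall>\<^sub>F x in at_top. L x = ln x powr a"
  shows "(\<lambda>x. tail (x * tail x)) \<sim>[at_top] tail"
proof -
  define \<phi> where "\<phi> x = ln x powr (a + 1) / (- a - 1)" for x :: real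
  have T: "\<forall>\<^sub>F x in at_top. tail x = \<phi> x" unfolding \<phi>_def by (rule tail_integral_ln_powr[OF a L])
  define \<psi> where "\<psi> x = ln x + (a + 1) * ln (ln x) - ln (- a - 1)" for x :: real
  have large: "\<forall>\<^sub>F x::real in at_top. x > 1 \<and> ln x > 0"
    using eventually_gt_at_top[of "1::real"] by eventually_elim simp
  have ln_eq: "\<forall>\<^sub>F x in at_top. ln (x * \<phi> x) = \<psi> x \<and> 0 < x * \<phi> x"
    using large
  proof eventually_elim
    case (elim x)
    have "0 < ln x powr (a + 1)" using elim by simp
    then have "0 < \<phi> x" unfolding \<phi>_def using a by simp
    then show ?case using elim a unfolding \<phi>_def \<psi>_def by (simp add: ln_mult ln_div ln_powr)
  qed
  have lnln: "((\<lambda>x::real. ln (ln x) / ln x) \<longlongrightarrow> 0) at_top"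
    using ln_x_over_x_tendsto_0 ln_at_top by (rule filterlim_compose)
  have inv: "((\<lambda>x::real. 1 / ln x) \<longlongrightarrow> 0) at_top"
    using tendsto_inverse_0_at_top[OF ln_at_top] by (simp add: inverse_eq_divide)
  have "((\<lambda>x. 1 + (a + 1) * (ln (ln x) / ln x) - ln (- a - 1) * (1 / ln x)) \<longlongrightarrow> 1 + (a + 1) * 0 - ln (- a - 1) * 0) at_top"
    by (intro tendsto_intros lnln inv)
  moreover have "\<forall>\<^sub>F x in at_top. 1 + (a + 1) * (ln (ln x) / ln x) - ln (- a - 1) * (1 / ln x) = \<psi> x / ln x"
    using large by eventually_elim (simp add: \<psi>_def field_simps)
  ultimately have ratio: "((\<lambda>x. \<psi> x / ln x) \<longlongrightarrow> 1) at_top"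
    by (simp add: tendsto_cong)
  have \<psi>top: "filterlim \<psi> at_top at_top"
  proof -
    have "filterlim (\<lambda>x. \<psi> x / ln x * ln x) at_top at_top"
      using ratio zero_less_one ln_at_top by (rule filterlim_tendsto_pos_mult_at_top)
    moreover have "\<forall>\<^sub>F x in at_top. \<psi> x / ln x * ln x = \<psi> x" using large by eventually_elim simp
    ultimately show ?thesis by (simp add: filterlim_cong)
  qed
  have xtop: "filterlim (\<lambda>x. x * \<phi> x) at_top at_top"
  proof -
    have "filterlim (\<lambda>x. exp (\<psi> x)) at_top at_top" using exp_at_top \<psi>top by (rule filterlim_compose)
    moreover have "\<forall>\<^sub>F x in at_top. exp (\<psi> x) = x * \<phi> x"
      using ln_eq by eventually_elim (metis exp_ln)
    ultimately show ?thesis by (simp add: filterlim_cong)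
  qed
  have "((\<lambda>x. (\<psi> x / ln x) powr (a + 1)) \<longlongrightarrow> 1 powr (a + 1)) at_top"
    by (intro tendsto_powr ratio tendsto_const) simp
  then have lim: "((\<lambda>x. (\<psi> x / ln x) powr (a + 1)) \<longlongrightarrow> 1) at_top" by simp
  have "\<forall>\<^sub>F x in at_top. \<psi> x > 0" using \<psi>top by (simp add: filterlim_at_top_dense)
  moreover have "\<forall>\<^sub>F x in at_top. tail (x * \<phi> x) = \<phi> (x * \<phi> x)"
    using T xtop by (rule eventually_compose_filterlim)
  ultimately have "\<forall>\<^sub>F x in at_top. (\<psi> x / ln x) powr (a + 1) = tail (x * tail x) / tail x"
    using T ln_eq large
  proof eventually_elim
    case (elim x)
    have "tail (x * tail x) / tail x = (\<psi> x powr (a + 1) / (- a - 1)) / (ln x powr (a + 1) / (- a - 1))"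
      using elim by (simp add: \<phi>_def)
    also have "\<dots> = \<psi> x powr (a + 1) / ln x powr (a + 1)" using a by simp
    also have "\<dots> = (\<psi> x / ln x) powr (a + 1)" using elim by (simp add: powr_divide)
    finally show ?case by simp
  qed
  then have "((\<lambda>x. tail (x * tail x) / tail x) \<longlongrightarrow> 1) at_top"
    using lim by (rule Lim_transform_eventually[rotated])
  then show ?thesis by (rule asymp_equivI')
qed

end

lemma mono_num_edges: "mono (\<lambda>t. num_edges m t \<omega>)"
  unfolding num_edges_eq by (intro monoI emeasure_mono) (auto simp: edge_occurrences_def)

lemma mono_num_vertices: "mono (\<lambda>t. num_vertices m t \<omega>)"
proof (rule monoI)
  fix s t :: nat assume "s \<le> t"
  then have "active_vertices m s \<omega> \<subseteq> active_vertices m t \<omega>" unfolding active_vertices_def by fastforce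
  then show "num_vertices m s \<omega> \<le> num_vertices m t \<omega>" unfolding num_vertices_eq by (rule emeasure_mono) simp
qed

lemma (in poisson_multigraph) AE_growth_in_time:
  assumes L: "slowly_varying_tail L" and typical: "AE \<omega> in M. typical_weights L w \<omega>"
  shows "AE \<omega> in M.
     (\<exists>c>0. \<exists>C. \<forall>\<^sub>F t in sequentially. c * (real t * tail_integral L t) \<le> enn2real (num_vertices m t \<omega>) \<and>
        enn2real (num_vertices m t \<omega>) \<le> C * (real t * tail_integral L t)) \<and>
     (\<exists>d>0. \<exists>D. \<forall>\<^sub>F t in sequentially. d * real t \<le> enn2real (num_edges m t \<omega>) \<and> enn2real (num_edges m t \<omega>) \<le> D * real t)"
  using AE_num_vertices_growth[OF L typical] AE_num_edges_growth[OF L typical]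
proof eventually_elim
  case (elim \<omega>)
  interpret slowly_varying_tail L by fact
  obtain c C where c: "c > 0" "C > 0" "\<forall>\<^sub>F n in sequentially. ennreal (c * growth n) \<le> num_vertices m (2 ^ n) \<omega> \<and>
     num_vertices m (2 ^ n) \<omega> \<le> ennreal (C * growth n)"
    using elim(1) unfolding growth_def by blast
  have "\<forall>\<^sub>F t in sequentially. c / 2 * (real t * tail_integral L t) \<le> enn2real (num_vertices m t \<omega>) \<and>
        enn2real (num_vertices m t \<omega>) \<le> 2 * C * (real t * tail_integral L t)"
    by (rule dyadic_interpolation[OF mono_num_vertices c growth_dyadic])
  then have "\<exists>c>0. \<exists>C. \<forall>\<^sub>F t in sequentially. c * (real t * tail_integral L t) \<le> enn2real (num_vertices m t \<omega>) \<and>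
        enn2real (num_vertices m t \<omega>) \<le> C * (real t * tail_integral L t)"
    using c(1) by (intro exI[of _ "c / 2"] exI[of _ "2 * C"] conjI) auto
  moreover obtain d D where d: "d > 0" "D > 0" "\<forall>\<^sub>F n in sequentially. ennreal (d * 2 ^ n) \<le> num_edges m (2 ^ n) \<omega> \<and>
     num_edges m (2 ^ n) \<omega> \<le> ennreal (D * 2 ^ n)"
    using elim(2) by blast
  have "\<forall>\<^sub>F t in sequentially. d / 2 * real t \<le> enn2real (num_edges m t \<omega>) \<and>
        enn2real (num_edges m t \<omega>) \<le> 2 * D * real t"
  proof (rule dyadic_interpolation[OF mono_num_edges d])
    have "real t \<le> 2 * 2 ^ n \<and> (2::real) ^ Suc n \<le> 2 * real t \<and> (0::real) < 2 ^ Suc n" if "2 ^ n \<le> t \<and> t < 2 ^ Suc n" for n t :: nat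
    proof -
      have "real (2 ^ n) \<le> real t" "real t \<le> real (2 ^ Suc n)" using that by (simp_all only: of_nat_le_iff) auto
      then show ?thesis by simp
    qed
    then show "\<forall>\<^sub>F n in sequentially. \<forall>t. 2 ^ n \<le> t \<and> t < 2 ^ Suc n \<longrightarrow> real t \<le> 2 * 2 ^ n \<and> (2::real) ^ Suc n \<le> 2 * real t \<and> (0::real) < 2 ^ Suc n"
      by auto
  qed
  then have "\<exists>d>0. \<exists>D. \<forall>\<^sub>F t in sequentially. d * real t \<le> enn2real (num_edges m t \<omega>) \<and> enn2real (num_edges m t \<omega>) \<le> D * real t"
    using d(1) by (intro exI[of _ "d / 2"] exI[of _ "2 * D"] conjI) auto
  ultimately show ?case by blast
qed

theorem theorem3p1:
  fixes M :: "'a measure" and \<nu> :: "real measure"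
    and w :: "nat \<Rightarrow> 'a \<Rightarrow> real" and m :: "nat \<Rightarrow> nat set \<Rightarrow> 'a \<Rightarrow> bool"
    and f L :: "real \<Rightarrow> real" and c :: real
  assumes graph: "poisson_multigraph M \<nu> w m"
    and density_measurable: "f \<in> borel_measurable (restrict_space lborel {0..1})"
    and density_nonneg: "\<And>x. x \<in> {0..1} \<Longrightarrow> f x \<ge> 0"
    and density: "\<nu> = density (restrict_space lborel {0..1}) (\<lambda>x. ennreal (f x))"
    and c_pos: "c > 0"
    and slowly_varying: "slowly_varying L"
    and density_asymp: "f \<sim>[at_right 0] (\<lambda>x. c * x powr (-2) * L (1 / x))"
    and tail_finite: "\<forall>\<^sub>F x in at_top. set_integrable lborel {x..} (\<lambda>u. L u / u)"
  shows "((\<lambda>x. tail_integral L (x * tail_integral L x)) \<sim>[at_top] tail_integral L \<longrightarrow>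
            (AE \<omega> in M. (\<lambda>t. enn2real (num_edges m t \<omega>)) \<in>
               \<Theta>(\<lambda>t. enn2real (num_vertices m t \<omega>) /
                      tail_integral L (enn2real (num_vertices m t \<omega>)))))
       \<and> (\<forall>a < -1. (\<forall>\<^sub>F x in at_top. L x = ln x powr a) \<longrightarrow>
            (AE \<omega> in M. (\<lambda>t. enn2real (num_edges m t \<omega>)) \<in>
               \<Theta>(\<lambda>t. enn2real (num_vertices m t \<omega>) *
                      ln (enn2real (num_vertices m t \<omega>)) powr (- a - 1))))"
proof -
  interpret poisson_multigraph M \<nu> w m by (rule graph)
  have tail: "slowly_varying_tail L" using slowly_varying tail_finite by unfold_locales
  interpret slowly_varying_tail L by (rule tail)
  note growth = AE_growth_in_time[OF tail AE_typical_weights[OF tail density_measurable density c_pos density_asymp]]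
  have general: "AE \<omega> in M. (\<lambda>t. enn2real (num_edges m t \<omega>)) \<in>
      \<Theta>(\<lambda>t. enn2real (num_vertices m t \<omega>) / tail_integral L (enn2real (num_vertices m t \<omega>)))"
    if stable: "(\<lambda>x. tail_integral L (x * tail_integral L x)) \<sim>[at_top] tail_integral L"
    using growth
  proof eventually_elim
    case (elim \<omega>)
    then obtain b C d D where "b > 0" "\<forall>\<^sub>F t in sequentially. b * (real t * tail_integral L t) \<le> enn2real (num_vertices m t \<omega>) \<and>
        enn2real (num_vertices m t \<omega>) \<le> C * (real t * tail_integral L t)"
      "d > 0" "\<forall>\<^sub>F t in sequentially. d * real t \<le> enn2real (num_edges m t \<omega>) \<and> enn2real (num_edges m t \<omega>) \<le> D * real t"
      by blast
    then show ?case
      by (rule bigtheta_inversion[where x = "\<lambda>t. enn2real (num_vertices m t \<omega>)", OF stable])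
  qed
  have logarithmic: "AE \<omega> in M. (\<lambda>t. enn2real (num_edges m t \<omega>)) \<in>
      \<Theta>(\<lambda>t. enn2real (num_vertices m t \<omega>) * ln (enn2real (num_vertices m t \<omega>)) powr (- a - 1))"
    if a: "a < -1" and La: "\<forall>\<^sub>F x in at_top. L x = ln x powr a" for a
    using growth general[OF ln_powr_tail_stable[OF a La]]
  proof eventually_elim
    case (elim \<omega>)
    define N where "N t = enn2real (num_vertices m t \<omega>)" for t
    obtain c where c: "c > 0" "\<forall>\<^sub>F t in sequentially. c * (real t * tail_integral L t) \<le> N t"
      using elim(1) unfolding N_def eventually_conj_iff by blast
    have "filterlim (\<lambda>t. c * (real t * tail_integral L t)) at_top sequentially"
      by (rule filterlim_tendsto_pos_mult_at_top[OF tendsto_const c(1) time_tail_at_top])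
    then have Ntop: "filterlim N at_top sequentially" using c(2) by (rule filterlim_at_top_mono)
    have "\<forall>\<^sub>F t in sequentially. tail_integral L (N t) = ln (N t) powr (a + 1) / (- a - 1)"
      using tail_integral_ln_powr[OF a La] Ntop by (rule eventually_compose_filterlim)
    moreover have "\<forall>\<^sub>F t in sequentially. 1 < N t" using Ntop by (simp add: filterlim_at_top_dense)
    ultimately have "\<forall>\<^sub>F t in sequentially. N t / tail_integral L (N t) = (- a - 1) * (N t * ln (N t) powr (- a - 1))"
    proof eventually_elim
      case (elim t)
      have "ln (N t) powr (- a - 1) = 1 / ln (N t) powr (a + 1)"
        using powr_minus_divide[of "ln (N t)" "a + 1"] by simp
      then show ?case using elim by simp
    qed
    then have "(\<lambda>t. N t / tail_integral L (N t)) \<in> \<Theta>(\<lambda>t. (- a - 1) * (N t * ln (N t) powr (- a - 1)))"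
      by (rule bigthetaI_cong)
    also have "(\<lambda>t. (- a - 1) * (N t * ln (N t) powr (- a - 1))) \<in> \<Theta>(\<lambda>t. N t * ln (N t) powr (- a - 1))"
      using a by simp
    finally show ?case using elim(2) unfolding N_def by (rule landau_theta.trans[rotated])
  qed
  show ?thesis using general logarithmic by blast
qed

end
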